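(* In the setting of the context, with $0<T<\infty$ almost surely under $\mathcal{P}(dN|\rho,\eta)$: (i) If $\theta>0$ and $E[T^{-\theta}|\rho,\eta]<\infty$, then $\tilde{\mathcal{P}}(dP|\rho,\eta,\theta)=\int_0^\infty\mathcal{P}(dP|e^{-vh}\rho,\eta)\,\pi_\theta(dv|\rho,\eta)$. (ii) Let $n\ge1$ be an integer and $\theta$ real with $\theta+n>0$; if $\theta\neq0$ assume $E[T^{-\theta}|\rho,\eta]<\infty$ and $E[T^{-(\theta+n)}|\rho,\eta]<\infty$. If $P$ has law $\tilde{\mathcal{P}}(dP|\rho,\eta,\theta)$ (which is $\mathcal{P}(dP|\rho,\eta)$ when $\theta=0$), then $P$ is equal in distribution to the random probability measure $$p_n^*P^*(\cdot)+(1-p_n^* )\frac{\sum_{j=1}^{n(\mathbf{p})}h(J_{j,n})\delta_{Y_j^*}(\cdot)}{\sum_{j=1}^{n(\mathbf{p})}h(J_{j,n})},\qquad p_n^*=\frac{T^*}{T^*+\sum_{j=1}^{n(\mathbf{p})}h(J_{j,n})},\quad P^*=\frac{\mu^*}{T^*},\quad T^*=\mu^*(\mathcal{Y}),$$ where $(V,\mathbf{p})$ has law $\pi_{\theta+n,\theta}(dv,\mathbf{p}|\rho,\eta)$ and, given $(V,\mathbf{p})$ with $V=v$, $\mu^*$ has law $\mathcal{P}(d\mu|e^{-vh}\rho,\eta)$ and is independent of the pairs $(J_{j,n},Y_j^* )$, $j=1,\dots,n(\mathbf{p})$, which are independent of each other with joint law $\frac{h(s)^{e_{j,n}}e^{-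vh(s)}\rho(ds|y)\eta(dy)}{\kappa_{e_{j,n}}(e^{-vh}\Omega)}$.
   Context: $\mathcal{S},\mathcal{Y}$ are Polish spaces; $\eta$ is a $\sigma$-finite non-atomic measure on $\mathcal{Y}$; $\rho(ds|y)$ is a measurable kernel of ($\sigma$-finite) measures on $\mathcal{S}$; $h:\mathcal{S}\to(0,\infty)$ is measurable. $\mathcal{P}(dN|\rho,\eta)$ is the law of a Poisson random measure on $\mathcal{S}\times\mathcal{Y}$ with intensity $\rho(ds|y)\eta(dy)$; $\mu(dy)=\int_{\mathcal{S}}h(s)N(ds,dy)$ has law $\mathcal{P}(d\mu|\rho,\eta)$; $T=\mu(\mathcal{Y})$, a.s. finite; $P=\mu/T$. $E[\cdot|\rho,\eta]$ is expectation under $\mathcal{P}(dN|\rho,\eta)$. $\tilde{\mathcal{P}}(dN|\rho,\eta,\theta)=T^{-\theta}\mathcal{P}(dN|\rho,\eta)/E[T^{-\theta}|\rho,\eta]$. $\mathcal{P}(dP|\rho,\eta)$ and $\tilde{\mathcal{P}}(dP|\rho,\eta,\theta)$ are the laws of $P$ when $N$ has law $\mathcal{P}(dN|\rho,\eta)$, resp. $\tilde{\mathcal{P}}(dN|\rho,\eta,\theta)$. $e^{-vh}\rho$ is the kernel $e^{-vh(s)}\rho(ds|y)$. $\kappa_m(e^{-vh}\Omega)=\int_{\mathcal{Y}}\int_{\mathcal{S}}h(s)^me^{-vh(s)}\rho(ds|y)\eta(dy)$. Partitions $\mathbf{p}=\{C_1,\dots,C_{n(\mathbf{p})}\}$ of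 $\{1,\dots,n\}$ have cell sizes $e_{j,n}=|C_j|$. $\pi_\theta(dv|\rho,\eta)=\frac{v^{\theta-1}E[e^{-vT}|\rho,\eta]dv}{\Gamma(\theta)E[T^{-\theta}|\rho,\eta]}$ on $(0,\infty)$, and $\pi_{\theta+n,\theta}(dv,\mathbf{p}|\rho,\eta)=\frac{[\prod_{j=1}^{n(\mathbf{p})}\kappa_{e_{j,n}}(e^{-vh}\Omega)]v^{\theta+n-1}E[e^{-vT}|\rho,\eta]dv}{\Gamma(\theta+n)E[T^{-\theta}|\rho,\eta]}$, a probability distribution of $(V,\mathbf{p})$. *)

theory Defs
  imports "HOL-Probability.Probability"
begin

definition non_atomic :: "'a measure \<Rightarrow> bool" where
  "non_atomic M \<longleftrightarrow>
    (\<forall>A\<in>sets M. 0 < emeasure M A \<longrightarrow>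
      (\<exists>B\<in>sets M. B \<subseteq> A \<and> 0 < emeasure M B \<and> emeasure M B < emeasure M A))"

definition sigma_finite_kernel ::
  "('y::topological_space \<Rightarrow> 's::topological_space measure) \<Rightarrow> bool" where
  "sigma_finite_kernel \<rho> \<longleftrightarrow>
    (\<forall>y. sets (\<rho> y) = sets borel \<and> sigma_finite_measure (\<rho> y)) \<and>
    (\<forall>A\<in>sets borel. (\<lambda>y. emeasure (\<rho> y) A) \<in> borel_measurable borel)"


subsection \<open>Poisson random measures\<close>

text \<open>As in \<^const>\<open>subprob_algebra\<close>, the evaluations generate, but the measures may be infinite.\<close>

definition measure_algebra :: "'a measure \<Rightarrow> 'a measure measure" where
  "measure_algebra K =
    (SUP A \<in> sets K. vimage_algebra {M. sets M = sets K} (\<lambda>M. emeasure M A) borel)"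

text \<open>The Poisson probabilities are written out, rather than taken from
  \<^const>\<open>poisson_pmf\<close>, because the mean may be \<open>0\<close> (then \<open>N(A) = 0\<close> almost surely).\<close>

definition poisson_random_measure ::
  "'w measure \<Rightarrow> ('w \<Rightarrow> 'a measure) \<Rightarrow> 'a measure \<Rightarrow> bool" where
  "poisson_random_measure M N \<nu> \<longleftrightarrow>
    prob_space M \<and>
    N \<in> measurable M (measure_algebra \<nu>) \<and>
    (\<forall>A\<in>sets \<nu>.
      if emeasure \<nu> A = \<infinity> then AE \<omega> in M. emeasure (N \<omega>) A = \<infinity>
      else \<forall>k::nat. measure M {\<omega> \<in> space M. emeasure (N \<omega>) A = of_nat k} =
             measure \<nu> A ^ k / fact k * exp (- measure \<nu> A)) \<and>
    (\<forall>A::nat \<Rightarrow> 'a set. range A \<subseteq> sets \<nu> \<and> disjoint_family A \<longrightarrow>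
      prob_space.indep_vars M (\<lambda>_. borel) (\<lambda>i \<omega>. emeasure (N \<omega>) (A i)) UNIV)"

definition poisson_law :: "'a measure \<Rightarrow> 'a measure measure" where
  "poisson_law \<nu> =
    (THE L. sets L = sets (measure_algebra \<nu>) \<and> poisson_random_measure L (\<lambda>N. N) \<nu>)"

text \<open>The measure \<open>\<rho>(ds|y) \<eta>(dy)\<close>. If this set function were not countably additive, the result
  would be the null measure, for which \<open>N = 0\<close>.\<close>

definition intensity ::
  "('y::topological_space \<Rightarrow> 's::topological_space measure) \<Rightarrow> 'y measure \<Rightarrow> ('s \<times> 'y) measure"
where
  "intensity \<rho> \<eta> =
    measure_of UNIV (sets (borel \<Otimes>\<^sub>M borel)) (\<lambda>B. \<integral>\<^sup>+y. emeasure (\<rho> y) {s. (s, y) \<in> B} \<partial>\<eta>)"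

definition exp_tilt ::
  "real \<Rightarrow> ('s \<Rightarrow> real) \<Rightarrow> ('y \<Rightarrow> 's measure) \<Rightarrow> 'y \<Rightarrow> 's measure" where
  "exp_tilt v h \<rho> y = density (\<rho> y) (\<lambda>s. ennreal (exp (- v * h s)))"


subsection \<open>The random measure \<open>\<mu>\<close>, its total mass \<open>T\<close> and its normalization \<open>P\<close>\<close>

definition weighted_measure ::
  "('s \<Rightarrow> real) \<Rightarrow> ('s \<times> 'y::topological_space) measure \<Rightarrow> 'y measure" where
  "weighted_measure h N = distr (density N (\<lambda>(s, y). ennreal (h s))) borel snd"

definition total_mass ::
  "('s \<Rightarrow> real) \<Rightarrow> ('s \<times> 'y::topological_space) measure \<Rightarrow> ennreal" where
  "total_mass h N = emeasure (weighted_measure h N) UNIV"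

text \<open>The value is an arbitrary point mass on the null event where the total mass is \<open>0\<close> or
  \<open>\<infinity>\<close>, so that a normalized measure always lies in the space of probability measures.\<close>

definition normalized_measure :: "'y::topological_space measure \<Rightarrow> 'y measure" where
  "normalized_measure \<mu> =
    (if 0 < emeasure \<mu> UNIV \<and> emeasure \<mu> UNIV < \<infinity> then scale_measure (1 / emeasure \<mu> UNIV) \<mu>
     else return borel undefined)"

definition weighted_law ::
  "('s::topological_space \<Rightarrow> real) \<Rightarrow> ('y::topological_space \<Rightarrow> 's measure) \<Rightarrow> 'y measure \<Rightarrow>
   'y measure measure" where
  "weighted_law h \<rho> \<eta> =
    distr (poisson_law (intensity \<rho> \<eta>)) (measure_algebra borel) (weighted_measure h)"

definition normalized_law ::
  "('s \<Rightarrow> real) \<Rightarrow> ('s \<times> 'y::topological_space) measure measure \<Rightarrow> 'y measure measure" where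
  "normalized_law h L =
    distr L (prob_algebra borel) (\<lambda>N. normalized_measure (weighted_measure h N))"


subsection \<open>Moments and tilted laws\<close>

text \<open>\<^const>\<open>enn2real\<close> only changes \<open>T\<close> on the null event \<open>T = \<infinity>\<close>.\<close>

definition neg_power_mass ::
  "('s \<Rightarrow> real) \<Rightarrow> real \<Rightarrow> ('s \<times> 'y::topological_space) measure \<Rightarrow> ennreal" where
  "neg_power_mass h \<theta> N = ennreal (enn2real (total_mass h N) powr (- \<theta>))"

text \<open>\<open>E[T\<^sup>-\<^sup>\<theta> | \<rho>, \<eta>]\<close> and \<open>E[exp(-vT) | \<rho>, \<eta>]\<close>, with values in \<open>[0, \<infinity>]\<close>.\<close>

definition neg_moment ::
  "('s::topological_space \<Rightarrow> real) \<Rightarrow> ('y::topological_space \<Rightarrow> 's measure) \<Rightarrow> 'y measure \<Rightarrow>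
   real \<Rightarrow> ennreal" where
  "neg_moment h \<rho> \<eta> \<theta> = (\<integral>\<^sup>+N. neg_power_mass h \<theta> N \<partial>poisson_law (intensity \<rho> \<eta>))"

definition laplace_mass ::
  "('s::topological_space \<Rightarrow> real) \<Rightarrow> ('y::topological_space \<Rightarrow> 's measure) \<Rightarrow> 'y measure \<Rightarrow>
   real \<Rightarrow> ennreal" where
  "laplace_mass h \<rho> \<eta> v =
    (\<integral>\<^sup>+N. ennreal (exp (- v * enn2real (total_mass h N))) \<partial>poisson_law (intensity \<rho> \<eta>))"

definition tilted_law ::
  "('s::topological_space \<Rightarrow> real) \<Rightarrow> ('y::topological_space \<Rightarrow> 's measure) \<Rightarrow> 'y measure \<Rightarrow>
   real \<Rightarrow> ('s \<times> 'y) measure measure" where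
  "tilted_law h \<rho> \<eta> \<theta> =
    density (poisson_law (intensity \<rho> \<eta>)) (\<lambda>N. neg_power_mass h \<theta> N / neg_moment h \<rho> \<eta> \<theta>)"

definition kappa ::
  "('s \<Rightarrow> real) \<Rightarrow> ('y \<Rightarrow> 's measure) \<Rightarrow> 'y measure \<Rightarrow> nat \<Rightarrow> real \<Rightarrow> ennreal" where
  "kappa h \<rho> \<eta> m v = (\<integral>\<^sup>+y. (\<integral>\<^sup>+s. ennreal (h s ^ m * exp (- v * h s)) \<partial>\<rho> y) \<partial>\<eta>)"


subsection \<open>Mixing distributions\<close>

definition mixing_law ::
  "('s::topological_space \<Rightarrow> real) \<Rightarrow> ('y::topological_space \<Rightarrow> 's measure) \<Rightarrow> 'y measure \<Rightarrow>
   real \<Rightarrow> real measure" where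
  "mixing_law h \<rho> \<eta> \<theta> =
    density (restrict_space lborel {0<..})
      (\<lambda>v. ennreal (v powr (\<theta> - 1) / Gamma \<theta>) * laplace_mass h \<rho> \<eta> v / neg_moment h \<rho> \<eta> \<theta>)"

definition partition_mixing_law ::
  "('s::topological_space \<Rightarrow> real) \<Rightarrow> ('y::topological_space \<Rightarrow> 's measure) \<Rightarrow> 'y measure \<Rightarrow>
   nat \<Rightarrow> real \<Rightarrow> (real \<times> nat set set) measure" where
  "partition_mixing_law h \<rho> \<eta> n \<theta> =
    density (restrict_space lborel {0<..} \<Otimes>\<^sub>M count_space {p. partition_on {1..n} p})
      (\<lambda>(v, p). (\<Prod>C\<in>p. kappa h \<rho> \<eta> (card C) v) *
         ennreal (v powr (\<theta> + real n - 1) / Gamma (\<theta> + real n)) *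
         laplace_mass h \<rho> \<eta> v / neg_moment h \<rho> \<eta> \<theta>)"


subsection \<open>The representation given \<open>(V, p)\<close>\<close>

text \<open>Law of a pair \<open>(J, Y)\<close> attached to a cell of size \<open>m\<close>, given \<open>V = v\<close>.\<close>

definition jump_law ::
  "('s::topological_space \<Rightarrow> real) \<Rightarrow> ('y::topological_space \<Rightarrow> 's measure) \<Rightarrow> 'y measure \<Rightarrow>
   nat \<Rightarrow> real \<Rightarrow> ('s \<times> 'y) measure" where
  "jump_law h \<rho> \<eta> m v =
    density (intensity \<rho> \<eta>)
      (\<lambda>(s, y). ennreal (h s ^ m * exp (- v * h s)) / kappa h \<rho> \<eta> m v)"

text \<open>The pairs \<open>x C = (J, Y)\<close> are indexed by the cells \<open>C \<in> p\<close> themselves instead of by an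
  enumeration of the cells.\<close>

definition jump_mass :: "('s \<Rightarrow> real) \<Rightarrow> 'c set \<Rightarrow> ('c \<Rightarrow> 's \<times> 'y) \<Rightarrow> ennreal" where
  "jump_mass h p x = (\<Sum>C\<in>p. ennreal (h (fst (x C))))"

definition mixture_weight ::
  "('s \<Rightarrow> real) \<Rightarrow> 'c set \<Rightarrow> 'y measure \<Rightarrow> ('c \<Rightarrow> 's \<times> 'y) \<Rightarrow> ennreal" where
  "mixture_weight h p \<mu> x = emeasure \<mu> UNIV / (emeasure \<mu> UNIV + jump_mass h p x)"

definition jump_mixture ::
  "('s \<Rightarrow> real) \<Rightarrow> 'c set \<Rightarrow> 'y::topological_space measure \<Rightarrow> ('c \<Rightarrow> 's \<times> 'y) \<Rightarrow> 'y measure" where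
  "jump_mixture h p \<mu> x =
    measure_of UNIV (sets borel)
      (\<lambda>A. mixture_weight h p \<mu> x * emeasure (normalized_measure \<mu>) A +
        (1 - mixture_weight h p \<mu> x) *
          ((\<Sum>C\<in>p. ennreal (h (fst (x C))) * emeasure (return borel (snd (x C))) A) /
           jump_mass h p x))"

definition jump_mixture_law ::
  "('s::topological_space \<Rightarrow> real) \<Rightarrow> ('y::topological_space \<Rightarrow> 's measure) \<Rightarrow> 'y measure \<Rightarrow>
   real \<Rightarrow> nat set set \<Rightarrow> 'y measure measure" where
  "jump_mixture_law h \<rho> \<eta> v p =
    distr (weighted_law h (exp_tilt v h \<rho>) \<eta> \<Otimes>\<^sub>M (\<Pi>\<^sub>M C\<in>p. jump_law h \<rho> \<eta> (card C) v))
      (prob_algebra borel) (\<lambda>(\<mu>, x). jump_mixture h p \<mu> x)"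

end

theory Submission
  imports Defs
begin

text \<open>The law of a Poisson random measure with intensity \<open>\<nu>\<close> is characterized by its Laplace
  functional \<open>E[exp(-N(u))] = exp(-\<integral>(1 - exp(-u)) d\<nu>)\<close>. Reweighting by
  \<open>exp(-vT) / E[exp(-vT)]\<close>, \<open>T = N(h)\<close>, yields the Laplace functional for the intensity \<open>exp(-vh) \<nu>\<close>;
  in particular the tilted Poisson laws exist. Both parts then follow from
  \<open>T\<^sup>-\<^sup>\<theta> = \<integral> v\<^sup>\<theta>\<^sup>+\<^sup>n\<^sup>-\<^sup>1 T\<^sup>n exp(-vT) dv / \<Gamma>(\<theta> + n)\<close> and Fubini, with \<open>n = 0\<close> for (i). For
  (ii), iterating the Mecke equation \<open>E[N(f) F(N)] = \<integral> f(x) E[F(N + \<delta>\<^sub>x)] \<nu>(dx)\<close> expands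
  \<open>E[T\<^sup>n F(N)]\<close> into a sum over the partitions of \<open>{1..n}\<close>, where every cell \<open>C\<close> contributes an atom
  of \<open>h\<^bsup>|C|\<^esup> \<nu>\<close>, and normalizing \<open>N\<close> with these atoms added gives the stated mixture.

  The kernel is only pointwise \<open>\<sigma>\<close>-finite, so it is \<open>T\<close> that controls the intensity: \<open>T > 0\<close>
  excludes that \<open>\<nu>\<close> is null, and \<open>T < \<infinity>\<close> forces \<open>\<integral>(1 - exp(-h)) d\<nu> < \<infinity>\<close>.\<close>

subsection \<open>Laplace transforms on \<open>[0, \<infinity>]\<close>\<close>

text \<open>\<open>N\<close> may have infinite mass, and \<nu> is not known to be \<sigma>-finite
  until T < \<infinity> has been used, so all identities live in [0, \<infinity>]; with
  \<open>nexp \<infinity> = 0\<close> the Laplace formula holds for every measurable u.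
  \<open>poisson_law\<close> is a definite description, so each use of it needs existence and
  uniqueness. For the original intensity existence is supplied by the given \<open>N\<close>; for
  the tilted ones it is the converse of the Laplace formula, that a law with this functional has
  independent Poisson counts. Uniqueness, this converse and the Mecke equation for general F rest on
  one fact: a finite measure on [0, \<infinity>] is determined by its Laplace transform at the
  natural numbers, since \<open>exp (- x)\<close> turns this into the Hausdorff moment problem on
  [0, 1]. The normalizing constants of the components, E[exp(-vT)] and the products of \<kappa>,
  occur as factors in the mixing densities. Their cancellation needs them positive and finite, which
  comes from 0 < T < \<infinity>: for \<kappa>, finiteness follows from bounding h^m exp(-vh), m
  \<ge> 1, by a multiple of 1 - exp(-h).\<close>

definition nexp :: "ennreal \<Rightarrow> ennreal" where
  "nexp x = (if x = \<infinity> then 0 else ennreal (exp (- enn2real x)))"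

lemma nexp_0 [simp]: "nexp 0 = 1"
  by (simp add: nexp_def)

lemma nexp_top [simp]: "nexp \<top> = 0"
  by (simp add: nexp_def)

lemma nexp_ennreal: "0 \<le> r \<Longrightarrow> nexp (ennreal r) = ennreal (exp (- r))"
  by (simp add: nexp_def)

lemma nexp_measurable [measurable]: "nexp \<in> borel_measurable borel"
  unfolding nexp_def by measurable

lemma nexp_le_1: "nexp x \<le> 1"
  by (simp add: nexp_def flip: ennreal_1)

lemma nexp_less_top [simp]: "nexp x < \<top>" "nexp x \<noteq> \<top>"
  by (simp_all add: nexp_def)

lemma nexp_add: "nexp (x + y) = nexp x * nexp y"
  by (cases x; cases y) (auto simp: nexp_ennreal exp_add ennreal_mult exp_minus exp_diff divide_inverse simp flip: ennreal_plus)

lemma nexp_sum: "nexp (\<Sum>i\<in>I. f i) = (\<Prod>i\<in>I. nexp (f i))"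
  by (induction I rule: infinite_finite_induct) (auto simp: nexp_add)

lemma nexp_of_nat_mult: "nexp (of_nat n * x) = nexp x ^ n"
  by (induction n) (auto simp: nexp_add distrib_right)

lemma nexp_mono: "x \<le> y \<Longrightarrow> nexp y \<le> nexp x"
  by (cases x; cases y) (auto simp: nexp_ennreal top_unique)

lemma nexp_eq_0_iff [simp]: "nexp x = 0 \<longleftrightarrow> x = \<top>"
  by (auto simp: nexp_def)

lemma nexp_eq_1_iff [simp]: "nexp x = 1 \<longleftrightarrow> x = 0"
  by (cases x) (auto simp: nexp_ennreal ennreal_eq_1)

text \<open>Since \<open>exp r \<ge> 1 + r\<close>. It serves to squeeze \<open>nexp\<close> to 0 at
  \<infinity>, where the continuity of the real exponential gives nothing.\<close>

lemma nexp_le_inverse: "nexp x \<le> inverse x"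
proof (cases x)
  case (real r)
  show ?thesis
  proof (cases "r = 0")
    case False
    then have r: "0 < r" using real by simp
    have "exp (- r) \<le> inverse r"
      using exp_ge_add_one_self[of r] r unfolding exp_minus by (intro le_imp_inverse_le) linarith+
    then show ?thesis
      using real r by (simp add: nexp_ennreal inverse_ennreal)
  qed (use real in simp)
qed simp

lemma tendsto_nexp:
  assumes "(f \<longlongrightarrow> x) F"
  shows "((\<lambda>i. nexp (f i)) \<longlongrightarrow> nexp x) F"
proof (cases "x = \<top>")
  case True
  have "((\<lambda>i. inverse (f i)) \<longlongrightarrow> inverse x) F"
    by (rule continuous_on_tendsto_compose[where g=f and s=UNIV and f="inverse"])
      (use continuous_on_inverse_ennreal[where f="\<lambda>x. x"] assms in simp_all)
  then have "((\<lambda>i. inverse (f i)) \<longlongrightarrow> 0) F"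
    using True by simp
  then have "((\<lambda>i. nexp (f i)) \<longlongrightarrow> 0) F"
    by (rule tendsto_sandwich[where f="\<lambda>_. 0", rotated 3]) (simp_all add: nexp_le_inverse)
  then show ?thesis
    using True by simp
next
  case False
  then obtain r where r: "x = ennreal r" "0 \<le> r" by (cases x) auto
  have "((\<lambda>i. ennreal (exp (- enn2real (f i)))) \<longlongrightarrow> ennreal (exp (- enn2real x))) F"
    using assms False by (intro tendsto_intros) (auto simp: r)
  moreover have "\<forall>\<^sub>F i in F. nexp (f i) = ennreal (exp (- enn2real (f i)))"
    using order_tendstoD(2)[OF assms, of \<top>] r
    by (auto simp: nexp_def elim!: eventually_mono)
  ultimately show ?thesis
    using False by (simp add: nexp_def tendsto_cong)
qed

text \<open>An explicit left inverse of \<open>nexp\<close>: transporting a measure along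
  \<open>nexp\<close> therefore loses no information.\<close>

lemma nexp_inverse: "x = (if enn2real (nexp x) \<le> 0 then \<infinity> else ennreal (- ln (enn2real (nexp x))))"
  by (cases x) (auto simp: nexp_ennreal not_le)

text \<open>Uniqueness in the Hausdorff moment problem. On [0, 1] all moments are at most 1, so the
  Taylor polynomials of the characteristic function, whose coefficients are given by the moments,
  converge to it for every \<open>t\<close>; Levy's uniqueness theorem concludes.\<close>

lemma moments_unique:
  fixes M1 M2 :: "real measure"
  assumes "real_distribution M1" "real_distribution M2"
    and "AE x in M1. x \<in> {0..1}" "AE x in M2. x \<in> {0..1}"
    and eq: "\<And>k::nat. (\<integral>x. x ^ k \<partial>M1) = (\<integral>x. x ^ k \<partial>M2)"
  shows "M1 = M2"
proof (rule Levy_uniqueness)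
  have approx: "cmod (char M t - (\<Sum>k \<le> n. ((\<i> * t)^k / fact k) * complex_of_real (\<integral>x. x ^ k \<partial>M)))
      \<le> 2 * (\<bar>t\<bar> ^ n / fact n)"
    if M: "real_distribution M" and AE: "AE x in M. x \<in> {0..1}" for M t n
  proof -
    interpret real_distribution M by fact
    have int: "integrable M (\<lambda>x. x ^ k)" for k
      by (intro integrable_const_bound[of _ 1] eventually_mono[OF AE]) (auto intro!: power_le_one)
    have "expectation (\<lambda>x. \<bar>x\<bar> ^ n) \<le> expectation (\<lambda>x. 1)"
      using int[of n]
      by (intro integral_mono_AE eventually_mono[OF AE]) (auto simp: power_abs power_le_one simp flip: power_abs)
    then have "(2 * \<bar>t\<bar> ^ n / fact n) * expectation (\<lambda>x. \<bar>x\<bar> ^ n) \<le> (2 * \<bar>t\<bar> ^ n / fact n) * 1"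
      by (intro mult_left_mono) (auto simp: prob_space[unfolded space_eq_univ])
    with char_approx1[of n t] int show ?thesis
      by (auto intro: order_trans)
  qed
  show "char M1 = char M2"
  proof
    fix t
    \<comment> \<open>Equal moments give equal Taylor polynomials, so only the two remainders are
      left; they vanish as terms of the exponential series.\<close>
    have "dist (char M1 t) (char M2 t) \<le> 4 * (\<bar>t\<bar> ^ n / fact n)" for n
      using norm_triangle_mono[OF approx[OF assms(1,3), of t n]
          approx[OF assms(2,4), of t n, unfolded norm_minus_commute[of "char M2 t"]]]
      by (simp add: eq dist_norm)
    moreover have "(\<lambda>n. 4 * (\<bar>t\<bar> ^ n / fact n)) \<longlonglongrightarrow> 4 * 0"
      using summable_LIMSEQ_zero[OF summable_exp[of "\<bar>t\<bar>"]]
      by (intro tendsto_intros) (simp add: field_simps)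
    ultimately have "dist (char M1 t) (char M2 t) \<le> 4 * 0"
      by (intro LIMSEQ_le_const) auto
    then show "char M1 t = char M2 t" by simp
  qed
qed fact+

text \<open>The substitution \<open>y = exp (- x)\<close> sends [0, \<infinity>] injectively into
  [0, 1] and turns the Laplace transform at \<open>n\<close> into the \<open>n\<close>-th moment, so
  integer arguments suffice.\<close>

lemma measure_eq_if_laplace_eq:
  fixes M1 M2 :: "ennreal measure"
  assumes "finite_measure M1" "finite_measure M2"
    and sets [measurable_cong]: "sets M1 = sets borel" "sets M2 = sets borel"
    and eq: "\<And>n. (\<integral>\<^sup>+x. nexp (of_nat n * x) \<partial>M1) = (\<integral>\<^sup>+x. nexp (of_nat n * x) \<partial>M2)"
  shows "M1 = M2"
proof (rule measure_eqI)
  fix B assume "B \<in> sets M1"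
  then have [measurable]: "B \<in> sets borel" by (simp add: sets)
  interpret M1: finite_measure M1 by fact
  interpret M2: finite_measure M2 by fact
  have space: "space M1 = UNIV" "space M2 = UNIV"
    using sets[THEN sets_eq_imp_space_eq] by auto
  define c where "c = emeasure M1 UNIV"
  \<comment> \<open>The argument \<open>n = 0\<close> shows that the total masses agree;
    \<open>c\<close> is this common value, by which the measures are normalized below when it is
    positive.\<close>
  have c: "emeasure M1 UNIV = c" "emeasure M2 UNIV = c" "c < \<top>"
    using eq[of 0] M1.emeasure_finite[of UNIV] by (simp_all add: c_def less_top[symmetric] space)
  show "emeasure M1 B = emeasure M2 B"
  proof (cases "c = 0")
    case True
    have "emeasure M1 B \<le> c" "emeasure M2 B \<le> c"
      unfolding c(1)[symmetric] by (auto intro!: emeasure_mono simp: sets)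
        (auto simp: c intro!: emeasure_mono simp: sets simp flip: c(2))
    with True show ?thesis by simp
  next
    case False
    define Y :: "ennreal \<Rightarrow> real" where "Y x = enn2real (nexp x)" for x
    define g :: "real \<Rightarrow> ennreal" where "g y = (if y \<le> 0 then \<infinity> else ennreal (- ln y))" for y
    have [measurable]: "Y \<in> borel_measurable borel" "g \<in> borel_measurable borel"
      unfolding Y_def g_def by measurable
    have gY: "g (Y x) = x" for x
      using nexp_inverse[of x] by (simp add: g_def Y_def)
    have Y01: "0 \<le> Y x" "Y x \<le> 1" for x
      using nexp_le_1[of x] enn2real_mono[of "nexp x" 1] by (auto simp: Y_def)
    define D where "D M = distr (scale_measure (1 / c) M) borel Y" for M
    have real_distr: "real_distribution (D M)"
      if "emeasure M UNIV = c" and [measurable_cong]: "sets M = sets borel" for M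
    proof -
      have "prob_space (scale_measure (1 / c) M)"
        using that c(3) False sets_eq_imp_space_eq[OF that(2)]
        by (intro prob_spaceI) (simp add: space_scale_measure ennreal_divide_times)
      then show ?thesis
        unfolding D_def by (intro prob_space.real_distribution_distr) (auto simp: that)
    qed
    have mom: "(\<integral>x. x ^ k \<partial>D M) = enn2real (1 / c * (\<integral>\<^sup>+x. nexp (of_nat k * x) \<partial>M))"
      if [measurable_cong]: "sets M = sets borel" for k M
    proof -
      have "ennreal (Y x ^ k) = nexp (of_nat k * x)" for x
        by (simp add: nexp_of_nat_mult Y_def flip: ennreal_power)
      then show ?thesis
        unfolding D_def
        by (simp add: integral_distr integral_eq_nn_integral Y01 nn_integral_scale_measure)
    qed
    have AE: "AE x in D M. x \<in> {0..1}" if [measurable_cong]: "sets M = sets borel" for M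
      unfolding D_def by (subst AE_distr_iff) (auto simp: Y01)
    have "D M1 = D M2"
      by (rule moments_unique) (simp_all only: real_distr c sets mom eq AE)
    \<comment> \<open>As \<open>g\<close> inverts \<open>Y\<close>, every Borel set \<open>B\<close>
      is the preimage under \<open>Y\<close> of a Borel set, namely of its preimage under
      \<open>g\<close>.\<close>
    then have "emeasure (D M1) (g -` B) = emeasure (D M2) (g -` B)" by simp
    then show ?thesis
      using c(3) False measurable_sets_borel[of g borel B]
      by (simp add: D_def emeasure_distr sets space vimage_comp comp_def gY
          ennreal_mult_cancel_left ennreal_divide_eq_top_iff)
        auto
  qed
qed (simp add: sets)

lemma finite_measure_density_le_1:
  assumes "finite_measure M" and [measurable]: "W \<in> borel_measurable M" and "\<And>\<omega>. W \<omega> \<le> 1"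
  shows "finite_measure (density M W)"
proof (rule finite_measureI)
  have "(\<integral>\<^sup>+\<omega>. W \<omega> \<partial>M) \<le> (\<integral>\<^sup>+\<omega>. 1 \<partial>M)"
    by (intro nn_integral_mono assms)
  then show "emeasure (density M W) (space (density M W)) \<noteq> \<infinity>"
    using finite_measure.emeasure_finite[OF assms(1), of "space M"]
    by (auto simp: emeasure_density top_unique cong: nn_integral_cong_simp)
qed

text \<open>The uniqueness theorem in the form in which it is applied. Weights bounded by 1 keep the
  weighted image measures finite, and the two sides may live on different spaces, so that
  \<open>N(A)\<close> can be compared with an explicit distribution on the naturals.\<close>

lemma nn_integral_indicator_eq_if_laplace_eq:
  fixes X1 W1 :: "'a \<Rightarrow> ennreal" and X2 W2 :: "'b \<Rightarrow> ennreal"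
  assumes "finite_measure M1" "finite_measure M2"
    and [measurable]: "X1 \<in> borel_measurable M1" "X2 \<in> borel_measurable M2"
      "W1 \<in> borel_measurable M1" "W2 \<in> borel_measurable M2"
    and W: "\<And>\<omega>. W1 \<omega> \<le> 1" "\<And>\<omega>. W2 \<omega> \<le> 1"
    and eq: "\<And>n. (\<integral>\<^sup>+\<omega>. W1 \<omega> * nexp (of_nat n * X1 \<omega>) \<partial>M1) = (\<integral>\<^sup>+\<omega>. W2 \<omega> * nexp (of_nat n * X2 \<omega>) \<partial>M2)"
    and [measurable]: "B \<in> sets borel"
  shows "(\<integral>\<^sup>+\<omega>. W1 \<omega> * indicator B (X1 \<omega>) \<partial>M1) = (\<integral>\<^sup>+\<omega>. W2 \<omega> * indicator B (X2 \<omega>) \<partial>M2)"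
proof -
  have "distr (density M1 W1) borel X1 = distr (density M2 W2) borel X2"
    using eq by (intro measure_eq_if_laplace_eq finite_measure.finite_measure_distr finite_measure_density_le_1 assms)
      (simp_all add: nn_integral_distr nn_integral_density)
  from arg_cong[OF this, of "\<lambda>D. \<integral>\<^sup>+x. indicator B x \<partial>D"] show ?thesis
    by (simp add: nn_integral_distr nn_integral_density del: nn_integral_indicator)
qed

subsection \<open>Spaces of measures\<close>

lemma space_measure_algebra: "space (measure_algebra K) = {M. sets M = sets K}"
  by (auto simp: measure_algebra_def space_Sup_eq_UN)

lemma measure_algebra_cong: "sets K = sets K' \<Longrightarrow> measure_algebra K = measure_algebra K'"
  by (simp add: measure_algebra_def)

lemma space_measure_algebraD:
  "N \<in> space (measure_algebra K) \<Longrightarrow> sets N = sets K"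
  "N \<in> space (measure_algebra K) \<Longrightarrow> space N = space K"
  by (auto simp: space_measure_algebra dest: sets_eq_imp_space_eq)

lemma measurable_emeasure_measure_algebra [measurable]:
  "A \<in> sets K \<Longrightarrow> (\<lambda>N. emeasure N A) \<in> borel_measurable (measure_algebra K)"
  by (auto intro!: measurable_Sup1 measurable_vimage_algebra1 simp: measure_algebra_def)

lemma measurable_measure_algebra:
  "(\<And>\<omega>. \<omega> \<in> space M \<Longrightarrow> sets (f \<omega>) = sets K) \<Longrightarrow>
   (\<And>A. A \<in> sets K \<Longrightarrow> (\<lambda>\<omega>. emeasure (f \<omega>) A) \<in> borel_measurable M) \<Longrightarrow>
   f \<in> measurable M (measure_algebra K)"
  by (auto intro!: measurable_Sup2 measurable_vimage_algebra2 simp: measure_algebra_def)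

lemma nn_integral_measurable_measure_algebra [measurable]:
  assumes "f \<in> borel_measurable K"
  shows "(\<lambda>N. integral\<^sup>N N f) \<in> borel_measurable (measure_algebra K)" (is "_ \<in> ?B")
  using assms
proof induct
  case (cong f g)
  moreover have "(\<lambda>N. integral\<^sup>N N f) \<in> ?B \<longleftrightarrow> (\<lambda>N. integral\<^sup>N N g) \<in> ?B"
    by (intro measurable_cong nn_integral_cong cong) (simp add: space_measure_algebraD)
  ultimately show ?case by simp
next
  case (set A)
  then have "(\<lambda>N. \<integral>\<^sup>+x. indicator A x \<partial>N) \<in> ?B \<longleftrightarrow> (\<lambda>N. emeasure N A) \<in> ?B"
    by (intro measurable_cong nn_integral_indicator) (simp add: space_measure_algebra)
  with set show ?case by simp
next
  case (mult f c)
  then have "(\<lambda>N. \<integral>\<^sup>+x. c * f x \<partial>N) \<in> ?B \<longleftrightarrow> (\<lambda>N. c * (\<integral>\<^sup>+x. f x \<partial>N)) \<in> ?B"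
    by (intro measurable_cong nn_integral_cmult)
      (simp add: space_measure_algebraD cong: measurable_cong_sets)
  with mult show ?case by simp
next
  case (add f g)
  then have "(\<lambda>N. \<integral>\<^sup>+x. g x + f x \<partial>N) \<in> ?B \<longleftrightarrow> (\<lambda>N. (\<integral>\<^sup>+x. g x \<partial>N) + (\<integral>\<^sup>+x. f x \<partial>N)) \<in> ?B"
    by (intro measurable_cong nn_integral_add)
      (simp_all add: space_measure_algebraD cong: measurable_cong_sets)
  with add show ?case by simp
next
  case (seq F)
  then have "(\<lambda>N. \<integral>\<^sup>+x. (SUP i. F i) x \<partial>N) \<in> ?B \<longleftrightarrow> (\<lambda>N. SUP i. (\<integral>\<^sup>+x. F i x \<partial>N)) \<in> ?B"
    unfolding SUP_apply
    by (intro measurable_cong nn_integral_monotone_convergence_SUP)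
      (auto simp: space_measure_algebraD cong: measurable_cong_sets)
  with seq show ?case by (simp add: ac_simps)
qed

definition laplace_functional :: "'a measure measure \<Rightarrow> ('a \<Rightarrow> ennreal) \<Rightarrow> ennreal" where
  "laplace_functional L u = (\<integral>\<^sup>+N. nexp (\<integral>\<^sup>+x. u x \<partial>N) \<partial>L)"

lemma nexp_integral_add_indicator:
  assumes "sets N = sets K" "u \<in> borel_measurable K" "A \<in> sets K"
  shows "nexp (\<integral>\<^sup>+x. u x + of_nat n * indicator A x \<partial>N) =
    nexp (\<integral>\<^sup>+x. u x \<partial>N) * nexp (of_nat n * emeasure N A)"
  using assms by (subst nn_integral_add)
    (auto simp: nexp_add nn_integral_cmult cong: measurable_cong_sets)

lemma prod_le_one_ennreal:
  fixes f :: "'i \<Rightarrow> ennreal"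
  shows "(\<And>i. i \<in> I \<Longrightarrow> f i \<le> 1) \<Longrightarrow> (\<Prod>i\<in>I. f i) \<le> 1"
  by (induction I rule: infinite_finite_induct) (auto intro: mult_le_one)

text \<open>By induction on \<open>J\<close>: factors \<open>nexp (n * N(A i))\<close> can be absorbed into \<open>u\<close>, and such
  Laplace transforms determine the integral with the factor \<open>indicator (B i) (N(A i))\<close> instead.\<close>

lemma joint_law_eq_if_laplace_eq:
  assumes K: "finite_measure K1" "finite_measure K2"
    and [measurable_cong]: "sets K1 = sets (measure_algebra \<nu>)" "sets K2 = sets (measure_algebra \<nu>)"
    and eq: "\<And>u. u \<in> borel_measurable \<nu> \<Longrightarrow> laplace_functional K1 u = laplace_functional K2 u"
    and "finite J" and "\<And>i. i \<in> J \<Longrightarrow> A i \<in> sets \<nu>" and "\<And>i. i \<in> J \<Longrightarrow> B i \<in> sets borel"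
    and "u \<in> borel_measurable \<nu>"
  shows "(\<integral>\<^sup>+N. (\<Prod>i\<in>J. indicator (B i) (emeasure N (A i))) * nexp (\<integral>\<^sup>+x. u x \<partial>N) \<partial>K1) =
    (\<integral>\<^sup>+N. (\<Prod>i\<in>J. indicator (B i) (emeasure N (A i))) * nexp (\<integral>\<^sup>+x. u x \<partial>N) \<partial>K2)"
  using assms(6-)
proof (induction J arbitrary: u)
  case empty
  then show ?case using eq by (simp add: laplace_functional_def)
next
  case (insert i J)
  note [measurable] = insert.prems(3)
  have [measurable]: "A j \<in> sets \<nu>" "B j \<in> sets borel" if "j \<in> insert i J" for j
    using insert.prems that by auto
  let ?W = "\<lambda>N. (\<Prod>j\<in>J. indicator (B j) (emeasure N (A j))) * nexp (\<integral>\<^sup>+x. u x \<partial>N)"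
  have IH: "(\<integral>\<^sup>+N. ?W N * nexp (of_nat n * emeasure N (A i)) \<partial>K1) =
      (\<integral>\<^sup>+N. ?W N * nexp (of_nat n * emeasure N (A i)) \<partial>K2)" for n
  proof -
    have "(\<integral>\<^sup>+N. ?W N * nexp (of_nat n * emeasure N (A i)) \<partial>K) =
       (\<integral>\<^sup>+N. (\<Prod>j\<in>J. indicator (B j) (emeasure N (A j))) *
          nexp (\<integral>\<^sup>+x. u x + of_nat n * indicator (A i) x \<partial>N) \<partial>K)"
      if "sets K = sets (measure_algebra \<nu>)" for K
      using sets_eq_imp_space_eq[OF that] insert.prems
      by (intro nn_integral_cong)
        (simp add: nexp_integral_add_indicator space_measure_algebraD mult.assoc)
    then show ?thesis
      using insert.prems assms(3,4) by (simp add: insert.IH)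
  qed
  have W: "?W N \<le> 1" for N
    by (intro mult_le_one prod_le_one_ennreal nexp_le_1) (auto simp: indicator_def)
  have "(\<integral>\<^sup>+N. ?W N * indicator (B i) (emeasure N (A i)) \<partial>K1) =
      (\<integral>\<^sup>+N. ?W N * indicator (B i) (emeasure N (A i)) \<partial>K2)"
    by (rule nn_integral_indicator_eq_if_laplace_eq[OF K _ _ _ _ W W IH]) measurable
  then show ?case
    using insert.hyps by (simp add: ac_simps)
qed

lemma prod_indicator_eq:
  "finite J \<Longrightarrow> (\<Prod>i\<in>J. indicator (B i) (f i)) = (if \<forall>i\<in>J. f i \<in> B i then 1 else 0 :: ennreal)"
  by (induction J rule: finite_induct) (auto simp: indicator_def)

text \<open>The cylinders given by finitely many conditions \<open>N(A) \<in> B\<close> form a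
  \<pi>-system generating the \<sigma>-algebra, and the preceding lemma on joint laws, with
  \<open>u = 0\<close>, shows that both measures agree on them.\<close>

lemma measure_algebra_eqI:
  assumes K: "finite_measure K1" "finite_measure K2"
    and sets: "sets K1 = sets (measure_algebra \<nu>)" "sets K2 = sets (measure_algebra \<nu>)"
    and eq: "\<And>u. u \<in> borel_measurable \<nu> \<Longrightarrow> laplace_functional K1 u = laplace_functional K2 u"
  shows "K1 = K2"
proof -
  let ?\<Omega> = "space (measure_algebra \<nu>)"
  \<comment> \<open>Indexing a cylinder by a set of pairs makes the intersection of cylinders
    correspond to the union of index sets, and lets the same \<open>A\<close> occur with several
    \<open>B\<close>.\<close>
  define cyl where "cyl J = {N \<in> ?\<Omega>. \<forall>(A, B)\<in>J. emeasure N A \<in> B}"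
    for J :: "('a set \<times> ennreal set) set"
  define E where "E = cyl ` {J. finite J \<and> J \<subseteq> sets \<nu> \<times> sets borel}"
  note [measurable_cong] = sets
  have space: "space K1 = ?\<Omega>" "space K2 = ?\<Omega>"
    using sets[THEN sets_eq_imp_space_eq] by auto
  have cyl_sets: "cyl J \<in> sets (measure_algebra \<nu>)" if "finite J" "J \<subseteq> sets \<nu> \<times> sets borel" for J
  proof -
    have "{N \<in> ?\<Omega>. emeasure N (fst i) \<in> snd i} \<in> sets (measure_algebra \<nu>)" if "i \<in> J" for i
    proof -
      have [measurable]: "fst i \<in> sets \<nu>" "snd i \<in> sets borel"
        using \<open>i \<in> J\<close> \<open>J \<subseteq> _\<close> by auto
      show ?thesis by measurable
    qed
    then have "{N \<in> ?\<Omega>. \<forall>i\<in>J. emeasure N (fst i) \<in> snd i} \<in> sets (measure_algebra \<nu>)"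
      using \<open>finite J\<close> by (intro sets.sets_Collect_finite_All) auto
    then show ?thesis by (simp add: cyl_def case_prod_unfold)
  qed
  show ?thesis
  proof (rule measure_eqI_generator_eq[where E=E and \<Omega>="?\<Omega>" and A="\<lambda>_. ?\<Omega>"])
    have "cyl J \<inter> cyl J' = cyl (J \<union> J')" for J J'
      by (auto simp: cyl_def)
    then show "Int_stable E"
      by (auto simp: Int_stable_def E_def)
    show "E \<subseteq> Pow ?\<Omega>" by (auto simp: E_def cyl_def)
    have "cyl {} = ?\<Omega>" by (simp add: cyl_def)
    then show "range (\<lambda>_. ?\<Omega>) \<subseteq> E" by (auto simp: E_def image_iff intro!: exI[of _ "{}"])
    show "emeasure K1 ?\<Omega> \<noteq> \<infinity>" for i :: nat
      using finite_measure.emeasure_finite[OF K(1)] by simp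
    have "sets (measure_algebra \<nu>) = sigma_sets ?\<Omega> E"
    proof (intro antisym)
      interpret S: sigma_algebra ?\<Omega> "sigma_sets ?\<Omega> E"
        by (rule sigma_algebra_sigma_sets) (auto simp: E_def cyl_def)
      \<comment> \<open>That \<open>E\<close> generates is expressed as measurability of the
        identity: its evaluations need only cylinders with a single condition.\<close>
      have "(\<lambda>N. N) \<in> measurable (sigma ?\<Omega> E) (measure_algebra \<nu>)"
      proof (rule measurable_measure_algebra)
        show "N \<in> space (sigma ?\<Omega> E) \<Longrightarrow> sets N = sets \<nu>" for N
          using \<open>E \<subseteq> Pow ?\<Omega>\<close> by (simp add: space_measure_algebraD space_measure_of_conv)
        show "(\<lambda>N. emeasure N A) \<in> borel_measurable (sigma ?\<Omega> E)" if "A \<in> sets \<nu>" for A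
        proof (rule measurableI)
          fix B :: "ennreal set" assume "B \<in> sets borel"
          then have "cyl {(A, B)} \<in> E" using that by (auto simp: E_def)
          moreover have "(\<lambda>N. emeasure N A) -` B \<inter> ?\<Omega> = cyl {(A, B)}" by (auto simp: cyl_def)
          ultimately show "(\<lambda>N. emeasure N A) -` B \<inter> space (sigma ?\<Omega> E) \<in> sets (sigma ?\<Omega> E)"
            using \<open>E \<subseteq> Pow ?\<Omega>\<close> by (simp add: space_measure_of_conv)
        qed simp
      qed
      from measurable_sets[OF this] \<open>E \<subseteq> Pow ?\<Omega>\<close>
      show "sets (measure_algebra \<nu>) \<subseteq> sigma_sets ?\<Omega> E"
        by (auto simp: space_measure_of_conv dest: sets.sets_into_space)
      show "sigma_sets ?\<Omega> E \<subseteq> sets (measure_algebra \<nu>)"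
        using cyl_sets by (intro sets.sigma_sets_subset) (auto simp: E_def)
    qed
    then show "sets K1 = sigma_sets ?\<Omega> E" "sets K2 = sigma_sets ?\<Omega> E" by (simp_all add: sets)
    fix X assume "X \<in> E"
    then obtain J where J: "X = cyl J" "finite J" "J \<subseteq> sets \<nu> \<times> sets borel" by (auto simp: E_def)
    have *: "emeasure K X = (\<integral>\<^sup>+N. (\<Prod>i\<in>J. indicator (snd i) (emeasure N (fst i))) * nexp (\<integral>\<^sup>+x. 0 \<partial>N) \<partial>K)"
      if "sets K = sets (measure_algebra \<nu>)" for K
    proof -
      have "emeasure K X = (\<integral>\<^sup>+N. indicator X N \<partial>K)"
        using cyl_sets[OF J(2,3)] by (simp add: J(1) that)
      also have "\<dots> = (\<integral>\<^sup>+N. (\<Prod>i\<in>J. indicator (snd i) (emeasure N (fst i))) \<partial>K)"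
        using sets_eq_imp_space_eq[OF that] J(2)
        by (intro nn_integral_cong) (simp add: J(1) cyl_def prod_indicator_eq indicator_def case_prod_unfold)
      finally show ?thesis by simp
    qed
    show "emeasure K1 X = emeasure K2 X"
      unfolding *[OF sets(1)] *[OF sets(2)] using J(3)
      by (intro joint_law_eq_if_laplace_eq[OF K sets eq J(2)]) auto
  qed simp
qed

subsection \<open>The Laplace functional of a Poisson random measure\<close>

text \<open>The generating function of the Poisson distribution at \<open>exp (- c)\<close>; at
  \<open>c = 0\<close> it says that the probabilities sum to 1.\<close>

lemma suminf_poisson_nexp:
  assumes "0 \<le> l" "c < \<top>"
  shows "(\<Sum>k. ennreal (l ^ k / fact k * exp (- l)) * nexp (c * of_nat k)) = nexp ((1 - nexp c) * ennreal l)"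
proof -
  obtain r where r: "c = ennreal r" "0 \<le> r" using assms by (cases c) auto
  have summand: "ennreal (l ^ k / fact k * exp (- l)) * nexp (c * of_nat k) =
      ennreal (exp (- l) * ((l * exp (- r)) ^ k /\<^sub>R fact k))" for k
  proof -
    have "nexp (c * of_nat k) = ennreal (exp (- r) ^ k)"
      using r by (subst mult.commute) (simp add: nexp_of_nat_mult nexp_ennreal ennreal_power)
    then show ?thesis
      using assms by (simp add: power_mult_distrib field_simps flip: ennreal_mult)
  qed
  have "(\<lambda>k. exp (- l) * ((l * exp (- r)) ^ k /\<^sub>R fact k)) sums (exp (- l) * exp (l * exp (- r)))"
    by (intro sums_mult exp_converges)
  then have "(\<Sum>k. ennreal (exp (- l) * ((l * exp (- r)) ^ k /\<^sub>R fact k))) =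
      ennreal (exp (- l) * exp (l * exp (- r)))"
    using assms by (subst suminf_ennreal2) (auto simp: sums_iff)
  also have "\<dots> = nexp (ennreal ((1 - exp (- r)) * l))"
    using assms r by (subst nexp_ennreal) (auto simp: algebra_simps mult_left_le simp flip: exp_add)
  also have "ennreal ((1 - exp (- r)) * l) = (1 - nexp c) * ennreal l"
    using r assms by (simp add: nexp_ennreal ennreal_mult ennreal_minus flip: ennreal_1)
  finally show ?thesis unfolding summand .
qed

lemma (in prob_space) nn_integral_poisson_nexp:
  assumes [measurable]: "X \<in> borel_measurable M" and "0 \<le> l" "c < \<top>"
    and pois: "\<And>k::nat. prob {\<omega> \<in> space M. X \<omega> = of_nat k} = l ^ k / fact k * exp (- l)"
  shows "(\<integral>\<^sup>+\<omega>. nexp (c * X \<omega>) \<partial>M) = nexp ((1 - nexp c) * ennreal l)"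
proof -
  define A where "A k = {\<omega> \<in> space M. X \<omega> = of_nat k}" for k :: nat
  have [measurable]: "A k \<in> sets M" for k unfolding A_def by measurable
  have em: "emeasure M (A k) = ennreal (l ^ k / fact k * exp (- l))" for k
    by (simp add: A_def emeasure_eq_measure pois)
  have disj: "disjoint_family A" by (auto simp: disjoint_family_on_def A_def)
  \<comment> \<open>The assumed probabilities sum to 1; hence \<open>X\<close>, a priori only
    [0, \<infinity>]-valued, is almost surely a natural number.\<close>
  have "emeasure M (\<Union>k. A k) = (\<Sum>k. ennreal (l ^ k / fact k * exp (- l)) * nexp (0 * of_nat k))"
    using disj by (subst suminf_emeasure[symmetric]) (auto simp: em)
  also have "\<dots> = 1"
    using assms(2) by (subst suminf_poisson_nexp) auto
  finally have AE: "AE \<omega> in M. \<omega> \<in> (\<Union>k. A k)"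
    using prob_eq_1[of "\<Union>k. A k"] by (simp add: emeasure_eq_measure)
  have "(\<integral>\<^sup>+\<omega>. nexp (c * X \<omega>) \<partial>M) = (\<integral>\<^sup>+\<omega>. (\<Sum>k. nexp (c * of_nat k) * indicator (A k) \<omega>) \<partial>M)"
  proof (intro nn_integral_cong_AE eventually_mono[OF AE])
    fix \<omega> assume "\<omega> \<in> (\<Union>k. A k)"
    then obtain k where k: "\<omega> \<in> A k" by auto
    then have "(\<Sum>k. nexp (c * of_nat k) * indicator (A k) \<omega>) = nexp (c * of_nat k) * indicator (A k) \<omega>"
      using suminf_finite[of "{k}" "\<lambda>k. nexp (c * of_nat k) * indicator (A k) \<omega> :: ennreal"]
      by (auto simp: A_def)
    with k show "nexp (c * X \<omega>) = (\<Sum>k. nexp (c * of_nat k) * indicator (A k) \<omega>)"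
      by (simp add: A_def)
  qed
  also have "\<dots> = (\<Sum>k. ennreal (l ^ k / fact k * exp (- l)) * nexp (c * of_nat k))"
    by (subst nn_integral_suminf) (simp_all add: nn_integral_multc em mult.commute[of "nexp _"])
  also have "\<dots> = nexp ((1 - nexp c) * ennreal l)"
    using assms by (intro suminf_poisson_nexp)
  finally show ?thesis .
qed

lemma nexp_less_1: "c \<noteq> 0 \<Longrightarrow> 0 < 1 - nexp c"
  using nexp_le_1[of c] nexp_eq_1_iff[of c] by (intro diff_gr0_ennreal) (auto simp: less_le)

lemma poisson_random_measure_nexp_emeasure:
  assumes prm: "poisson_random_measure M N \<nu>" and A: "A \<in> sets \<nu>" and c: "c < \<top>"
  shows "(\<integral>\<^sup>+\<omega>. nexp (c * emeasure (N \<omega>) A) \<partial>M) = nexp ((1 - nexp c) * emeasure \<nu> A)"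
proof -
  interpret prob_space M using prm by (simp add: poisson_random_measure_def)
  have [measurable]: "N \<in> measurable M (measure_algebra \<nu>)"
    using prm by (simp add: poisson_random_measure_def)
  note A [measurable]
  show ?thesis
  proof (cases "emeasure \<nu> A = \<infinity>")
    case True
    then have "AE \<omega> in M. emeasure (N \<omega>) A = \<infinity>"
      using prm A by (auto simp: poisson_random_measure_def split: if_splits)
    then have "(\<integral>\<^sup>+\<omega>. nexp (c * emeasure (N \<omega>) A) \<partial>M) = (\<integral>\<^sup>+\<omega>. nexp (c * \<infinity>) \<partial>M)"
      by (intro nn_integral_cong_AE) auto
    \<comment> \<open>For \<open>c > 0\<close> both sides are 0; for \<open>c = 0\<close> both are 1
      because \<open>0 * \<infinity> = 0\<close>.\<close>
    then show ?thesis
      using True nexp_less_1[of c] by (cases "c = 0") (auto simp: emeasure_space_1 ennreal_mult_top)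
  next
    case False
    have "emeasure \<nu> A = ennreal (measure \<nu> A)"
      using False by (simp add: emeasure_eq_ennreal_measure)
    then show ?thesis
      using prm A False c unfolding poisson_random_measure_def
      by (subst nn_integral_poisson_nexp[where l="measure \<nu> A"]) auto
  qed
qed

text \<open>The level sets of \<open>u\<close> are disjoint, so the integral is a finite combination
  of independent counts and its Laplace transform factors.\<close>

lemma poisson_random_measure_laplace_simple:
  assumes prm: "poisson_random_measure M N \<nu>" and u: "simple_function \<nu> u" "\<And>x. u x < \<top>"
  shows "(\<integral>\<^sup>+\<omega>. nexp (\<integral>\<^sup>+x. u x \<partial>N \<omega>) \<partial>M) = nexp (\<integral>\<^sup>+x. (1 - nexp (u x)) \<partial>\<nu>)"
proof -
  interpret prob_space M using prm by (simp add: poisson_random_measure_def)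
  have N [measurable]: "N \<in> measurable M (measure_algebra \<nu>)"
    using prm by (simp add: poisson_random_measure_def)
  have "finite (u ` space \<nu>)" using u by (simp add: simple_function_def)
  then obtain r where r: "bij_betw r {0..<card (u ` space \<nu>)} (u ` space \<nu>)"
    using ex_bij_betw_nat_finite by blast
  define m where "m = card (u ` space \<nu>)"
  note r = r[folded m_def]
  \<comment> \<open>Independence is stated for infinite sequences of sets, so the finite family of
    level sets is continued by empty sets.\<close>
  define A where "A i = (if i < m then u -` {r i} \<inter> space \<nu> else {})" for i
  have A [measurable]: "A i \<in> sets \<nu>" for i
    using u(1) by (auto simp: A_def intro: simple_functionD(2))
  have "r i \<noteq> r j" if "i \<noteq> j" "i < m" "j < m" for i j
    using bij_betw_imp_inj_on[OF r] that by (auto dest!: inj_onD)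
  then have disj: "disjoint_family A"
    by (auto simp: disjoint_family_on_def A_def)
  \<comment> \<open>Stated for arbitrary \<open>f\<close> because the expansion is used twice: with
    the identity for the integral against \<open>N\<close>, and with \<open>1 - nexp\<close> for the
    integral against \<nu>.\<close>
  have rep: "f (u x) = (\<Sum>i<m. f (r i) * indicator (A i) x)" if x: "x \<in> space \<nu>"
    for x and f :: "ennreal \<Rightarrow> ennreal"
  proof -
    obtain i where i: "i < m" "u x = r i"
      using x r by (metis atLeastLessThan_iff bij_betw_iff_bijections imageI)
    then have "x \<in> A i" using x by (simp add: A_def)
    moreover have "x \<notin> A j" if "j \<noteq> i" for j
      using \<open>x \<in> A i\<close> disj that by (auto simp: disjoint_family_on_def)
    ultimately have "f (r j) * indicator (A j) x = (if j = i then f (u x) else 0)" for j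
      using i by auto
    then show ?thesis using i by simp
  qed
  have int: "(\<integral>\<^sup>+x. f (u x) \<partial>K) = (\<Sum>i<m. f (r i) * emeasure K (A i))"
    if sets [measurable_cong]: "sets K = sets \<nu>" for K and f :: "ennreal \<Rightarrow> ennreal"
  proof -
    have "(\<integral>\<^sup>+x. f (u x) \<partial>K) = (\<integral>\<^sup>+x. (\<Sum>i<m. f (r i) * indicator (A i) x) \<partial>K)"
      using sets_eq_imp_space_eq[OF sets] by (intro nn_integral_cong rep) simp
    also have "\<dots> = (\<Sum>i<m. f (r i) * emeasure K (A i))"
      by (subst nn_integral_sum) (auto simp: sets nn_integral_cmult)
    finally show ?thesis .
  qed
  have fin: "r i < \<top>" if "i < m" for i
    using that bij_betwE[OF r] u(2) by force
  have "indep_vars (\<lambda>_. borel) (\<lambda>i \<omega>. emeasure (N \<omega>) (A i)) UNIV"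
    using prm[unfolded poisson_random_measure_def, THEN conjunct2, THEN conjunct2, THEN conjunct2, THEN spec, of A] disj A
    by blast
  then have "indep_vars (\<lambda>_. borel) (\<lambda>i \<omega>. emeasure (N \<omega>) (A i)) {..<m}"
    by (rule indep_vars_subset) auto
  then have indep: "indep_vars (\<lambda>_. borel) (\<lambda>i \<omega>. nexp (r i * emeasure (N \<omega>) (A i))) {..<m}"
    by (rule indep_vars_compose2) auto
  have "(\<integral>\<^sup>+\<omega>. nexp (\<integral>\<^sup>+x. u x \<partial>N \<omega>) \<partial>M) = (\<integral>\<^sup>+\<omega>. (\<Prod>i<m. nexp (r i * emeasure (N \<omega>) (A i))) \<partial>M)"
    using measurable_space[OF N]
    by (intro nn_integral_cong) (simp add: int[of _ "\<lambda>x. x"] space_measure_algebra nexp_sum)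
  also have "\<dots> = (\<Prod>i<m. \<integral>\<^sup>+\<omega>. nexp (r i * emeasure (N \<omega>) (A i)) \<partial>M)"
    by (intro indep_vars_nn_integral indep) auto
  also have "\<dots> = (\<Prod>i<m. nexp ((1 - nexp (r i)) * emeasure \<nu> (A i)))"
    using prm fin by (intro prod.cong) (auto simp: poisson_random_measure_nexp_emeasure)
  also have "\<dots> = nexp (\<integral>\<^sup>+x. (1 - nexp (u x)) \<partial>\<nu>)"
    by (simp add: int[of \<nu> "\<lambda>x. 1 - nexp x"] nexp_sum)
  finally show ?thesis .
qed

text \<open>Approximation by increasing simple functions: dominated convergence with bound 1 on the
  left, monotone convergence on the right. Continuity of \<open>nexp\<close> at \<infinity> covers
  infinite integrals on both sides.\<close>

lemma poisson_random_measure_laplace: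
  assumes prm: "poisson_random_measure M N \<nu>" and u [measurable]: "u \<in> borel_measurable \<nu>"
  shows "(\<integral>\<^sup>+\<omega>. nexp (\<integral>\<^sup>+x. u x \<partial>N \<omega>) \<partial>M) = nexp (\<integral>\<^sup>+x. (1 - nexp (u x)) \<partial>\<nu>)"
proof -
  interpret prob_space M using prm by (simp add: poisson_random_measure_def)
  have N [measurable]: "N \<in> measurable M (measure_algebra \<nu>)"
    using prm by (simp add: poisson_random_measure_def)
  obtain U where U: "\<And>i. simple_function \<nu> (U i)" "incseq U" "\<And>i x. U i x < \<top>" "\<And>x. (SUP i. U i x) = u x"
    using borel_measurable_implies_simple_function_sequence'[OF u] by blast
  have [measurable]: "U i \<in> borel_measurable \<nu>" for i
    using U(1) by (rule borel_measurable_simple_function)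
  have lim: "(\<lambda>i. U i x) \<longlonglongrightarrow> u x" for x
    using U(2) LIMSEQ_SUP[of "\<lambda>i. U i x"] by (simp add: U(4) incseq_def le_fun_def)
  have "(\<lambda>i. \<integral>\<^sup>+\<omega>. nexp (\<integral>\<^sup>+x. U i x \<partial>N \<omega>) \<partial>M) \<longlonglongrightarrow> (\<integral>\<^sup>+\<omega>. nexp (\<integral>\<^sup>+x. u x \<partial>N \<omega>) \<partial>M)"
  proof (rule nn_integral_dominated_convergence[where w="\<lambda>_. 1"])
    show "AE \<omega> in M. (\<lambda>i. nexp (\<integral>\<^sup>+x. U i x \<partial>N \<omega>)) \<longlonglongrightarrow> nexp (\<integral>\<^sup>+x. u x \<partial>N \<omega>)"
    proof (rule AE_I2)
      fix \<omega> assume "\<omega> \<in> space M"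
      then have [measurable_cong]: "sets (N \<omega>) = sets \<nu>"
        using measurable_space[OF N] by (simp add: space_measure_algebra)
      show "(\<lambda>i. nexp (\<integral>\<^sup>+x. U i x \<partial>N \<omega>)) \<longlonglongrightarrow> nexp (\<integral>\<^sup>+x. u x \<partial>N \<omega>)"
        using U(2) lim by (intro tendsto_nexp nn_integral_LIMSEQ) auto
    qed
  qed (auto simp: nexp_le_1 emeasure_space_1)
  moreover have "(\<lambda>i. nexp (\<integral>\<^sup>+x. (1 - nexp (U i x)) \<partial>\<nu>)) \<longlonglongrightarrow> nexp (\<integral>\<^sup>+x. (1 - nexp (u x)) \<partial>\<nu>)"
    using U(2) lim
    by (intro tendsto_nexp nn_integral_LIMSEQ tendsto_diff_ennreal)
      (auto simp: incseq_def le_fun_def intro!: ennreal_minus_mono nexp_mono)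
  ultimately show ?thesis
    using U by (simp add: poisson_random_measure_laplace_simple[OF prm] LIMSEQ_unique)
qed

text \<open>Where one of two summands vanishes, \<open>1 - nexp\<close> is additive. In the exponent
  of the Laplace functional this becomes multiplicativity over disjoint supports, the source of
  independence below.\<close>

lemma nn_integral_one_minus_nexp_disjoint:
  assumes [measurable]: "u \<in> borel_measurable \<nu>" "A \<in> sets \<nu>" and "\<And>x. x \<in> A \<Longrightarrow> u x = 0"
  shows "(\<integral>\<^sup>+x. (1 - nexp (u x + of_nat n * indicator A x)) \<partial>\<nu>) =
    (\<integral>\<^sup>+x. (1 - nexp (u x)) \<partial>\<nu>) + (\<integral>\<^sup>+x. (1 - nexp (of_nat n * indicator A x)) \<partial>\<nu>)"
proof -
  have "(\<integral>\<^sup>+x. (1 - nexp (u x + of_nat n * indicator A x)) \<partial>\<nu>) =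
      (\<integral>\<^sup>+x. (1 - nexp (u x)) + (1 - nexp (of_nat n * indicator A x)) \<partial>\<nu>)"
    using assms(3) by (intro nn_integral_cong) (simp add: indicator_def)
  then show ?thesis
    by (simp add: nn_integral_add)
qed

text \<open>The converse direction: the Laplace formula is assumed, and the Poisson property is
  derived from it. This is the form in which the tilted laws are known.\<close>

locale poisson_laplace = prob_space L for L :: "'a measure measure" +
  fixes \<nu> :: "'a measure"
  assumes sets_L [measurable_cong]: "sets L = sets (measure_algebra \<nu>)"
    and laplace: "u \<in> borel_measurable \<nu> \<Longrightarrow>
      laplace_functional L u = nexp (\<integral>\<^sup>+x. (1 - nexp (u x)) \<partial>\<nu>)"
begin

lemma space_L: "space L = {N. sets N = sets \<nu>}"
  using sets_eq_imp_space_eq[OF sets_L] by (simp add: space_measure_algebra)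

lemma laplace_indicator:
  assumes "A \<in> sets \<nu>"
  shows "(\<integral>\<^sup>+N. nexp (c * emeasure N A) \<partial>L) = nexp ((1 - nexp c) * emeasure \<nu> A)"
proof -
  have "(\<integral>\<^sup>+N. nexp (c * emeasure N A) \<partial>L) = laplace_functional L (\<lambda>x. c * indicator A x)"
    unfolding laplace_functional_def using assms
    by (intro nn_integral_cong) (simp add: space_L nn_integral_cmult)
  also have "\<dots> = nexp (\<integral>\<^sup>+x. (1 - nexp c) * indicator A x \<partial>\<nu>)"
    using assms
    by (subst laplace) (auto intro!: arg_cong[where f=nexp] nn_integral_cong simp: indicator_def)
  finally show ?thesis using assms by (simp add: nn_integral_cmult)
qed

lemma emeasure_infinite:
  assumes [measurable]: "A \<in> sets \<nu>" and "emeasure \<nu> A = \<infinity>"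
  shows "AE N in L. emeasure N A = \<infinity>"
proof -
  have "(\<integral>\<^sup>+N. nexp (emeasure N A) \<partial>L) = 0"
    using laplace_indicator[of A 1] assms nexp_less_1[of 1]
    by (simp add: ennreal_mult_top)
  then show ?thesis
    by (subst (asm) nn_integral_0_iff_AE) auto
qed

lemma emeasure_finite_poisson:
  assumes [measurable]: "A \<in> sets \<nu>" and fin: "emeasure \<nu> A \<noteq> \<infinity>"
  shows "prob {N \<in> space L. emeasure N A = of_nat k} = measure \<nu> A ^ k / fact k * exp (- measure \<nu> A)"
proof -
  let ?l = "measure \<nu> A"
  let ?p = "\<lambda>k. ennreal (?l ^ k / fact k * exp (- ?l))"
  \<comment> \<open>The Poisson distribution with mean \<open>?l\<close>, which may be 0. It is
    compared with the law of \<open>N(A)\<close> through their Laplace transforms.\<close>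
  let ?D = "density (count_space UNIV) ?p"
  have D: "(\<integral>\<^sup>+j. f j \<partial>?D) = (\<Sum>j. ?p j * f j)" for f :: "nat \<Rightarrow> ennreal"
    by (simp add: nn_integral_density nn_integral_count_space_nat)
  have "emeasure ?D (space ?D) = (\<Sum>j. ?p j * nexp (0 * of_nat j))"
    using D[of "\<lambda>_. 1"] by simp
  also have "\<dots> = 1"
    by (subst suminf_poisson_nexp) simp_all
  finally have "finite_measure ?D"
    by (intro finite_measureI) (simp only: infinity_ennreal_def ennreal_one_neq_top not_False_eq_True)
  then have "(\<integral>\<^sup>+N. 1 * indicator {of_nat k} (emeasure N A) \<partial>L) =
      (\<integral>\<^sup>+j. 1 * indicator {of_nat k} (of_nat j :: ennreal) \<partial>?D)"
  proof (intro nn_integral_indicator_eq_if_laplace_eq)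
    show "(\<integral>\<^sup>+N. 1 * nexp (of_nat n * emeasure N A) \<partial>L) = (\<integral>\<^sup>+j. 1 * nexp (of_nat n * of_nat j) \<partial>?D)" for n
      unfolding D using fin suminf_poisson_nexp[of ?l "of_nat n"] of_nat_less_top[of n]
      by (simp add: laplace_indicator emeasure_eq_ennreal_measure)
  qed (auto intro: finite_measure_axioms)
  also have "\<dots> = (\<Sum>j. ?p j * indicator {k} j)"
    unfolding D by (intro suminf_cong) (simp add: indicator_def)
  also have "\<dots> = ?p k"
    by (subst suminf_finite[of "{k}"]) auto
  also have "(\<integral>\<^sup>+N. 1 * indicator {of_nat k} (emeasure N A) \<partial>L) =
      (\<integral>\<^sup>+N. indicator {N \<in> space L. emeasure N A = of_nat k} N \<partial>L)"
    by (intro nn_integral_cong) (auto simp: indicator_def)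
  also have "\<dots> = emeasure L {N \<in> space L. emeasure N A = of_nat k}"
    by (intro nn_integral_indicator) measurable
  finally show ?thesis
    by (simp add: emeasure_eq_measure)
qed

text \<open>Induction on \<open>J\<close>: a factor \<open>nexp (n * N(A i))\<close> is absorbed
  into \<open>u\<close>, and since \<open>u\<close> vanishes on \<open>A i\<close> the Laplace
  functional splits it off again. The value of the remaining factors becomes a constant weight
  \<open>?c \<le> 1\<close>, so both sides have the same Laplace transform in \<open>N(A i)\<close>,
  and \<open>indicator (B i)\<close> may replace the exponential.\<close>

lemma joint_law:
  assumes "finite J" and "\<And>i. i \<in> J \<Longrightarrow> A i \<in> sets \<nu>" and "\<And>i. i \<in> J \<Longrightarrow> B i \<in> sets borel"
    and "disjoint_family_on A J"
    and "u \<in> borel_measurable \<nu>" and "\<And>i x. i \<in> J \<Longrightarrow> x \<in> A i \<Longrightarrow> u x = 0"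
  shows "(\<integral>\<^sup>+N. (\<Prod>i\<in>J. indicator (B i) (emeasure N (A i))) * nexp (\<integral>\<^sup>+x. u x \<partial>N) \<partial>L) =
    (\<Prod>i\<in>J. \<integral>\<^sup>+N. indicator (B i) (emeasure N (A i)) \<partial>L) * laplace_functional L u"
  using assms
proof (induction J arbitrary: u)
  case empty
  then show ?case by (simp add: laplace_functional_def)
next
  case (insert i J)
  note [measurable] = insert.prems(4)
  have [measurable]: "A j \<in> sets \<nu>" "B j \<in> sets borel" if "j \<in> insert i J" for j
    using insert.prems that by auto
  let ?W = "\<lambda>N. (\<Prod>j\<in>J. indicator (B j) (emeasure N (A j))) * nexp (\<integral>\<^sup>+x. u x \<partial>N)"
  let ?c = "(\<Prod>j\<in>J. \<integral>\<^sup>+N. indicator (B j) (emeasure N (A j)) \<partial>L) * laplace_functional L u"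
  have eq: "(\<integral>\<^sup>+N. ?W N * nexp (of_nat n * emeasure N (A i)) \<partial>L) =
      (\<integral>\<^sup>+N. ?c * nexp (of_nat n * emeasure N (A i)) \<partial>L)" for n
  proof -
    let ?u = "\<lambda>x. u x + of_nat n * indicator (A i) x"
    have "(\<integral>\<^sup>+N. ?W N * nexp (of_nat n * emeasure N (A i)) \<partial>L) =
       (\<integral>\<^sup>+N. (\<Prod>j\<in>J. indicator (B j) (emeasure N (A j))) * nexp (\<integral>\<^sup>+x. ?u x \<partial>N) \<partial>L)"
      by (intro nn_integral_cong) (simp add: nexp_integral_add_indicator[of _ \<nu>] space_L mult.assoc)
    also have "\<dots> = (\<Prod>j\<in>J. \<integral>\<^sup>+N. indicator (B j) (emeasure N (A j)) \<partial>L) * laplace_functional L ?u"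
    proof (rule insert.IH)
      show "disjoint_family_on A J"
        using insert.prems(3) by (rule disjoint_family_on_mono[rotated]) auto
      show "?u x = 0" if "j \<in> J" "x \<in> A j" for j x
        using that insert by (auto simp: disjoint_family_on_def indicator_def)
    qed (use insert.prems in auto)
    also have "laplace_functional L ?u = laplace_functional L u * (\<integral>\<^sup>+N. nexp (of_nat n * emeasure N (A i)) \<partial>L)"
    proof -
      have "laplace_functional L (\<lambda>x. of_nat n * indicator (A i) x) = (\<integral>\<^sup>+N. nexp (of_nat n * emeasure N (A i)) \<partial>L)"
        unfolding laplace_functional_def
        by (intro nn_integral_cong) (simp add: space_L nn_integral_cmult)
      moreover have "laplace_functional L ?u =
          laplace_functional L u * laplace_functional L (\<lambda>x. of_nat n * indicator (A i) x)"
        using insert.prems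
        by (simp add: laplace flip: nexp_add)
          (subst nn_integral_one_minus_nexp_disjoint, auto)
      ultimately show ?thesis by simp
    qed
    finally show ?thesis by (simp add: nn_integral_cmult mult.assoc)
  qed
  have W: "?W N \<le> 1" for N
    by (intro mult_le_one prod_le_one_ennreal nexp_le_1) (auto simp: indicator_def)
  have le1: "(\<integral>\<^sup>+N. f N \<partial>L) \<le> 1" if "\<And>N. f N \<le> 1" for f :: "'a measure \<Rightarrow> ennreal"
    using nn_integral_mono[of L f "\<lambda>_. 1"] that by (simp add: emeasure_space_1)
  have c: "?c \<le> 1"
    unfolding laplace_functional_def
    by (intro mult_le_one prod_le_one_ennreal le1 nexp_le_1) (auto simp: indicator_def)
  have "(\<integral>\<^sup>+N. ?W N * indicator (B i) (emeasure N (A i)) \<partial>L) =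
      (\<integral>\<^sup>+N. ?c * indicator (B i) (emeasure N (A i)) \<partial>L)"
    by (rule nn_integral_indicator_eq_if_laplace_eq[OF finite_measure_axioms finite_measure_axioms _ _ _ _ W c eq])
      measurable
  then have "(\<integral>\<^sup>+N. ?W N * indicator (B i) (emeasure N (A i)) \<partial>L) =
      ?c * (\<integral>\<^sup>+N. indicator (B i) (emeasure N (A i)) \<partial>L)"
    by (simp add: nn_integral_cmult)
  then show ?case
    using insert.hyps by (simp add: ac_simps)
qed

lemma poisson_random_measure: "poisson_random_measure L (\<lambda>N. N) \<nu>"
  unfolding poisson_random_measure_def
proof (intro conjI ballI allI impI)
  show "prob_space L" by (rule prob_space_axioms)
  show "(\<lambda>N. N) \<in> measurable L (measure_algebra \<nu>)" by measurable
  show "if emeasure \<nu> A = \<infinity> then AE \<omega> in L. emeasure \<omega> A = \<infinity>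
      else \<forall>k. prob {\<omega> \<in> space L. emeasure \<omega> A = of_nat k} = measure \<nu> A ^ k / fact k * exp (- measure \<nu> A)"
    if "A \<in> sets \<nu>" for A
    using that emeasure_infinite[of A] by (auto simp: emeasure_finite_poisson)
  fix A :: "nat \<Rightarrow> 'a set" assume A: "range A \<subseteq> sets \<nu> \<and> disjoint_family A"
  then have [measurable]: "A i \<in> sets \<nu>" for i by auto
  show "indep_vars (\<lambda>_. borel) (\<lambda>i \<omega>. emeasure \<omega> (A i)) UNIV"
    unfolding indep_vars_def2
  proof (intro conjI ballI indep_setsI)
    show "(\<lambda>\<omega>. emeasure \<omega> (A i)) \<in> borel_measurable L" for i by measurable
    then show "{(\<lambda>\<omega>. emeasure \<omega> (A i)) -` B \<inter> space L |B. B \<in> sets borel} \<subseteq> events" for i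
      using measurable_sets by blast
    fix S :: "nat \<Rightarrow> 'a measure set" and J :: "nat set"
    assume J: "J \<noteq> {}" "finite J"
      and S: "\<forall>j\<in>J. S j \<in> {(\<lambda>\<omega>. emeasure \<omega> (A j)) -` B \<inter> space L |B. B \<in> sets borel}"
    then obtain B where B: "\<And>j. j \<in> J \<Longrightarrow> B j \<in> sets borel"
        "\<And>j. j \<in> J \<Longrightarrow> S j = (\<lambda>\<omega>. emeasure \<omega> (A j)) -` B j \<inter> space L"
      by simp metis
    have S_sets: "S j \<in> events" if "j \<in> J" for j
    proof -
      have [measurable]: "B j \<in> sets borel" using that B by simp
      have "S j = {\<omega> \<in> space L. emeasure \<omega> (A j) \<in> B j}" using B(2)[OF that] by auto
      then show ?thesis by simp
    qed
    then have [measurable]: "(\<Inter>j\<in>J. S j) \<in> events"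
      using J by auto
    have "emeasure L (\<Inter>j\<in>J. S j) = (\<integral>\<^sup>+N. indicator (\<Inter>j\<in>J. S j) N \<partial>L)"
      by simp
    also have "\<dots> = (\<integral>\<^sup>+N. (\<Prod>i\<in>J. indicator (B i) (emeasure N (A i))) * nexp (\<integral>\<^sup>+x. 0 \<partial>N) \<partial>L)"
      using J B(2) by (intro nn_integral_cong) (simp add: prod_indicator_eq indicator_def)
    also have "\<dots> = (\<Prod>i\<in>J. \<integral>\<^sup>+N. indicator (B i) (emeasure N (A i)) \<partial>L)"
      using A J B by (subst joint_law)
        (auto simp: laplace_functional_def emeasure_space_1 disjoint_family_on_def)
    also have "\<dots> = (\<Prod>i\<in>J. emeasure L (S i))"
    proof (intro prod.cong refl)
      fix i assume i: "i \<in> J"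
      have "(\<integral>\<^sup>+N. indicator (B i) (emeasure N (A i)) \<partial>L) = (\<integral>\<^sup>+N. indicator (S i) N \<partial>L)"
        using B(2)[OF i] by (intro nn_integral_cong) (simp add: indicator_def)
      then show "(\<integral>\<^sup>+N. indicator (B i) (emeasure N (A i)) \<partial>L) = emeasure L (S i)"
        using S_sets[OF i] by simp
    qed
    finally show "prob (\<Inter>j\<in>J. S j) = (\<Prod>j\<in>J. prob (S j))"
      by (simp add: emeasure_eq_measure prod_ennreal prod_nonneg)
  qed
qed

text \<open>\<open>L\<close> itself witnesses existence; any other candidate is a Poisson random
  measure, hence has the same Laplace functional and equals \<open>L\<close>.\<close>

lemma poisson_law_eq: "poisson_law \<nu> = L"
  unfolding poisson_law_def
proof (rule the_equality)
  show "sets L = sets (measure_algebra \<nu>) \<and> poisson_random_measure L (\<lambda>N. N) \<nu>"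
    by (simp add: sets_L poisson_random_measure)
  fix L' assume L': "sets L' = sets (measure_algebra \<nu>) \<and> poisson_random_measure L' (\<lambda>N. N) \<nu>"
  then have "prob_space L'" by (simp add: poisson_random_measure_def)
  moreover have "laplace_functional L' u = laplace_functional L u" if "u \<in> borel_measurable \<nu>" for u
    using L' that
    by (simp add: laplace) (simp add: laplace_functional_def poisson_random_measure_laplace)
  ultimately show "L' = L"
    using L' by (intro measure_algebra_eqI[of _ _ \<nu>])
      (auto simp: sets_L intro: prob_space.finite_measure prob_space_axioms)
qed

end

lemma poisson_laplace_distr:
  assumes prm: "poisson_random_measure M N \<nu>"
  shows "poisson_laplace (distr M (measure_algebra \<nu>) N) \<nu>"
proof -
  have [measurable]: "N \<in> measurable M (measure_algebra \<nu>)" and "prob_space M"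
    using prm by (simp_all add: poisson_random_measure_def)
  then interpret prob_space "distr M (measure_algebra \<nu>) N"
    by (intro prob_space.prob_space_distr)
  show ?thesis
    by unfold_locales
      (simp_all add: laplace_functional_def nn_integral_distr poisson_random_measure_laplace[OF prm])
qed

subsection \<open>Intensities\<close>

lemma space_borel_pair [simp]: "space (borel \<Otimes>\<^sub>M borel) = UNIV"
  by (simp add: space_pair_measure)

lemma sets_intensity: "sets (intensity \<rho> \<eta>) = sets (borel \<Otimes>\<^sub>M borel)"
  unfolding intensity_def
  using sets.sigma_sets_eq[of "borel \<Otimes>\<^sub>M borel"] by simp

text \<open>If the defining set function were not countably additive, \<^const>\<open>intensity\<close> would be null.\<close>

lemma emeasure_intensity:
  assumes "emeasure (intensity \<rho> \<eta>) UNIV \<noteq> 0" and B: "B \<in> sets (borel \<Otimes>\<^sub>M borel)"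
  shows "emeasure (intensity \<rho> \<eta>) B = (\<integral>\<^sup>+y. emeasure (\<rho> y) {s. (s, y) \<in> B} \<partial>\<eta>)"
  using assms sets.sigma_sets_eq[of "borel \<Otimes>\<^sub>M borel"]
  by (auto simp: intensity_def emeasure_measure_of_conv split: if_splits)

lemma measurable_kernel_measure_algebra:
  "sigma_finite_kernel \<rho> \<Longrightarrow> \<rho> \<in> measurable borel (measure_algebra borel)"
  by (intro measurable_measure_algebra) (simp_all add: sigma_finite_kernel_def)

lemma measurable_section:
  "f \<in> borel_measurable (borel \<Otimes>\<^sub>M borel) \<Longrightarrow> (\<lambda>s. f (s, y)) \<in> borel_measurable borel"
  by (rule measurable_compose[rotated]) auto

context
  fixes \<eta> :: "'y::polish_space measure" and \<rho> :: "'y \<Rightarrow> 's::polish_space measure"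
  assumes sets_\<eta> [measurable_cong]: "sets \<eta> = sets borel"
    and kernel: "sigma_finite_kernel \<rho>"
    and nonzero: "emeasure (intensity \<rho> \<eta>) UNIV \<noteq> 0"
begin

lemma sets_kernel_borel: "sets (\<rho> y) = sets borel"
  using kernel by (simp add: sigma_finite_kernel_def)

lemma space_kernel_UNIV: "space (\<rho> y) = UNIV"
  using sets_eq_imp_space_eq[OF sets_kernel_borel[of y]] by simp

lemma measurable_nn_integral_kernel:
  assumes [measurable]: "f \<in> borel_measurable borel"
  shows "(\<lambda>y. \<integral>\<^sup>+s. f s \<partial>\<rho> y) \<in> borel_measurable borel"
  using measurable_kernel_measure_algebra[OF kernel] by measurable

text \<open>For integrands in \<open>s\<close> alone the inner integral is measurable in
  \<open>y\<close> by the kernel property itself. This case comes first because it turns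
  integrability of \<open>g\<close> against the intensity into the almost everywhere finiteness of
  the integrals of \<open>g\<close> against \<open>\<rho> y\<close>, on which the general case
  rests.\<close>

lemma nn_integral_intensity_fst:
  fixes f :: "'s \<Rightarrow> ennreal"
  assumes "f \<in> borel_measurable borel"
  shows "(\<integral>\<^sup>+x. f (fst x) \<partial>intensity \<rho> \<eta>) = (\<integral>\<^sup>+y. (\<integral>\<^sup>+s. f s \<partial>\<rho> y) \<partial>\<eta>)"
proof -
  note [measurable_cong] = sets_kernel_borel and [measurable] = measurable_nn_integral_kernel
  have [measurable_cong]: "sets (intensity \<rho> \<eta>) = sets (borel \<Otimes>\<^sub>M borel)" by (rule sets_intensity)
  show ?thesis
    using assms
  proof induct
    case (cong f g)
    then have "f = g" by auto
    with cong show ?case by simp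
  next
    case (set A)
    then have [measurable]: "A \<in> sets borel" .
    have "(\<integral>\<^sup>+x. indicator A (fst x) \<partial>intensity \<rho> \<eta>) = (\<integral>\<^sup>+x. indicator (A \<times> UNIV) x \<partial>intensity \<rho> \<eta>)"
      by (intro nn_integral_cong) (auto simp: indicator_def)
    also have "\<dots> = emeasure (intensity \<rho> \<eta>) (A \<times> UNIV)"
      by (subst nn_integral_indicator) (auto simp: sets_intensity)
    also have "\<dots> = (\<integral>\<^sup>+y. emeasure (\<rho> y) A \<partial>\<eta>)"
      by (subst emeasure_intensity[OF nonzero]) auto
    finally show ?case by simp
  next
    case (mult f c)
    then have [measurable]: "f \<in> borel_measurable borel" by simp
    from mult show ?case by (simp add: nn_integral_cmult)
  next
    case (add f g)
    then have [measurable]: "f \<in> borel_measurable borel" "g \<in> borel_measurable borel" by simp_all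
    from add show ?case by (simp add: nn_integral_add)
  next
    case (seq U)
    then have [measurable]: "U i \<in> borel_measurable borel" for i by simp
    have inc: "incseq (\<lambda>i. \<integral>\<^sup>+s. U i s \<partial>\<rho> y)" for y
      using seq by (auto simp: incseq_def le_fun_def intro!: nn_integral_mono)
    have inc': "incseq (\<lambda>i x. U i (fst x))" "incseq (\<lambda>i y. \<integral>\<^sup>+s. U i s \<partial>\<rho> y)"
      using seq inc by (auto simp: incseq_def le_fun_def)
    have "(\<integral>\<^sup>+x. (SUP i. U i) (fst x) \<partial>intensity \<rho> \<eta>) = (SUP i. \<integral>\<^sup>+x. U i (fst x) \<partial>intensity \<rho> \<eta>)"
      unfolding SUP_apply by (intro nn_integral_monotone_convergence_SUP inc') measurable
    also have "\<dots> = (SUP i. \<integral>\<^sup>+y. (\<integral>\<^sup>+s. U i s \<partial>\<rho> y) \<partial>\<eta>)"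
      using seq by simp
    also have "\<dots> = (\<integral>\<^sup>+y. (SUP i. \<integral>\<^sup>+s. U i s \<partial>\<rho> y) \<partial>\<eta>)"
      by (intro nn_integral_monotone_convergence_SUP[symmetric] inc') measurable
    also have "\<dots> = (\<integral>\<^sup>+y. (\<integral>\<^sup>+s. (SUP i. U i) s \<partial>\<rho> y) \<partial>\<eta>)"
      unfolding SUP_apply using seq(4)
      by (intro nn_integral_cong nn_integral_monotone_convergence_SUP[symmetric]) measurable
    finally show ?case .
  qed
qed

text \<open>To be instantiated with \<open>1 - exp (- h)\<close>, which is positive and, as T is
  almost surely finite, integrable.\<close>

context
  fixes g :: "'s \<Rightarrow> ennreal"
  assumes g [measurable]: "g \<in> borel_measurable borel" and g_pos: "\<And>s. 0 < g s" "\<And>s. g s < \<top>"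
    and g_int: "(\<integral>\<^sup>+x. g (fst x) \<partial>intensity \<rho> \<eta>) < \<top>"
begin

lemma AE_integral_kernel_finite: "AE y in \<eta>. (\<integral>\<^sup>+s. g s \<partial>\<rho> y) < \<top>"
  using g_int nn_integral_PInf_AE[of "\<lambda>y. \<integral>\<^sup>+s. g s \<partial>\<rho> y" \<eta>] measurable_nn_integral_kernel[OF g]
  by (simp add: nn_integral_intensity_fst less_top)

text \<open>The sections of a pointwise \<open>\<sigma>\<close>-finite kernel need not be measurable; they are almost
  everywhere, because \<open>\<eta>\<close>-almost every \<open>g \<cdot> \<rho> y\<close> is a finite measure, so that, up to normalization,
  \<open>\<rho>\<close> is a density with respect to a subprobability kernel.\<close>

lemma nn_integral_kernel_AE_measurable:
  fixes f :: "'s \<times> 'y \<Rightarrow> ennreal"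
  assumes [measurable]: "f \<in> borel_measurable (borel \<Otimes>\<^sub>M borel)"
  obtains k where "k \<in> borel_measurable \<eta>" "AE y in \<eta>. (\<integral>\<^sup>+s. f (s, y) \<partial>\<rho> y) = k y"
proof
  note [measurable_cong] = sets_kernel_borel and [measurable] = measurable_nn_integral_kernel
  let ?c = "\<lambda>y. \<integral>\<^sup>+s. g s \<partial>\<rho> y"
  \<comment> \<open>The divisor is \<open>1 + ?c y\<close> instead of \<open>?c y\<close> so that
    \<open>K y\<close> has mass at most 1 for every \<open>y\<close>, including those with
    \<open>?c y\<close> equal to 0 or \<infinity>.\<close>
  let ?w = "\<lambda>y s. g s / (1 + ?c y)"
  define K where "K y = density (\<rho> y) (?w y)" for y
  have K [measurable]: "K \<in> measurable borel (subprob_algebra borel)"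
  proof (rule measurable_subprob_algebra)
    show "sets (K y) = sets borel" for y by (simp add: K_def sets_kernel_borel)
    have em: "emeasure (K y) A = (\<integral>\<^sup>+s. g s * indicator A s \<partial>\<rho> y) / (1 + ?c y)"
      if [measurable]: "A \<in> sets borel" for A y
      by (simp add: K_def emeasure_density sets_kernel_borel divide_ennreal_def nn_integral_multc
          mult.assoc mult.commute[of _ "indicator _ _"] mult.left_commute[of _ "indicator _ _"])
         (simp add: mult.commute[of _ "inverse _"] mult.left_commute[of _ "inverse _"] nn_integral_cmult)
    show "(\<lambda>y. emeasure (K y) A) \<in> borel_measurable borel" if [measurable]: "A \<in> sets borel" for A
      by (subst em) measurable
    show "subprob_space (K y)" for y
    proof (rule subprob_spaceI)
      have "?c y / (1 + ?c y) \<le> 1"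
        by (cases "?c y = \<top>")
          (auto intro!: divide_le_posI_ennreal simp: add_pos_nonneg)
      then show "emeasure (K y) (space (K y)) \<le> 1"
        using em[of UNIV y] by (simp add: K_def space_kernel_UNIV)
    qed (simp add: K_def space_kernel_UNIV)
  qed
  show "(\<lambda>y. \<integral>\<^sup>+s. f (s, y) * ((1 + ?c y) / g s) \<partial>K y) \<in> borel_measurable \<eta>"
    unfolding measurable_cong_sets[OF sets_\<eta> refl]
    by (rule nn_integral_measurable_subprob_algebra2[OF _ K]) measurable
  \<comment> \<open>Cancelling the weights needs \<open>1 + ?c y\<close> finite, which holds almost
    everywhere.\<close>
  show "AE y in \<eta>. (\<integral>\<^sup>+s. f (s, y) \<partial>\<rho> y) = (\<integral>\<^sup>+s. f (s, y) * ((1 + ?c y) / g s) \<partial>K y)"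
    using AE_integral_kernel_finite
  proof eventually_elim
    case (elim y)
    have [measurable]: "(\<lambda>s. f (s, y)) \<in> borel_measurable borel"
      by (intro measurable_section assms)
    have "?w y s * (f (s, y) * ((1 + ?c y) / g s)) = f (s, y)" for s
    proof -
      have "?w y s * ((1 + ?c y) / g s) = 1"
      proof -
        have "?w y s * ((1 + ?c y) / g s) = (g s / g s) * ((1 + ?c y) / (1 + ?c y))"
          by (simp add: divide_ennreal_def ac_simps)
        also have "\<dots> = 1"
          using g_pos[of s] elim by (simp add: ennreal_divide_self)
        finally show ?thesis .
      qed
      then show ?thesis by (simp add: mult.left_commute)
    qed
    then show ?case
      by (simp add: K_def nn_integral_density)
  qed
qed

text \<open>The inner integral need not be measurable in \<open>y\<close>, while linearity and
  monotone convergence of the outer integral need measurability. In the steps for multiples, sums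
  and limits it is therefore replaced by an almost everywhere equal measurable version
  \<open>k\<close>.\<close>

lemma nn_integral_intensity:
  fixes f :: "'s \<times> 'y \<Rightarrow> ennreal"
  assumes "f \<in> borel_measurable (borel \<Otimes>\<^sub>M borel)"
  shows "(\<integral>\<^sup>+x. f x \<partial>intensity \<rho> \<eta>) = (\<integral>\<^sup>+y. (\<integral>\<^sup>+s. f (s, y) \<partial>\<rho> y) \<partial>\<eta>)"
proof -
  note [measurable_cong] = sets_kernel_borel and [measurable] = measurable_nn_integral_kernel
  have [measurable_cong]: "sets (intensity \<rho> \<eta>) = sets (borel \<Otimes>\<^sub>M borel)" by (rule sets_intensity)
  show ?thesis
    using assms
  proof induct
    case (cong f g)
    then have "f = g" by auto
    with cong show ?case by simp
  next
    case (set B)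
    have "(\<integral>\<^sup>+s. indicator B (s, y) \<partial>\<rho> y) = emeasure (\<rho> y) {s. (s, y) \<in> B}" for y
    proof -
      have "(\<integral>\<^sup>+s. indicator B (s, y) \<partial>\<rho> y) = (\<integral>\<^sup>+s. indicator {s. (s, y) \<in> B} s \<partial>\<rho> y)"
        by (intro nn_integral_cong) (simp add: indicator_def)
      moreover have "{s. (s, y) \<in> B} \<in> sets borel"
        using sets_Pair2[OF set, of y] by (simp add: vimage_def)
      ultimately show ?thesis by (simp add: sets_kernel_borel)
    qed
    then show ?case
      using set by (simp add: emeasure_intensity[OF nonzero] sets_intensity)
  next
    case (mult f c)
    note [measurable] = mult(2) measurable_section[OF mult(2)]
    obtain k where k [measurable]: "k \<in> borel_measurable \<eta>" "AE y in \<eta>. (\<integral>\<^sup>+s. f (s, y) \<partial>\<rho> y) = k y"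
      using nn_integral_kernel_AE_measurable[OF mult(2)] by blast
    have "(\<integral>\<^sup>+y. c * (\<integral>\<^sup>+s. f (s, y) \<partial>\<rho> y) \<partial>\<eta>) = (\<integral>\<^sup>+y. c * k y \<partial>\<eta>)"
      using k(2) by (intro nn_integral_cong_AE) auto
    moreover have "(\<integral>\<^sup>+y. (\<integral>\<^sup>+s. f (s, y) \<partial>\<rho> y) \<partial>\<eta>) = (\<integral>\<^sup>+y. k y \<partial>\<eta>)"
      by (intro nn_integral_cong_AE k)
    ultimately show ?case using mult by (simp add: nn_integral_cmult)
  next
    case (add f f')
    note [measurable] = add(1,4) measurable_section[OF add(1)] measurable_section[OF add(4)]
    obtain k where k [measurable]: "k \<in> borel_measurable \<eta>" "AE y in \<eta>. (\<integral>\<^sup>+s. f (s, y) \<partial>\<rho> y) = k y"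
      using nn_integral_kernel_AE_measurable[OF add(1)] by blast
    obtain k' where k' [measurable]: "k' \<in> borel_measurable \<eta>" "AE y in \<eta>. (\<integral>\<^sup>+s. f' (s, y) \<partial>\<rho> y) = k' y"
      using nn_integral_kernel_AE_measurable[OF add(4)] by blast
    have "(\<integral>\<^sup>+y. (\<integral>\<^sup>+s. f' (s, y) \<partial>\<rho> y) + (\<integral>\<^sup>+s. f (s, y) \<partial>\<rho> y) \<partial>\<eta>) = (\<integral>\<^sup>+y. k' y + k y \<partial>\<eta>)"
      using k(2) k'(2) by (intro nn_integral_cong_AE) auto
    moreover have "(\<integral>\<^sup>+y. (\<integral>\<^sup>+s. f (s, y) \<partial>\<rho> y) \<partial>\<eta>) = (\<integral>\<^sup>+y. k y \<partial>\<eta>)"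
        "(\<integral>\<^sup>+y. (\<integral>\<^sup>+s. f' (s, y) \<partial>\<rho> y) \<partial>\<eta>) = (\<integral>\<^sup>+y. k' y \<partial>\<eta>)"
      by (intro nn_integral_cong_AE k k')+
    ultimately show ?case using add by (simp add: nn_integral_add)
  next
    case (seq U)
    note [measurable] = seq(1) measurable_section[OF seq(1)]
    have "\<exists>k. k \<in> borel_measurable \<eta> \<and> (AE y in \<eta>. (\<integral>\<^sup>+s. U i (s, y) \<partial>\<rho> y) = k y)" for i
      using nn_integral_kernel_AE_measurable[OF seq(1)] by blast
    then obtain k where k [measurable]: "\<And>i. k i \<in> borel_measurable \<eta>"
        "\<And>i. AE y in \<eta>. (\<integral>\<^sup>+s. U i (s, y) \<partial>\<rho> y) = k i y"
      by metis
    then have AE_k: "AE y in \<eta>. \<forall>i. (\<integral>\<^sup>+s. U i (s, y) \<partial>\<rho> y) = k i y"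
      by (simp add: AE_all_countable)
    have U_mono: "i \<le> j \<Longrightarrow> U i x \<le> U j x" for i j x
      using seq(4) by (blast dest: incseqD le_funD)
    have "(\<integral>\<^sup>+y. (\<integral>\<^sup>+s. (SUP i. U i) (s, y) \<partial>\<rho> y) \<partial>\<eta>) = (\<integral>\<^sup>+y. (SUP i. \<integral>\<^sup>+s. U i (s, y) \<partial>\<rho> y) \<partial>\<eta>)"
      unfolding SUP_apply
      by (intro nn_integral_cong nn_integral_monotone_convergence_SUP)
        (auto simp: incseq_def le_fun_def U_mono)
    also have "\<dots> = (\<integral>\<^sup>+y. (SUP i. k i y) \<partial>\<eta>)"
      using AE_k by (intro nn_integral_cong_AE) auto
    \<comment> \<open>The versions \<open>k i\<close> increase only almost everywhere, as each is
      fixed only up to a null set.\<close>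
    also have "\<dots> = (SUP i. \<integral>\<^sup>+y. k i y \<partial>\<eta>)"
    proof (rule nn_integral_monotone_convergence_SUP_AE)
      show "AE y in \<eta>. k i y \<le> k (Suc i) y" for i
        using AE_k
      proof eventually_elim
        case (elim y)
        have "(\<integral>\<^sup>+s. U i (s, y) \<partial>\<rho> y) \<le> (\<integral>\<^sup>+s. U (Suc i) (s, y) \<partial>\<rho> y)"
          by (intro nn_integral_mono U_mono) simp
        with elim show ?case by simp
      qed
    qed simp
    also have "\<dots> = (SUP i. \<integral>\<^sup>+x. U i x \<partial>intensity \<rho> \<eta>)"
      using seq(3) nn_integral_cong_AE[OF k(2)] by simp
    also have "\<dots> = (\<integral>\<^sup>+x. (SUP i. U i) x \<partial>intensity \<rho> \<eta>)"
      unfolding SUP_apply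
      by (intro nn_integral_monotone_convergence_SUP[symmetric] seq(4)) measurable
    finally show ?case by simp
  qed
qed

lemma intensity_exp_tilt:
  assumes [measurable]: "h \<in> borel_measurable borel"
  shows "intensity (exp_tilt v h \<rho>) \<eta> = density (intensity \<rho> \<eta>) (\<lambda>(s, y). ennreal (exp (- v * h s)))"
    (is "_ = density ?\<nu> ?e")
proof -
  note [measurable_cong] = sets_kernel_borel and [measurable] = measurable_nn_integral_kernel
  have [measurable_cong]: "sets ?\<nu> = sets (borel \<Otimes>\<^sub>M borel)" by (rule sets_intensity)
  have space: "space ?\<nu> = UNIV" using sets_eq_imp_space_eq[OF sets_intensity] by simp
  \<comment> \<open>The tilted intensity is defined through \<open>measure_of\<close>, which
    collapses to the null measure unless its set function is countably additive. Writing the density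
    in the same form reduces the claim to an equality of set functions and so settles that question
    as well.\<close>
  have "density ?\<nu> ?e = measure_of UNIV (sets (borel \<Otimes>\<^sub>M borel)) (emeasure (density ?\<nu> ?e))"
    using measure_of_of_measure[of "density ?\<nu> ?e"] by (simp add: space sets_intensity)
  also have "\<dots> = intensity (exp_tilt v h \<rho>) \<eta>"
    unfolding intensity_def[of "exp_tilt v h \<rho>"]
  proof (rule measure_of_eq)
    fix B :: "('s \<times> 'y) set" assume "B \<in> sigma_sets UNIV (sets (borel \<Otimes>\<^sub>M borel))"
    then have B [measurable]: "B \<in> sets (borel \<Otimes>\<^sub>M borel)"
      using sets.sigma_sets_eq[of "borel \<Otimes>\<^sub>M borel :: ('s \<times> 'y) measure"] by simp
    have "emeasure (density ?\<nu> ?e) B = (\<integral>\<^sup>+x. ?e x * indicator B x \<partial>?\<nu>)"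
      by (intro emeasure_density) (auto simp: sets_intensity)
    also have "\<dots> = (\<integral>\<^sup>+y. (\<integral>\<^sup>+s. ?e (s, y) * indicator B (s, y) \<partial>\<rho> y) \<partial>\<eta>)"
      by (intro nn_integral_intensity) measurable
    also have "\<dots> = (\<integral>\<^sup>+y. emeasure (exp_tilt v h \<rho> y) {s. (s, y) \<in> B} \<partial>\<eta>)"
    proof (intro nn_integral_cong)
      fix y
      have "{s. (s, y) \<in> B} \<in> sets (\<rho> y)"
        using sets_Pair2[OF B, of y] by (simp add: vimage_def sets_kernel_borel)
      then show "(\<integral>\<^sup>+s. ?e (s, y) * indicator B (s, y) \<partial>\<rho> y) = emeasure (exp_tilt v h \<rho> y) {s. (s, y) \<in> B}"
        by (simp add: exp_tilt_def emeasure_density indicator_def of_bool_def)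
    qed
    finally show "emeasure (density ?\<nu> ?e) B = (\<integral>\<^sup>+y. emeasure (exp_tilt v h \<rho> y) {s. (s, y) \<in> B} \<partial>\<eta>)" .
  qed simp
  finally show ?thesis by (rule sym)
qed

end

end

subsection \<open>Partitions and added atoms\<close>

text \<open>\<open>C = {}\<close> stands for opening the new cell \<open>{a}\<close>: then
  \<open>insert a C = {a}\<close>, and removing \<open>{}\<close> from \<open>p\<close> changes
  nothing.\<close>

lemma partition_on_insert_point:
  assumes p: "partition_on S p" and C: "C \<in> insert {} p" and a: "a \<notin> S"
  shows "partition_on (insert a S) (insert (insert a C) (p - {C}))"
proof -
  have disj: "disjoint p" and union: "\<Union>p = S" and ne: "{} \<notin> p"
    using p by (simp_all add: partition_on_def)
  have *: "disjnt (insert a C) B" if "B \<in> p - {C}" for B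
  proof -
    have "a \<notin> B" using that union a by auto
    moreover have "disjnt C B" using that disj C by (cases "C = {}") (auto simp: pairwise_def)
    ultimately show ?thesis by simp
  qed
  have "disjoint (p - {C})"
    using disj by (rule pairwise_subset) auto
  then have "disjoint (insert (insert a C) (p - {C}))"
    using * by (subst pairwise_insert) (blast intro: disjnt_sym)
  moreover have "\<Union>(insert (insert a C) (p - {C})) = insert a S"
    using union C by auto
  ultimately show ?thesis
    using ne by (simp add: partition_on_def)
qed

text \<open>A partition of \<open>insert a S\<close> arises from a unique partition of \<open>S\<close> by adding \<open>a\<close> to one of
  its cells or to the empty set.\<close>

lemma sum_partitions_insert:
  fixes f :: "'i set set \<Rightarrow> 'b::comm_monoid_add"
  assumes S: "finite S" and a: "a \<notin> S"
  shows "(\<Sum>q | partition_on (insert a S) q. f q) =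
    (\<Sum>p | partition_on S p. f (insert {a} p) + (\<Sum>C\<in>p. f (insert (insert a C) (p - {C}))))"
proof -
  let ?P = "{p. partition_on S p}"
  define c where "c q = \<Union>{B \<in> q. a \<in> B}" for q
  \<comment> \<open>\<open>i\<close> removes \<open>a\<close>: its cell \<open>c q\<close> is
    replaced by \<open>c q - {a}\<close>, which \<open>- {{}}\<close> discards if it is empty; the
    second component remembers where \<open>a\<close> was. \<open>j\<close> puts it back.\<close>
  define i where "i q = ((q - {c q}) \<union> ({c q - {a}} - {{}}), c q - {a})" for q
  define j where "j x = insert (insert a (snd x)) (fst x - {snd x})" for x :: "'i set set \<times> 'i set"
  have c_eq: "c q = B" if "partition_on (insert a S) q" "B \<in> q" "a \<in> B" for q B
  proof -
    have "{B \<in> q. a \<in> B} = {B}"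
      using that by (auto simp: partition_on_def disjoint_def)
    then show ?thesis by (simp add: c_def)
  qed
  have i: "j (i q) = q" "i q \<in> Sigma ?P (insert {})" if q: "partition_on (insert a S) q" for q
  proof -
    obtain B where B: "B \<in> q" "a \<in> B"
      using q by (auto simp: partition_on_def)
    have c: "c q = B" using c_eq[OF q B] .
    have disj: "\<And>C. C \<in> q \<Longrightarrow> C \<noteq> B \<Longrightarrow> C \<inter> B = {}" and ne: "{} \<notin> q"
      and union: "\<Union>q = insert a S" and disj': "disjoint q"
      using q B by (auto simp: partition_on_def disjoint_def)
    \<comment> \<open>Otherwise reinserting \<open>a\<close>, which takes \<open>B - {a}\<close> out
      again, would delete an original cell of \<open>q\<close>.\<close>
    have "B - {a} \<notin> q"
    proof
      assume "B - {a} \<in> q"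
      moreover have "B - {a} \<noteq> B" using B by auto
      ultimately have "B - {a} = {}" using disj[of "B - {a}"] by auto
      with \<open>B - {a} \<in> q\<close> ne show False by simp
    qed
    then have "((q - {B}) \<union> ({B - {a}} - {{}})) - {B - {a}} = q - {B}" by auto
    moreover have "insert a (B - {a}) = B" using B by auto
    ultimately have "j (i q) = insert B (q - {B})"
      by (simp add: i_def j_def c)
    also have "\<dots> = q"
      by (rule insert_Diff[OF B(1)])
    finally show "j (i q) = q" .
    have *: "X \<union> (B - {a}) = S" if "X \<union> B = insert a S" "X \<inter> B = {}" for X
    proof -
      have "a \<notin> X" using that(2) B(2) by auto
      have "X \<union> (B - {a}) = (X \<union> B) - {a}" using \<open>a \<notin> X\<close> by auto
      then show ?thesis using that(1) a by simp
    qed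
    have "\<Union>({B - {a}} - {{}}) = B - {a}" by (cases "B - {a} = {}") auto
    moreover have "\<Union>(q - {B}) \<union> B = insert a S" using union B(1) by auto
    moreover have d: "\<Union>(q - {B}) \<inter> B = {}" using disj by auto
    ultimately have "\<Union>((q - {B}) \<union> ({B - {a}} - {{}})) = S"
      unfolding Union_Un_distrib by (simp only: *)
    moreover have "disjoint (q - {B})" using disj' by (rule pairwise_subset) auto
    then have "disjoint ((q - {B}) \<union> ({B - {a}} - {{}}))"
      using d by (cases "B - {a} = {}") (auto simp: pairwise_insert disjnt_def)
    ultimately have "partition_on S ((q - {B}) \<union> ({B - {a}} - {{}}))"
      using ne by (simp add: partition_on_def)
    then show "i q \<in> Sigma ?P (insert {})"
      unfolding i_def c by (intro SigmaI) auto
  qed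
  have j: "i (j (p, C)) = (p, C)" "partition_on (insert a S) (j (p, C))"
    if p: "partition_on S p" and C: "C \<in> insert {} p" for p C
  proof -
    note q = partition_on_insert_point[OF p C a]
    then show "partition_on (insert a S) (j (p, C))" by (simp add: j_def)
    have c: "c (j (p, C)) = insert a C"
      using c_eq[OF q, of "insert a C"] by (simp add: j_def)
    have aC: "a \<notin> C" "insert a C \<notin> p" and ne: "{} \<notin> p"
      using p C a by (auto simp: partition_on_def)
    then have "insert a C - {a} = C" by auto
    moreover have "insert (insert a C) (p - {C}) - {insert a C} = p - {C}"
      using aC by auto
    moreover have "p - {C} \<union> ({C} - {{}}) = p"
      using C ne by auto
    ultimately show "i (j (p, C)) = (p, C)"
      unfolding i_def c by (simp add: j_def)
  qed
  have "(\<Sum>q | partition_on (insert a S) q. f q) = (\<Sum>x\<in>Sigma ?P (insert {}). f (j x))"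
    using i j by (intro sum.reindex_bij_witness[of _ j i]) auto
  also have "\<dots> = (\<Sum>p\<in>?P. \<Sum>C\<in>insert {} p. f (insert (insert a C) (p - {C})))"
  proof (subst sum.Sigma)
    show "finite ?P" using S by (rule finitely_many_partition_on)
    show "\<forall>p\<in>?P. finite (insert {} p)" using finite_elements[OF S] by auto
  qed (simp add: case_prod_unfold j_def)
  also have "\<dots> = (\<Sum>p\<in>?P. f (insert {a} p) + (\<Sum>C\<in>p. f (insert (insert a C) (p - {C}))))"
    using finite_elements[OF S] by (intro sum.cong refl) (auto simp: partition_on_def)
  finally show ?thesis .
qed

section \<open>Adding finitely many atoms to a measure\<close>

definition add_atoms :: "'a measure \<Rightarrow> 'i set \<Rightarrow> ('i \<Rightarrow> 'a) \<Rightarrow> 'a measure" where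
  "add_atoms N I x = measure_of (space N) (sets N) (\<lambda>A. emeasure N A + (\<Sum>i\<in>I. indicator A (x i)))"

lemma sets_add_atoms [simp, measurable_cong]: "sets (add_atoms N I x) = sets N"
  by (simp add: add_atoms_def)

lemma space_add_atoms [simp]: "space (add_atoms N I x) = space N"
  by (simp add: add_atoms_def)

lemma emeasure_add_atoms:
  assumes "A \<in> sets N"
  shows "emeasure (add_atoms N I x) A = emeasure N A + (\<Sum>i\<in>I. indicator A (x i))"
proof (rule emeasure_measure_of[OF add_atoms_def])
  show "positive (sets (add_atoms N I x)) (\<lambda>A. emeasure N A + (\<Sum>i\<in>I. indicator A (x i)))"
    by (simp add: positive_def)
  show "countably_additive (sets (add_atoms N I x)) (\<lambda>A. emeasure N A + (\<Sum>i\<in>I. indicator A (x i)))"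
  proof (rule countably_additiveI)
    fix A :: "nat \<Rightarrow> 'a set"
    assume A: "range A \<subseteq> sets (add_atoms N I x)" "disjoint_family A"
    have "(\<Sum>k. emeasure N (A k) + (\<Sum>i\<in>I. indicator (A k) (x i))) =
        (\<Sum>k. emeasure N (A k)) + (\<Sum>i\<in>I. \<Sum>k. indicator (A k) (x i) :: ennreal)"
      by (subst suminf_add[symmetric]) (auto simp: suminf_sum)
    then show "(\<Sum>k. emeasure N (A k) + (\<Sum>i\<in>I. indicator (A k) (x i))) =
        emeasure N (\<Union>k. A k) + (\<Sum>i\<in>I. indicator (\<Union>k. A k) (x i))"
      using A by (simp add: suminf_emeasure suminf_indicator)
  qed
qed (use assms in \<open>auto dest: sets.sets_into_space\<close>)

lemma nn_integral_add_atoms: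
  assumes "f \<in> borel_measurable N" and x: "\<And>i. i \<in> I \<Longrightarrow> x i \<in> space N"
  shows "(\<integral>\<^sup>+z. f z \<partial>add_atoms N I x) = (\<integral>\<^sup>+z. f z \<partial>N) + (\<Sum>i\<in>I. f (x i))"
  using assms(1)
proof induct
  case (cong f g)
  moreover have "(\<Sum>i\<in>I. f (x i)) = (\<Sum>i\<in>I. g (x i))"
    using x cong(3) by (intro sum.cong) auto
  moreover have "(\<integral>\<^sup>+z. f z \<partial>N) = (\<integral>\<^sup>+z. g z \<partial>N)" "(\<integral>\<^sup>+z. f z \<partial>add_atoms N I x) = (\<integral>\<^sup>+z. g z \<partial>add_atoms N I x)"
    using cong(3) by (auto intro!: nn_integral_cong)
  ultimately show ?case by simp
next
  case (set A)
  then show ?case by (simp add: emeasure_add_atoms)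
next
  case (mult f c)
  then show ?case by (simp add: nn_integral_cmult distrib_left sum_distrib_left)
next
  case (add f g)
  then show ?case by (simp add: nn_integral_add sum.distrib ac_simps)
next
  case (seq U)
  have inc: "incseq (\<lambda>i. U i z)" for z using seq(4) by (auto simp: incseq_def le_fun_def)
  have "(\<integral>\<^sup>+z. (SUP i. U i) z \<partial>add_atoms N I x) = (SUP i. \<integral>\<^sup>+z. U i z \<partial>add_atoms N I x)"
    unfolding SUP_apply using seq by (intro nn_integral_monotone_convergence_SUP) auto
  also have "\<dots> = (SUP i. (\<integral>\<^sup>+z. U i z \<partial>N) + (\<Sum>j\<in>I. U i (x j)))"
    using seq by simp
  also have "\<dots> = (SUP i. \<integral>\<^sup>+z. U i z \<partial>N) + (SUP i. \<Sum>j\<in>I. U i (x j))"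
    using seq(4) by (intro ennreal_SUP_add)
      (auto simp: incseq_def le_fun_def intro!: nn_integral_mono sum_mono)
  also have "(SUP i. \<integral>\<^sup>+z. U i z \<partial>N) = (\<integral>\<^sup>+z. (SUP i. U i) z \<partial>N)"
    unfolding SUP_apply using seq by (intro nn_integral_monotone_convergence_SUP[symmetric]) auto
  also have "(SUP i. \<Sum>j\<in>I. U i (x j)) = (\<Sum>j\<in>I. (SUP i. U i) (x j))"
    unfolding SUP_apply by (intro incseq_sumI2 ennreal_SUP_sum inc)
  finally show ?case .
qed

lemma add_atoms_empty: "add_atoms N {} x = N"
  by (simp add: add_atoms_def measure_of_of_measure)

text \<open>The Mecke equation adds one atom at a time under a dummy index \<open>c\<close>; here it
  is renamed to a fresh \<open>i\<close> and joins the indexed family.\<close>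

lemma add_atoms_add_atom:
  assumes "finite I" "i \<notin> I"
  shows "add_atoms (add_atoms N {c} (\<lambda>_. y)) I x = add_atoms N (insert i I) (x(i := y))"
proof (rule measure_eqI)
  fix A assume A: "A \<in> sets (add_atoms (add_atoms N {c} (\<lambda>_. y)) I x)"
  have "(\<Sum>j\<in>I. indicator A ((x(i := y)) j) :: ennreal) = (\<Sum>j\<in>I. indicator A (x j))"
    using assms by (intro sum.cong) auto
  with A show "emeasure (add_atoms (add_atoms N {c} (\<lambda>_. y)) I x) A = emeasure (add_atoms N (insert i I) (x(i := y))) A"
    using assms by (simp add: emeasure_add_atoms ac_simps)
qed simp

lemma measurable_add_atoms [measurable]:
  fixes K :: "'a measure"
  assumes [measurable]: "f \<in> measurable M (measure_algebra K)"
    and "\<And>i. i \<in> I \<Longrightarrow> (\<lambda>\<omega>. g \<omega> i) \<in> measurable M K"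
  shows "(\<lambda>\<omega>. add_atoms (f \<omega>) I (g \<omega>)) \<in> measurable M (measure_algebra K)"
proof (rule measurable_measure_algebra)
  have sets: "sets (f \<omega>) = sets K" if "\<omega> \<in> space M" for \<omega>
    using measurable_space[OF assms(1) that] by (simp add: space_measure_algebra)
  then show "\<omega> \<in> space M \<Longrightarrow> sets (add_atoms (f \<omega>) I (g \<omega>)) = sets K" for \<omega>
    by simp
  fix A assume A [measurable]: "A \<in> sets K"
  have "(\<lambda>\<omega>. emeasure (f \<omega>) A + (\<Sum>i\<in>I. indicator A (g \<omega> i))) \<in> borel_measurable M"
    using assms(2) by (intro borel_measurable_add borel_measurable_sum) auto
  then show "(\<lambda>\<omega>. emeasure (add_atoms (f \<omega>) I (g \<omega>)) A) \<in> borel_measurable M"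
    by (rule measurable_cong[THEN iffD1, rotated]) (simp add: emeasure_add_atoms sets A)
qed

subsection \<open>The Mecke equation\<close>

text \<open>\<open>b\<close> may vary with \<open>k\<close> because in the application
  \<open>1 - exp (- t)\<close> takes the place of \<open>t\<close> in the inner exponent, which
  perturbs the limit constant by a factor tending to 1.\<close>

lemma tendsto_difference_quotient_nexp:
  assumes "0 \<le> r" and b: "b \<longlonglongrightarrow> r"
  shows "(\<lambda>k. 2 ^ k * (1 - exp (- (b k / 2 ^ k)))) \<longlonglongrightarrow> (r::real)"
proof -
  have D: "((\<lambda>t. (1 - exp (- t)) / t) \<longlongrightarrow> 1) (at (0::real))"
  proof -
    have "((\<lambda>t. 1 - exp (- t)) has_real_derivative 1) (at (0::real))"
      by (auto intro!: derivative_eq_intros)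
    then show ?thesis by (simp add: has_field_derivative_iff)
  qed
  \<comment> \<open>The continuous extension of the quotient to \<open>t = 0\<close>, as
    \<open>b k\<close> may vanish.\<close>
  define \<phi> where "\<phi> t = (if t = 0 then 1 else (1 - exp (- t)) / t)" for t :: real
  have "isCont \<phi> 0"
    using D unfolding isCont_def \<phi>_def
    by (subst LIM_equal[where g="\<lambda>t. (1 - exp (- t)) / t"]) auto
  moreover have "(\<lambda>k. b k * (1 / 2) ^ k) \<longlonglongrightarrow> r * 0"
    by (intro tendsto_mult b LIMSEQ_realpow_zero) auto
  ultimately have "(\<lambda>k. b k * \<phi> (b k * (1 / 2) ^ k)) \<longlonglongrightarrow> r * \<phi> 0"
    using b by (intro tendsto_mult) (auto intro: isCont_tendsto_compose)
  moreover have "b k * \<phi> (b k * (1 / 2) ^ k) = 2 ^ k * (1 - exp (- (b k / 2 ^ k)))" for k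
    by (simp add: \<phi>_def field_simps power_divide)
  ultimately show ?thesis by (simp add: \<phi>_def)
qed

text \<open>The quotient \<open>(1 - exp (- t * z)) / t\<close> at \<open>t = 2^-k\<close>, an
  approximation of \<open>z\<close> from below that stays finite even at
  \<open>z = \<infinity>\<close>.\<close>

definition diff_quot :: "nat \<Rightarrow> ennreal \<Rightarrow> ennreal" where
  "diff_quot k z = 2 ^ k * (1 - nexp (ennreal (1 / 2 ^ k) * z))"

lemma measurable_diff_quot [measurable]: "diff_quot k \<in> borel_measurable borel"
  unfolding diff_quot_def by measurable

lemma diff_quot_ennreal:
  assumes "0 \<le> r"
  shows "diff_quot k (ennreal r) = ennreal (2 ^ k * (1 - exp (- (r / 2 ^ k))))"
proof -
  have "nexp (ennreal (1 / 2 ^ k) * ennreal r) = ennreal (exp (- (r / 2 ^ k)))"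
    using assms by (simp add: nexp_ennreal flip: ennreal_mult)
  moreover have "(1::ennreal) - ennreal (exp (- (r / 2 ^ k))) = ennreal (1 - exp (- (r / 2 ^ k)))"
    by (simp add: ennreal_minus flip: ennreal_1)
  moreover have "(2::ennreal) ^ k = ennreal (2 ^ k)"
    by (simp add: ennreal_power[symmetric])
  ultimately show ?thesis
    using assms by (simp add: diff_quot_def ennreal_mult)
qed

lemma diff_quot_top: "diff_quot k \<top> = 2 ^ k"
  by (simp add: diff_quot_def ennreal_mult_top)

text \<open>Along powers of \<open>2\<close> the difference quotients \<open>(1 - exp (-t z)) / t\<close> increase, because
  \<open>1 - x\<^sup>2 = (1 - x) (1 + x) \<le> 2 (1 - x)\<close> for \<open>x \<le> 1\<close>.\<close>

lemma incseq_diff_quot: "incseq (\<lambda>k. diff_quot k z)"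
proof (rule incseq_SucI)
  fix k
  show "diff_quot k z \<le> diff_quot (Suc k) z"
  proof (cases z)
    case (real r)
    define x where "x = exp (- (r / 2 ^ Suc k))"
    have x: "0 \<le> x" "x \<le> 1" using real by (simp_all add: x_def)
    have "exp (- (r / 2 ^ k)) = x * x"
      by (simp add: x_def field_simps flip: exp_add)
    moreover have "1 - x * x \<le> 2 * (1 - x)"
      using zero_le_power2[of "1 - x"] by (simp add: power2_eq_square algebra_simps)
    then have "2 ^ k * (1 - x * x) \<le> 2 ^ k * (2 * (1 - x))"
      by (intro mult_left_mono) auto
    ultimately show ?thesis
      using real by (simp add: diff_quot_ennreal x_def[symmetric] ennreal_leI del: power_Suc) (simp add: ennreal_leI)
  next
    case top
    have "1 * (2::ennreal) ^ k \<le> 2 * 2 ^ k" by (intro mult_right_mono) auto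
    with top show ?thesis by (simp add: diff_quot_top)
  qed
qed

lemma tendsto_power2_ennreal: "(\<lambda>k. 2 ^ k :: ennreal) \<longlonglongrightarrow> \<top>"
proof (rule tendsto_sandwich[OF _ _ of_nat_tendsto_top_ennreal tendsto_const])
  show "\<forall>\<^sub>F k in sequentially. (of_nat k :: ennreal) \<le> 2 ^ k"
  proof (rule always_eventually, rule allI)
    fix k :: nat
    have "(of_nat k :: ennreal) \<le> of_nat (2 ^ k)"
      by (intro of_nat_mono less_imp_le less_exp)
    then show "(of_nat k :: ennreal) \<le> 2 ^ k" by simp
  qed
qed simp

lemma tendsto_diff_quot: "(\<lambda>k. diff_quot k z) \<longlonglongrightarrow> z"
proof (cases z)
  case (real r)
  then show ?thesis
    using tendsto_difference_quotient_nexp[of r "\<lambda>_. r"]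
    by (simp add: diff_quot_ennreal tendsto_ennrealI)
qed (simp add: diff_quot_top tendsto_power2_ennreal)

text \<open>Subtraction on [0, \<infinity>] is truncated, hence the bounds. With
  \<open>a = exp (- u)\<close> and \<open>c = exp (- t)\<close>, the second identity describes how
  the exponent of the Laplace functional changes when \<open>t\<close> is added to \<open>u\<close>:
  by \<open>1 - exp (- t)\<close> integrated against the intensity reweighted by
  \<open>exp (- u)\<close>. The Mecke equation and the exponential tilting both come from
  this.\<close>

lemma diff_mult_distrib_ennreal_le_1:
  fixes a c :: ennreal
  assumes "a \<le> 1" "c \<le> 1"
  shows "(1 - c) * a = a - c * a" and "1 - a * c = (1 - a) + (1 - c) * a"
proof -
  obtain r where r: "a = ennreal r" "0 \<le> r" "r \<le> 1"
    using assms(1) by (cases a) (auto simp: top_unique)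
  obtain q where q: "c = ennreal q" "0 \<le> q" "q \<le> 1"
    using assms(2) by (cases c) (auto simp: top_unique)
  have qr: "q * r \<le> 1" using r q by (simp add: mult_le_one)
  have 1: "1 - ennreal z = ennreal (1 - z)" if "0 \<le> z" for z
    using that by (simp add: ennreal_minus flip: ennreal_1)
  show "(1 - c) * a = a - c * a"
    using r q qr by (simp add: 1 ennreal_minus algebra_simps flip: ennreal_mult)
  have "1 - q * r = (1 - r) + (1 - q) * r" by (simp add: algebra_simps)
  then show "1 - a * c = (1 - a) + (1 - c) * a"
    using r q qr by (simp add: 1 mult.commute flip: ennreal_mult ennreal_plus)
qed

context poisson_laplace
begin

text \<open>The left side is a difference quotient of the Laplace functional in direction
  \<open>indicator D\<close>. The factor after \<open>laplace_functional L u\<close> is a scalar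
  difference quotient, whose limit is elementary.\<close>

lemma nn_integral_diff_quot_laplace:
  assumes [measurable]: "D \<in> sets \<nu>" "u \<in> borel_measurable \<nu>"
  shows "(\<integral>\<^sup>+N. diff_quot k (emeasure N D) * nexp (\<integral>\<^sup>+x. u x \<partial>N) \<partial>L) =
    laplace_functional L u * (2 ^ k * (1 - nexp ((1 - nexp (ennreal (1 / 2 ^ k))) * (\<integral>\<^sup>+x. nexp (u x) * indicator D x \<partial>\<nu>))))"
proof -
  let ?t = "ennreal (1 / 2 ^ k)"
  have "laplace_functional L (\<lambda>x. u x + ?t * indicator D x) =
      (\<integral>\<^sup>+N. nexp (?t * emeasure N D) * nexp (\<integral>\<^sup>+x. u x \<partial>N) \<partial>L)"
    unfolding laplace_functional_def
    by (intro nn_integral_cong, subst nn_integral_add)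
      (auto simp: space_L nexp_add nn_integral_cmult mult.commute[of "nexp (_ * _)"] cong: measurable_cong_sets)
  moreover have "laplace_functional L (\<lambda>x. u x + ?t * indicator D x) =
      nexp (\<integral>\<^sup>+x. (1 - nexp (u x)) \<partial>\<nu>) * nexp (\<integral>\<^sup>+x. (1 - nexp ?t) * (nexp (u x) * indicator D x) \<partial>\<nu>)"
  proof -
    have "1 - nexp (u x + ?t * indicator D x) = (1 - nexp (u x)) + (1 - nexp ?t) * (nexp (u x) * indicator D x)" for x
      using diff_mult_distrib_ennreal_le_1(2)[of "nexp (u x)" "nexp ?t"]
      by (simp add: nexp_le_1 nexp_add indicator_def)
    then show ?thesis
      by (subst laplace) (simp_all add: nn_integral_add nexp_add)
  qed
  ultimately have shift: "(\<integral>\<^sup>+N. nexp (?t * emeasure N D) * nexp (\<integral>\<^sup>+x. u x \<partial>N) \<partial>L) =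
      laplace_functional L u * nexp ((1 - nexp ?t) * (\<integral>\<^sup>+x. nexp (u x) * indicator D x \<partial>\<nu>))"
    by (simp add: laplace nn_integral_cmult)
  have "(\<integral>\<^sup>+N. diff_quot k (emeasure N D) * nexp (\<integral>\<^sup>+x. u x \<partial>N) \<partial>L) =
      (\<integral>\<^sup>+N. 2 ^ k * (nexp (\<integral>\<^sup>+x. u x \<partial>N) - nexp (?t * emeasure N D) * nexp (\<integral>\<^sup>+x. u x \<partial>N)) \<partial>L)"
    by (intro nn_integral_cong)
      (simp add: diff_quot_def mult.assoc diff_mult_distrib_ennreal_le_1(1) nexp_le_1)
  also have "\<dots> = 2 ^ k * (laplace_functional L u - (\<integral>\<^sup>+N. nexp (?t * emeasure N D) * nexp (\<integral>\<^sup>+x. u x \<partial>N) \<partial>L))"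
    unfolding laplace_functional_def
  proof (subst nn_integral_cmult, measurable, subst nn_integral_diff)
    have "(\<integral>\<^sup>+N. nexp (?t * emeasure N D) * nexp (\<integral>\<^sup>+x. u x \<partial>N) \<partial>L) \<le> (\<integral>\<^sup>+N. 1 \<partial>L)"
      by (intro nn_integral_mono mult_le_one nexp_le_1) auto
    then show "(\<integral>\<^sup>+N. nexp (?t * emeasure N D) * nexp (\<integral>\<^sup>+x. u x \<partial>N) \<partial>L) \<noteq> \<infinity>"
      by (auto simp: emeasure_space_1 top_unique)
    show "AE N in L. nexp (?t * emeasure N D) * nexp (\<integral>\<^sup>+x. u x \<partial>N) \<le> nexp (\<integral>\<^sup>+x. u x \<partial>N)"
      using mult_right_mono[OF nexp_le_1] by (intro AE_I2) fastforce
  qed simp_all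
  also have "\<dots> = laplace_functional L u * (2 ^ k * (1 - nexp ((1 - nexp ?t) * (\<integral>\<^sup>+x. nexp (u x) * indicator D x \<partial>\<nu>))))"
  proof -
    have "laplace_functional L u - laplace_functional L u * nexp c = laplace_functional L u * (1 - nexp c)" for c
      using diff_mult_distrib_ennreal_le_1(1)[of "laplace_functional L u" "nexp c"]
      by (simp add: laplace nexp_le_1 mult.commute)
    then show ?thesis unfolding shift by (simp only: mult.left_commute)
  qed
  finally show ?thesis .
qed

text \<open>The derivative at \<open>t = 0\<close> of the Laplace functional at \<open>u + t * indicator D\<close>, up to sign.\<close>

lemma mecke_laplace:
  assumes [measurable]: "D \<in> sets \<nu>" and fin: "emeasure \<nu> D \<noteq> \<infinity>" and [measurable]: "u \<in> borel_measurable \<nu>"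
  shows "(\<integral>\<^sup>+N. emeasure N D * nexp (\<integral>\<^sup>+x. u x \<partial>N) \<partial>L) =
    (\<integral>\<^sup>+x. nexp (u x) * indicator D x \<partial>\<nu>) * laplace_functional L u"
proof (rule LIMSEQ_unique)
  let ?b = "\<integral>\<^sup>+x. nexp (u x) * indicator D x \<partial>\<nu>"
  have "?b \<le> (\<integral>\<^sup>+x. indicator D x \<partial>\<nu>)"
    by (intro nn_integral_mono) (auto simp: nexp_le_1 indicator_def)
  then have "?b < \<top>"
    using fin by (auto simp: less_top[symmetric] top_unique)
  then obtain b where b: "?b = ennreal b" "0 \<le> b" by (cases ?b) auto
  \<comment> \<open>Monotone convergence, as the dyadic quotients increase to
    \<open>N(D)\<close>.\<close>
  show "(\<lambda>k. \<integral>\<^sup>+N. diff_quot k (emeasure N D) * nexp (\<integral>\<^sup>+x. u x \<partial>N) \<partial>L)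
      \<longlonglongrightarrow> (\<integral>\<^sup>+N. emeasure N D * nexp (\<integral>\<^sup>+x. u x \<partial>N) \<partial>L)"
    using incseq_diff_quot unfolding mult.commute[of _ "nexp _"]
    by (intro nn_integral_LIMSEQ ennreal_tendsto_cmult tendsto_diff_quot)
      (auto simp: incseq_def le_fun_def intro!: mult_left_mono)
  \<comment> \<open>The inner \<open>1 - exp (- t)\<close> is written as \<open>t\<close> times a
    factor tending to 1, which gives the shape of \<open>tendsto_difference_quotient_nexp\<close>
    with varying \<open>b\<close>.\<close>
  have "2 ^ k * (1 - nexp ((1 - nexp (ennreal (1 / 2 ^ k))) * ?b)) =
      ennreal (2 ^ k * (1 - exp (- (b * (2 ^ k * (1 - exp (- (1 / 2 ^ k)))) / 2 ^ k))))" for k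
  proof -
    have "1 - nexp (ennreal (1 / 2 ^ k)) = ennreal (1 - exp (- (1 / 2 ^ k)))"
      by (simp add: nexp_ennreal ennreal_minus flip: ennreal_1)
    then show ?thesis
      using b diff_quot_ennreal[of "b * (2 ^ k * (1 - exp (- (1 / 2 ^ k))))" k]
      by (simp add: diff_quot_def ac_simps flip: ennreal_mult)
  qed
  moreover have "(\<lambda>k. ennreal (2 ^ k * (1 - exp (- (b * (2 ^ k * (1 - exp (- (1 / 2 ^ k)))) / 2 ^ k))))) \<longlonglongrightarrow> ennreal b"
    using tendsto_mult[OF tendsto_const[of b] tendsto_difference_quotient_nexp[of 1 "\<lambda>_. 1"]] b
    by (intro tendsto_ennrealI tendsto_difference_quotient_nexp) simp_all
  ultimately have "(\<lambda>k. laplace_functional L u * (2 ^ k * (1 - nexp ((1 - nexp (ennreal (1 / 2 ^ k))) * ?b))))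
      \<longlonglongrightarrow> laplace_functional L u * ennreal b"
    by (intro ennreal_tendsto_cmult) (auto simp: laplace)
  then show "(\<lambda>k. \<integral>\<^sup>+N. diff_quot k (emeasure N D) * nexp (\<integral>\<^sup>+x. u x \<partial>N) \<partial>L)
      \<longlonglongrightarrow> ?b * laplace_functional L u"
    unfolding nn_integral_diff_quot_laplace[OF assms(1,3)] by (simp only: b(1) mult.commute[of "ennreal b"])
qed

end

context poisson_laplace
begin

lemma measurable_add_atom_pair [measurable]:
  "(\<lambda>(x, N). add_atoms N {()} (\<lambda>_. x)) \<in> measurable (\<nu> \<Otimes>\<^sub>M L) (measure_algebra \<nu>)"
  unfolding case_prod_unfold by (rule measurable_add_atoms) measurable

text \<open>Passes from exponentials to all measurable \<open>F\<close>: both sides integrate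
  \<open>F\<close> against measures \<open>K1\<close> and \<open>K2\<close> on the space of
  measures, which have the same Laplace functional by \<open>mecke_laplace\<close>. Both have total
  mass \<nu>(D), and the uniqueness theorem is about finite measures, whence the restriction on
  \<open>D\<close>.\<close>

lemma mecke_finite_set:
  assumes D [measurable]: "D \<in> sets \<nu>" and fin: "emeasure \<nu> D \<noteq> \<infinity>"
    and [measurable]: "F \<in> borel_measurable (measure_algebra \<nu>)"
  shows "(\<integral>\<^sup>+N. emeasure N D * F N \<partial>L) =
    (\<integral>\<^sup>+x. indicator D x * (\<integral>\<^sup>+N. F (add_atoms N {()} (\<lambda>_. x)) \<partial>L) \<partial>\<nu>)"
proof -
  define K1 where "K1 = density L (\<lambda>N. emeasure N D)"
  define K2 where "K2 = distr (density \<nu> (indicator D) \<Otimes>\<^sub>M L) (measure_algebra \<nu>) (\<lambda>(x, N). add_atoms N {()} (\<lambda>_. x))"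
  have K1: "(\<integral>\<^sup>+N. G N \<partial>K1) = (\<integral>\<^sup>+N. emeasure N D * G N \<partial>L)"
    if [measurable]: "G \<in> borel_measurable (measure_algebra \<nu>)" for G
    by (simp add: K1_def nn_integral_density)
  have K2: "(\<integral>\<^sup>+N. G N \<partial>K2) = (\<integral>\<^sup>+x. indicator D x * (\<integral>\<^sup>+N. G (add_atoms N {()} (\<lambda>_. x)) \<partial>L) \<partial>\<nu>)"
    if [measurable]: "G \<in> borel_measurable (measure_algebra \<nu>)" for G
  proof -
    have [measurable]: "(\<lambda>z. G (add_atoms (snd z) {()} (\<lambda>_. fst z))) \<in> borel_measurable (\<nu> \<Otimes>\<^sub>M L)"
      using measurable_compose[OF measurable_add_atom_pair that] by (simp add: case_prod_unfold)
    have "(\<integral>\<^sup>+N. G N \<partial>K2) = (\<integral>\<^sup>+z. G (add_atoms (snd z) {()} (\<lambda>_. fst z)) \<partial>(density \<nu> (indicator D) \<Otimes>\<^sub>M L))"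
      unfolding K2_def by (subst nn_integral_distr) (auto simp: case_prod_unfold)
    also have "\<dots> = (\<integral>\<^sup>+x. (\<integral>\<^sup>+N. G (add_atoms N {()} (\<lambda>_. x)) \<partial>L) \<partial>density \<nu> (indicator D))"
      by (subst nn_integral_fst[symmetric]) auto
    also have "\<dots> = (\<integral>\<^sup>+x. indicator D x * (\<integral>\<^sup>+N. G (add_atoms N {()} (\<lambda>_. x)) \<partial>L) \<partial>\<nu>)"
      using borel_measurable_nn_integral_fst[of "\<lambda>z. G (add_atoms (snd z) {()} (\<lambda>_. fst z))" \<nu>]
      by (subst nn_integral_density) auto
    finally show ?thesis .
  qed
  have sets: "sets K1 = sets (measure_algebra \<nu>)" "sets K2 = sets (measure_algebra \<nu>)"
    by (simp_all add: K1_def K2_def sets_L)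
  have lapl: "laplace_functional K1 u = laplace_functional K2 u" if [measurable]: "u \<in> borel_measurable \<nu>" for u
  proof -
    have "laplace_functional K2 u =
        (\<integral>\<^sup>+x. indicator D x * (\<integral>\<^sup>+N. nexp (\<integral>\<^sup>+z. u z \<partial>add_atoms N {()} (\<lambda>_. x)) \<partial>L) \<partial>\<nu>)"
      unfolding laplace_functional_def by (rule K2) measurable
    also have "\<dots> = (\<integral>\<^sup>+x. (nexp (u x) * indicator D x) * laplace_functional L u \<partial>\<nu>)"
    proof (intro nn_integral_cong)
      fix x assume "x \<in> space \<nu>"
      have "(\<integral>\<^sup>+N. nexp (\<integral>\<^sup>+z. u z \<partial>add_atoms N {()} (\<lambda>_. x)) \<partial>L) = (\<integral>\<^sup>+N. nexp (u x) * nexp (\<integral>\<^sup>+z. u z \<partial>N) \<partial>L)"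
        using \<open>x \<in> space \<nu>\<close>
        by (intro nn_integral_cong, subst nn_integral_add_atoms)
          (auto simp: space_L nexp_add mult.commute dest: sets_eq_imp_space_eq cong: measurable_cong_sets)
      then show "indicator D x * (\<integral>\<^sup>+N. nexp (\<integral>\<^sup>+z. u z \<partial>add_atoms N {()} (\<lambda>_. x)) \<partial>L) =
          (nexp (u x) * indicator D x) * laplace_functional L u"
        by (simp add: nn_integral_cmult laplace_functional_def ac_simps)
    qed
    also have "\<dots> = (\<integral>\<^sup>+x. nexp (u x) * indicator D x \<partial>\<nu>) * laplace_functional L u"
      by (rule nn_integral_multc) measurable
    also have "\<dots> = laplace_functional K1 u"
      unfolding laplace_functional_def using fin
      by (subst K1) (simp_all add: mecke_laplace laplace_functional_def)
    finally show ?thesis by simp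
  qed
  have total: "(\<integral>\<^sup>+N. 1 \<partial>K1) = emeasure \<nu> D"
    using mecke_laplace[OF D fin, of "\<lambda>_. 0"] by (subst K1) (auto simp: laplace_functional_def emeasure_space_1)
  have "finite_measure K1"
    using total fin by (intro finite_measureI) simp
  moreover have "finite_measure K2"
    using total fin lapl[of "\<lambda>_. 0"] by (intro finite_measureI) (simp add: laplace_functional_def)
  ultimately have "K1 = K2"
    by (rule measure_algebra_eqI[OF _ _ sets lapl])
  then show ?thesis
    using K1[of F] K2[of F] by simp
qed

text \<open>Monotone class argument in \<open>f\<close>; for an indicator, \<sigma>-finiteness cuts
  the set into countably many pieces of finite intensity.\<close>

lemma mecke:
  assumes "sigma_finite_measure \<nu>" and "f \<in> borel_measurable \<nu>"
    and [measurable]: "F \<in> borel_measurable (measure_algebra \<nu>)"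
  shows "(\<integral>\<^sup>+N. (\<integral>\<^sup>+x. f x \<partial>N) * F N \<partial>L) =
    (\<integral>\<^sup>+x. f x * (\<integral>\<^sup>+N. F (add_atoms N {()} (\<lambda>_. x)) \<partial>L) \<partial>\<nu>)"
proof -
  let ?G = "\<lambda>x. \<integral>\<^sup>+N. F (add_atoms N {()} (\<lambda>_. x)) \<partial>L"
  have [measurable]: "?G \<in> borel_measurable \<nu>"
    using borel_measurable_nn_integral_fst[of "\<lambda>z. F (add_atoms (snd z) {()} (\<lambda>_. fst z))" \<nu>]
      measurable_compose[OF measurable_add_atom_pair assms(3)]
    by (simp add: case_prod_unfold)
  show ?thesis
    using assms(2)
  proof induct
    case (cong f g)
    moreover have "(\<integral>\<^sup>+N. (\<integral>\<^sup>+x. f x \<partial>N) * F N \<partial>L) = (\<integral>\<^sup>+N. (\<integral>\<^sup>+x. g x \<partial>N) * F N \<partial>L)"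
      using cong(3) by (intro nn_integral_cong arg_cong2[where f="(*)"] refl)
        (auto simp: space_L dest: sets_eq_imp_space_eq)
    moreover have "(\<integral>\<^sup>+x. f x * ?G x \<partial>\<nu>) = (\<integral>\<^sup>+x. g x * ?G x \<partial>\<nu>)"
      using cong(3) by (intro nn_integral_cong) simp
    ultimately show ?case by simp
  next
    case (set A)
    note set [measurable]
    interpret \<nu>: sigma_finite_measure \<nu> by fact
    obtain C :: "nat \<Rightarrow> 'a set" where C: "range C \<subseteq> sets \<nu>" "(\<Union>i. C i) = space \<nu>"
        "\<And>i. emeasure \<nu> (C i) \<noteq> \<infinity>" "disjoint_family C"
      using \<nu>.sigma_finite_disjoint by blast
    define D where "D i = A \<inter> C i" for i
    have D [measurable]: "D i \<in> sets \<nu>" for i using C(1) by (auto simp: D_def)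
    have disj: "disjoint_family D" using C(4) by (auto simp: D_def disjoint_family_on_def)
    have A: "(\<Union>i. D i) = A" using C(2) sets.sets_into_space[OF set] by (auto simp: D_def)
    have fin: "emeasure \<nu> (D i) \<noteq> \<infinity>" for i
      using emeasure_mono[of "D i" "C i" \<nu>] C by (auto simp: D_def top_unique)
    have "(\<integral>\<^sup>+N. (\<integral>\<^sup>+x. indicator A x \<partial>N) * F N \<partial>L) = (\<integral>\<^sup>+N. (\<Sum>i. emeasure N (D i) * F N) \<partial>L)"
    proof (intro nn_integral_cong)
      fix N assume "N \<in> space L"
      then have sets: "sets N = sets \<nu>" by (simp add: space_L)
      have "emeasure N A = (\<Sum>i. emeasure N (D i))"
        using disj D by (subst suminf_emeasure) (auto simp: A sets)
      then show "(\<integral>\<^sup>+x. indicator A x \<partial>N) * F N = (\<Sum>i. emeasure N (D i) * F N)"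
        using set sets by (simp add: ennreal_suminf_multc)
    qed
    also have "\<dots> = (\<Sum>i. \<integral>\<^sup>+N. emeasure N (D i) * F N \<partial>L)"
      by (rule nn_integral_suminf) measurable
    also have "\<dots> = (\<Sum>i. \<integral>\<^sup>+x. indicator (D i) x * ?G x \<partial>\<nu>)"
      by (intro suminf_cong mecke_finite_set fin) measurable
    also have "\<dots> = (\<integral>\<^sup>+x. (\<Sum>i. indicator (D i) x * ?G x) \<partial>\<nu>)"
      by (rule nn_integral_suminf[symmetric]) measurable
    also have "\<dots> = (\<integral>\<^sup>+x. indicator A x * ?G x \<partial>\<nu>)"
      using disj by (simp add: ennreal_suminf_multc suminf_indicator A)
    finally show ?case .
  next
    case (mult f c)
    note mult(2) [measurable]
    have "(\<integral>\<^sup>+N. (\<integral>\<^sup>+x. c * f x \<partial>N) * F N \<partial>L) = (\<integral>\<^sup>+N. c * ((\<integral>\<^sup>+x. f x \<partial>N) * F N) \<partial>L)"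
      by (intro nn_integral_cong, subst nn_integral_cmult)
        (auto simp: space_L mult.assoc cong: measurable_cong_sets)
    with mult show ?case by (simp add: nn_integral_cmult mult.assoc)
  next
    case (add f g)
    note add(1,4) [measurable]
    have "(\<integral>\<^sup>+N. (\<integral>\<^sup>+x. g x + f x \<partial>N) * F N \<partial>L) = (\<integral>\<^sup>+N. (\<integral>\<^sup>+x. g x \<partial>N) * F N + (\<integral>\<^sup>+x. f x \<partial>N) * F N \<partial>L)"
      by (intro nn_integral_cong, subst nn_integral_add)
        (auto simp: space_L distrib_right cong: measurable_cong_sets)
    with add show ?case by (simp add: nn_integral_add distrib_right)
  next
    case (seq U)
    note seq(1) [measurable]
    have inc: "incseq (\<lambda>i. U i x)" for x using seq(4) by (auto simp: incseq_def le_fun_def)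
    have "(\<integral>\<^sup>+N. (\<integral>\<^sup>+x. (SUP i. U i) x \<partial>N) * F N \<partial>L) = (\<integral>\<^sup>+N. (SUP i. (\<integral>\<^sup>+x. U i x \<partial>N) * F N) \<partial>L)"
      unfolding SUP_apply using seq(4)
      by (intro nn_integral_cong, subst nn_integral_monotone_convergence_SUP)
        (auto simp: space_L SUP_mult_right_ennreal cong: measurable_cong_sets)
    also have "\<dots> = (SUP i. \<integral>\<^sup>+N. (\<integral>\<^sup>+x. U i x \<partial>N) * F N \<partial>L)"
      using seq(4) by (intro nn_integral_monotone_convergence_SUP)
        (auto simp: incseq_def le_fun_def intro!: mult_right_mono nn_integral_mono)
    also have "\<dots> = (SUP i. \<integral>\<^sup>+x. U i x * ?G x \<partial>\<nu>)"
      using seq(3) by simp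
    also have "\<dots> = (\<integral>\<^sup>+x. (SUP i. U i x * ?G x) \<partial>\<nu>)"
      using seq(4) by (intro nn_integral_monotone_convergence_SUP[symmetric])
        (auto simp: incseq_def le_fun_def intro!: mult_right_mono)
    also have "\<dots> = (\<integral>\<^sup>+x. (SUP i. U i) x * ?G x \<partial>\<nu>)"
      unfolding SUP_apply by (simp add: SUP_mult_right_ennreal)
    finally show ?case .
  qed
qed

end

subsection \<open>Moments of the total mass\<close>

text \<open>The contribution of one pattern of coincidences to \<open>E[N(w)^m F(N)]\<close>: the
  indices in \<open>p\<close> stand for different points of the process, and \<open>k i\<close> of
  the \<open>m\<close> factors fall on point \<open>i\<close>. The indices will be the cells of a
  partition, with their sizes as exponents.\<close>

definition palm_integral ::
  "'a measure measure \<Rightarrow> 'a measure \<Rightarrow> ('a \<Rightarrow> ennreal) \<Rightarrow> ('i \<Rightarrow> nat) \<Rightarrow> 'i set \<Rightarrow>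
   ('a measure \<Rightarrow> ennreal) \<Rightarrow> ennreal" where
  "palm_integral L \<nu> w k p F =
    (\<integral>\<^sup>+x. (\<Prod>i\<in>p. w (x i) ^ k i) * (\<integral>\<^sup>+N. F (add_atoms N p x) \<partial>L) \<partial>(\<Pi>\<^sub>M i\<in>p. \<nu>))"

context poisson_laplace
begin

lemma measurable_add_atoms_PiM [measurable]:
  "(\<lambda>(x, N). add_atoms N p x) \<in> measurable ((\<Pi>\<^sub>M i\<in>p. \<nu>) \<Otimes>\<^sub>M L) (measure_algebra \<nu>)"
  unfolding case_prod_unfold by (rule measurable_add_atoms) measurable

lemma measurable_add_atoms_fixed:
  assumes [measurable]: "F \<in> borel_measurable (measure_algebra \<nu>)" and x: "x \<in> space (\<Pi>\<^sub>M i\<in>p. \<nu>)"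
  shows "(\<lambda>N. F (add_atoms N p x)) \<in> borel_measurable (measure_algebra \<nu>)"
proof -
  have "x i \<in> space \<nu>" if "i \<in> p" for i using x that by (auto simp: space_PiM)
  then show ?thesis
    by (intro measurable_compose[OF _ assms(1)] measurable_add_atoms) auto
qed

lemma measurable_integral_add_atoms [measurable]:
  assumes "F \<in> borel_measurable (measure_algebra \<nu>)"
  shows "(\<lambda>x. \<integral>\<^sup>+N. F (add_atoms N p x) \<partial>L) \<in> borel_measurable (\<Pi>\<^sub>M i\<in>p. \<nu>)"
proof -
  have "(\<lambda>z. F (add_atoms (snd z) p (fst z))) \<in> borel_measurable ((\<Pi>\<^sub>M i\<in>p. \<nu>) \<Otimes>\<^sub>M L)"
    using measurable_compose[OF measurable_add_atoms_PiM assms] by (simp add: case_prod_unfold)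
  from borel_measurable_nn_integral_fst[OF this] show ?thesis by simp
qed

context
  fixes w :: "'a \<Rightarrow> ennreal"
  assumes sigma_finite_\<nu>: "sigma_finite_measure \<nu>" and w [measurable]: "w \<in> borel_measurable \<nu>"
begin

text \<open>On the right \<open>i\<close> enters only through the exponent \<open>k i\<close>.
  Integrals whose new indices differ but carry the same exponent therefore agree, which is how a
  cell is renamed later.\<close>

lemma palm_integral_insert:
  assumes "finite p" "i \<notin> p" and [measurable]: "F \<in> borel_measurable (measure_algebra \<nu>)"
  shows "palm_integral L \<nu> w k (insert i p) F =
    (\<integral>\<^sup>+x. (\<integral>\<^sup>+y. w y ^ k i * ((\<Prod>j\<in>p. w (x j) ^ k j) *
      (\<integral>\<^sup>+N. F (add_atoms (add_atoms N {()} (\<lambda>_. y)) p x) \<partial>L)) \<partial>\<nu>) \<partial>(\<Pi>\<^sub>M i\<in>p. \<nu>))"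
proof -
  interpret product_sigma_finite "\<lambda>_. \<nu>"
    using sigma_finite_\<nu> by (simp add: product_sigma_finite_def)
  have "(\<Prod>j\<in>insert i p. w ((x(i := y)) j) ^ k j) * (\<integral>\<^sup>+N. F (add_atoms N (insert i p) (x(i := y))) \<partial>L) =
      w y ^ k i * ((\<Prod>j\<in>p. w (x j) ^ k j) * (\<integral>\<^sup>+N. F (add_atoms (add_atoms N {()} (\<lambda>_. y)) p x) \<partial>L))" for x y
  proof -
    have "(\<Prod>j\<in>p. w ((x(i := y)) j) ^ k j) = (\<Prod>j\<in>p. w (x j) ^ k j)"
      using assms by (intro prod.cong) auto
    then show ?thesis
      using assms by (simp add: add_atoms_add_atom mult.assoc)
  qed
  then show ?thesis
    unfolding palm_integral_def
    by (subst product_nn_integral_insert) (use assms in simp_all)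
qed

text \<open>A further factor \<open>N(w)\<close> adds a new atom, forming the cell \<open>{a}\<close>, or repeats the atom of a
  cell \<open>C\<close>, which becomes \<open>insert a C\<close>.\<close>

lemma palm_integral_mult_mass:
  fixes p :: "'i set set"
  assumes S: "finite S" and p: "partition_on S p" and a: "a \<notin> S"
    and F [measurable]: "F \<in> borel_measurable (measure_algebra \<nu>)"
  shows "palm_integral L \<nu> w card p (\<lambda>N. (\<integral>\<^sup>+x. w x \<partial>N) * F N) =
    palm_integral L \<nu> w card (insert {a} p) F +
    (\<Sum>C\<in>p. palm_integral L \<nu> w card (insert (insert a C) (p - {C})) F)"
proof -
  have fin: "finite p" and cells: "\<And>C. C \<in> p \<Longrightarrow> finite C \<and> a \<notin> C"
    using finite_elements[OF S p] p a S by (auto simp: partition_on_def intro: finite_subset)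
  let ?W = "\<lambda>x. \<Prod>C\<in>p. w (x C) ^ card C"
  let ?B = "\<lambda>x. \<integral>\<^sup>+N. F (add_atoms N p x) \<partial>L"
  let ?A = "\<lambda>x. \<integral>\<^sup>+N. (\<integral>\<^sup>+z. w z \<partial>N) * F (add_atoms N p x) \<partial>L"
  have [measurable]: "?A \<in> borel_measurable (\<Pi>\<^sub>M i\<in>p. \<nu>)"
    using borel_measurable_nn_integral_fst[of "\<lambda>z. (\<integral>\<^sup>+y. w y \<partial>snd z) * F (add_atoms (snd z) p (fst z))" "\<Pi>\<^sub>M i\<in>p. \<nu>"]
      measurable_compose[OF measurable_add_atoms_PiM F]
    by (simp add: case_prod_unfold)
  have split: "(\<integral>\<^sup>+N. (\<integral>\<^sup>+z. w z \<partial>add_atoms N p x) * F (add_atoms N p x) \<partial>L) = ?A x + (\<Sum>C\<in>p. w (x C)) * ?B x"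
    if x: "x \<in> space (\<Pi>\<^sub>M i\<in>p. \<nu>)" for x
  proof -
    note [measurable] = measurable_add_atoms_fixed[OF F x]
    have "x i \<in> space \<nu>" if "i \<in> p" for i using x that by (auto simp: space_PiM)
    then have "(\<integral>\<^sup>+N. (\<integral>\<^sup>+z. w z \<partial>add_atoms N p x) * F (add_atoms N p x) \<partial>L) =
        (\<integral>\<^sup>+N. (\<integral>\<^sup>+z. w z \<partial>N) * F (add_atoms N p x) + (\<Sum>C\<in>p. w (x C)) * F (add_atoms N p x) \<partial>L)"
      by (intro nn_integral_cong, subst nn_integral_add_atoms)
        (auto simp: space_L distrib_right dest: sets_eq_imp_space_eq cong: measurable_cong_sets)
    then show ?thesis by (simp add: nn_integral_add nn_integral_cmult)
  qed
  have "palm_integral L \<nu> w card p (\<lambda>N. (\<integral>\<^sup>+x. w x \<partial>N) * F N) =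
      (\<integral>\<^sup>+x. ?W x * ?A x + (\<Sum>C\<in>p. ?W x * w (x C) * ?B x) \<partial>(\<Pi>\<^sub>M i\<in>p. \<nu>))"
    unfolding palm_integral_def
    by (intro nn_integral_cong)
      (simp add: split distrib_left sum_distrib_left sum_distrib_right mult.assoc)
  also have "\<dots> = (\<integral>\<^sup>+x. ?W x * ?A x \<partial>(\<Pi>\<^sub>M i\<in>p. \<nu>)) +
      (\<Sum>C\<in>p. \<integral>\<^sup>+x. ?W x * w (x C) * ?B x \<partial>(\<Pi>\<^sub>M i\<in>p. \<nu>))"
    by (subst nn_integral_add) (simp_all add: nn_integral_sum)
  also have "(\<integral>\<^sup>+x. ?W x * ?A x \<partial>(\<Pi>\<^sub>M i\<in>p. \<nu>)) = palm_integral L \<nu> w card (insert {a} p) F"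
  proof (subst palm_integral_insert)
    show "{a} \<notin> p" using cells by auto
    show "(\<integral>\<^sup>+x. ?W x * ?A x \<partial>(\<Pi>\<^sub>M i\<in>p. \<nu>)) =
      (\<integral>\<^sup>+x. (\<integral>\<^sup>+y. w y ^ card {a} * (?W x *
        (\<integral>\<^sup>+N. F (add_atoms (add_atoms N {()} (\<lambda>_. y)) p x) \<partial>L)) \<partial>\<nu>) \<partial>(\<Pi>\<^sub>M i\<in>p. \<nu>))"
    proof (intro nn_integral_cong)
      fix x assume x: "x \<in> space (\<Pi>\<^sub>M i\<in>p. \<nu>)"
      note m = measurable_add_atoms_fixed[OF F x]
      have [measurable]: "(\<lambda>y. \<integral>\<^sup>+N. F (add_atoms (add_atoms N {()} (\<lambda>_. y)) p x) \<partial>L) \<in> borel_measurable \<nu>"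
        using borel_measurable_nn_integral_fst[of "\<lambda>z. F (add_atoms (add_atoms (snd z) {()} (\<lambda>_. fst z)) p x)" \<nu>]
          measurable_compose[OF measurable_add_atom_pair m]
        by (simp add: case_prod_unfold)
      show "?W x * ?A x = (\<integral>\<^sup>+y. w y ^ card {a} * (?W x *
          (\<integral>\<^sup>+N. F (add_atoms (add_atoms N {()} (\<lambda>_. y)) p x) \<partial>L)) \<partial>\<nu>)"
        by (subst mecke[OF sigma_finite_\<nu> w m], subst nn_integral_cmult[symmetric])
          (auto intro!: nn_integral_cong simp: mult.left_commute)
    qed
  qed (use fin in simp_all)
  also have "(\<Sum>C\<in>p. \<integral>\<^sup>+x. ?W x * w (x C) * ?B x \<partial>(\<Pi>\<^sub>M i\<in>p. \<nu>)) =
      (\<Sum>C\<in>p. palm_integral L \<nu> w card (insert (insert a C) (p - {C})) F)"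
  proof (intro sum.cong refl)
    fix C assume C: "C \<in> p"
    \<comment> \<open>The extra factor \<open>w (x C)\<close> raises the exponent of
      \<open>C\<close> by one; this new exponent is the size of \<open>insert a C\<close>, so it
      remains to rename the index.\<close>
    let ?k = "card(C := Suc (card C))"
    have p_eq: "insert C (p - {C}) = p" using C by auto
    have "?W x * w (x C) = (\<Prod>B\<in>p. w (x B) ^ ?k B)" for x
      using fin C by (simp add: prod.remove[of p C] ac_simps)
    then have "(\<integral>\<^sup>+x. ?W x * w (x C) * ?B x \<partial>(\<Pi>\<^sub>M i\<in>p. \<nu>)) = palm_integral L \<nu> w ?k (insert C (p - {C})) F"
      unfolding p_eq by (simp add: palm_integral_def)
    also have "\<dots> = palm_integral L \<nu> w card (insert (insert a C) (p - {C})) F"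
    proof -
      have notin: "insert a C \<notin> p - {C}" "C \<notin> p - {C}" using cells by auto
      have "card (insert a C) = ?k C" using cells[OF C] by simp
      moreover have "(\<Prod>j\<in>p - {C}. w (x j) ^ ?k j) = (\<Prod>j\<in>p - {C}. w (x j) ^ card j)" for x
        by (intro prod.cong) auto
      ultimately show ?thesis
        by (simp only: palm_integral_insert[OF finite_Diff[OF fin] notin(1) F]
            palm_integral_insert[OF finite_Diff[OF fin] notin(2) F])
    qed
    finally show "(\<integral>\<^sup>+x. ?W x * w (x C) * ?B x \<partial>(\<Pi>\<^sub>M i\<in>p. \<nu>)) =
      palm_integral L \<nu> w card (insert (insert a C) (p - {C})) F" .
  qed
  finally show ?thesis .
qed

text \<open>The induction runs over arbitrary \<open>F\<close>, since the factor \<open>N(w)\<close>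
  belonging to the new element is first merged into \<open>F\<close>.\<close>

lemma mass_power_eq_sum_palm_integral:
  assumes "finite S" and "F \<in> borel_measurable (measure_algebra \<nu>)"
  shows "(\<integral>\<^sup>+N. (\<integral>\<^sup>+x. w x \<partial>N) ^ card S * F N \<partial>L) =
    (\<Sum>p | partition_on S p. palm_integral L \<nu> w card p F)"
  using assms
proof (induction S arbitrary: F)
  case empty
  have "{p. partition_on {} p} = {{} :: 'b set set}" by (auto simp: partition_on_empty)
  then show ?case
    by (simp add: palm_integral_def PiM_empty nn_integral_count_space_finite add_atoms_empty)
next
  case (insert a S)
  note [measurable] = insert.prems
  have "(\<integral>\<^sup>+N. (\<integral>\<^sup>+x. w x \<partial>N) ^ card (insert a S) * F N \<partial>L) =
      (\<integral>\<^sup>+N. (\<integral>\<^sup>+x. w x \<partial>N) ^ card S * ((\<integral>\<^sup>+x. w x \<partial>N) * F N) \<partial>L)"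
    using insert.hyps by (simp add: ac_simps)
  also have "\<dots> = (\<Sum>p | partition_on S p. palm_integral L \<nu> w card p (\<lambda>N. (\<integral>\<^sup>+x. w x \<partial>N) * F N))"
    by (intro insert.IH) measurable
  also have "\<dots> = (\<Sum>p | partition_on S p. palm_integral L \<nu> w card (insert {a} p) F +
      (\<Sum>C\<in>p. palm_integral L \<nu> w card (insert (insert a C) (p - {C})) F))"
    using insert.hyps insert.prems by (intro sum.cong refl palm_integral_mult_mass) auto
  also have "\<dots> = (\<Sum>p | partition_on (insert a S) p. palm_integral L \<nu> w card p F)"
    using insert.hyps by (intro sum_partitions_insert[symmetric])
  finally show ?case .
qed

end

end

subsection \<open>Exponential tilting\<close>

text \<open>One term of the exponential series of \<open>v * x\<close>.\<close>

lemma power_mult_exp_le: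
  assumes "0 \<le> x" "0 < v"
  shows "x ^ k * exp (- v * x) \<le> fact k / (v ^ k :: real)"
proof -
  have "(v * x) ^ k / fact k \<le> exp (v * x)"
  proof -
    have "(\<Sum>n\<in>{k}. (v * x) ^ n /\<^sub>R fact n) \<le> (\<Sum>n. (v * x) ^ n /\<^sub>R fact n)"
      using assms by (intro sum_le_suminf summable_exp_generic) auto
    then show ?thesis by (simp add: exp_def divide_inverse_commute)
  qed
  then show ?thesis
    using assms by (simp add: exp_minus power_mult_distrib field_simps)
qed

text \<open>From \<open>x \<le> (1 - exp (- x)) * (1 + x)\<close>; the two summands of the constant
  bound the powers \<open>m\<close> and \<open>Suc m\<close> that \<open>x ^ m * (1 + x)\<close>
  produces. It makes the weight moments finite once \<open>1 - exp (- w)\<close> is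
  integrable.\<close>

lemma power_mult_exp_le_one_minus_exp:
  assumes "0 \<le> x" "0 < v"
  shows "x ^ Suc m * exp (- v * x) \<le> (fact m / v ^ m + fact (Suc m) / v ^ Suc m) * (1 - exp (- x) :: real)"
proof -
  have "exp (- x) \<le> 1 / (1 + x)"
    using exp_ge_add_one_self[of x] assms by (simp add: exp_minus field_simps)
  then have *: "x \<le> (1 - exp (- x)) * (1 + x)"
    using assms by (simp add: field_simps)
  have "x ^ Suc m * exp (- v * x) = x ^ m * exp (- v * x) * x" by simp
  also have "\<dots> \<le> x ^ m * exp (- v * x) * ((1 - exp (- x)) * (1 + x))"
    using assms by (intro mult_left_mono *) auto
  also have "\<dots> = (x ^ m * exp (- v * x) + x ^ Suc m * exp (- v * x)) * (1 - exp (- x))"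
    by (simp add: algebra_simps)
  also have "\<dots> \<le> (fact m / v ^ m + fact (Suc m) / v ^ Suc m) * (1 - exp (- x))"
    using assms by (intro mult_right_mono add_mono power_mult_exp_le) auto
  finally show ?thesis .
qed

locale poisson_mass = poisson_laplace L \<nu> for L :: "'a measure measure" and \<nu> :: "'a measure" +
  fixes w :: "'a \<Rightarrow> real"
  assumes w_measurable [measurable]: "w \<in> borel_measurable \<nu>"
    and w_pos: "\<And>x. 0 < w x"
    and AE_mass: "AE N in L. 0 < (\<integral>\<^sup>+x. ennreal (w x) \<partial>N) \<and> (\<integral>\<^sup>+x. ennreal (w x) \<partial>N) < \<infinity>"
begin

abbreviation mass :: "'a measure \<Rightarrow> ennreal" where
  "mass N \<equiv> \<integral>\<^sup>+x. ennreal (w x) \<partial>N"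

definition mass_laplace :: "real \<Rightarrow> ennreal" where
  "mass_laplace v = (\<integral>\<^sup>+N. nexp (ennreal v * mass N) \<partial>L)"

lemma nexp_mass:
  assumes "sets N = sets \<nu>" "0 \<le> v"
  shows "nexp (ennreal v * mass N) = nexp (\<integral>\<^sup>+x. ennreal (v * w x) \<partial>N)"
  using assms
  by (simp add: ennreal_mult' nn_integral_cmult cong: measurable_cong_sets)

lemma mass_laplace_eq:
  assumes "0 \<le> v"
  shows "mass_laplace v = nexp (\<integral>\<^sup>+x. (1 - nexp (ennreal (v * w x))) \<partial>\<nu>)"
proof -
  have "mass_laplace v = laplace_functional L (\<lambda>x. ennreal (v * w x))"
    unfolding mass_laplace_def laplace_functional_def
    using assms by (intro nn_integral_cong) (simp add: space_L nexp_mass)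
  then show ?thesis by (simp add: laplace)
qed

text \<open>Since T < \<infinity> almost surely, \<open>exp (- v * T)\<close> is almost surely
  positive. Through \<open>mass_laplace_eq\<close> this makes the integral in the exponent
  finite.\<close>

lemma mass_laplace_pos: "0 < mass_laplace v"
proof -
  have "mass_laplace v \<noteq> 0"
  proof
    assume "mass_laplace v = 0"
    then have "AE N in L. ennreal v * mass N = \<top>"
      unfolding mass_laplace_def by (subst (asm) nn_integral_0_iff_AE) auto
    with AE_mass have "AE N in L. False"
      by eventually_elim (auto simp: ennreal_mult_eq_top_iff)
    then show False by simp
  qed
  then show ?thesis by (simp add: zero_less_iff_neq_zero)
qed

lemma mass_laplace_le_1: "mass_laplace v \<le> 1"
  using nn_integral_mono[of L "\<lambda>N. nexp (ennreal v * mass N)" "\<lambda>_. 1"]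
  by (simp add: mass_laplace_def nexp_le_1 emeasure_space_1)

lemma mass_laplace_finite: "mass_laplace v \<noteq> \<top>"
  using mass_laplace_le_1[of v] by (auto simp: top_unique)

lemma integral_one_minus_exp_finite:
  assumes "0 \<le> v"
  shows "(\<integral>\<^sup>+x. (1 - nexp (ennreal (v * w x))) \<partial>\<nu>) < \<top>"
  using mass_laplace_pos[of v] mass_laplace_eq[OF assms] by (auto simp: less_top[symmetric])

text \<open>A null intensity gives \<open>E[exp (- T)] = 1\<close>, that is \<open>T = 0\<close>
  almost surely.\<close>

lemma emeasure_space_nonzero: "emeasure \<nu> (space \<nu>) \<noteq> 0"
proof
  assume "emeasure \<nu> (space \<nu>) = 0"
  then have "(\<integral>\<^sup>+x. (1 - nexp (ennreal (1 * w x))) \<partial>\<nu>) = 0"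
    using nn_integral_null_set by (subst nn_integral_0_iff_AE) (auto intro!: AE_I[where N="space \<nu>"])
  then have one: "(\<integral>\<^sup>+N. nexp (mass N) \<partial>L) = 1"
    using mass_laplace_eq[of 1] by (simp add: mass_laplace_def)
  have "(\<integral>\<^sup>+N. (1 - nexp (mass N)) \<partial>L) = (\<integral>\<^sup>+N. 1 \<partial>L) - (\<integral>\<^sup>+N. nexp (mass N) \<partial>L)"
    by (rule nn_integral_diff) (auto simp: one nexp_le_1)
  then have "(\<integral>\<^sup>+N. (1 - nexp (mass N)) \<partial>L) = 0"
    by (simp add: one emeasure_space_1)
  then have "AE N in L. 1 - nexp (mass N) = 0"
    by (subst (asm) nn_integral_0_iff_AE) auto
  with AE_mass have "AE N in L. False"
    by eventually_elim (metis less_irrefl nexp_less_1)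
  then show False by simp
qed

text \<open>\<open>1 - exp (- w)\<close> is strictly positive and has finite integral, so \<nu> has
  a finite-valued density with respect to a finite measure.\<close>

lemma sigma_finite_\<nu>: "sigma_finite_measure \<nu>"
proof -
  define g where "g x = 1 - nexp (ennreal (1 * w x))" for x
  have g [measurable]: "g \<in> borel_measurable \<nu>" unfolding g_def by measurable
  have g_pos: "0 < g x" "g x < \<top>" for x
    using nexp_less_1[of "ennreal (w x)"] w_pos[of x] by (auto simp: g_def less_top[symmetric])
  interpret D: finite_measure "density \<nu> g"
    using integral_one_minus_exp_finite[of 1]
    by (intro finite_measureI) (simp add: emeasure_density g_def less_top cong: nn_integral_cong_simp)
  have "\<nu> = density (density \<nu> g) (\<lambda>x. 1 / g x)"
    using g_pos by (subst density_density_eq)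
      (auto simp: ennreal_times_divide ennreal_divide_self less_imp_neq[symmetric] density_1)
  moreover have "sigma_finite_measure (density (density \<nu> g) (\<lambda>x. 1 / g x))"
    using g_pos by (subst D.sigma_finite_iff_density_finite)
      (auto simp: ennreal_divide_eq_top_iff less_imp_neq[symmetric])
  ultimately show ?thesis by simp
qed

definition weight_moment :: "nat \<Rightarrow> real \<Rightarrow> ennreal" where
  "weight_moment m v = (\<integral>\<^sup>+x. ennreal (w x ^ m * exp (- v * w x)) \<partial>\<nu>)"

text \<open>The exponent \<open>m\<close> will be the size of a cell and thus at least 1. For
  \<open>m = 0\<close> the integrand does not vanish where \<open>w\<close> is small, and infinitely
  many small jumps may make the integral infinite.\<close>

lemma weight_moment_finite:
  assumes "1 \<le> m" "0 < v"
  shows "weight_moment m v < \<top>"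
proof -
  obtain k where m: "m = Suc k" using assms(1) by (cases m) auto
  let ?c = "fact k / v ^ k + fact (Suc k) / v ^ Suc k"
  have "weight_moment m v \<le> (\<integral>\<^sup>+x. ennreal ?c * (1 - nexp (ennreal (1 * w x))) \<partial>\<nu>)"
    unfolding weight_moment_def
  proof (intro nn_integral_mono)
    fix x
    have "ennreal (w x ^ m * exp (- v * w x)) \<le> ennreal (?c * (1 - exp (- w x)))"
      unfolding m using power_mult_exp_le_one_minus_exp[of "w x" v k] w_pos[of x] assms by (intro ennreal_leI) auto
    also have "\<dots> = ennreal ?c * (1 - nexp (ennreal (1 * w x)))"
      using w_pos[of x] assms
      by (simp add: nexp_ennreal ennreal_mult ennreal_minus del: ennreal_plus flip: ennreal_1)
    finally show "ennreal (w x ^ m * exp (- v * w x)) \<le> ennreal ?c * (1 - nexp (ennreal (1 * w x)))" .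
  qed
  also have "\<dots> < \<top>"
    using integral_one_minus_exp_finite[of 1]
    by (simp add: nn_integral_cmult ennreal_mult_less_top)
  finally show ?thesis .
qed

lemma weight_moment_pos: "0 < weight_moment m v"
proof -
  have "weight_moment m v \<noteq> 0"
  proof
    assume "weight_moment m v = 0"
    then have "AE x in \<nu>. ennreal (w x ^ m * exp (- v * w x)) = 0"
      unfolding weight_moment_def by (subst (asm) nn_integral_0_iff_AE) auto
    then have "AE x in \<nu>. False"
    proof eventually_elim
      case (elim x)
      have "0 < w x ^ m * exp (- v * w x)" using w_pos[of x] by simp
      with elim show False by (simp add: ennreal_eq_0_iff)
    qed
    then show False
      using emeasure_space_nonzero by (simp add: AE_iff_measurable[OF _ refl])
  qed
  then show ?thesis by (simp add: zero_less_iff_neq_zero)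
qed

definition tilt :: "real \<Rightarrow> 'a measure measure" where
  "tilt v = density L (\<lambda>N. nexp (ennreal v * mass N) / mass_laplace v)"

text \<open>Multiplying by \<open>exp (- v * T)\<close> adds \<open>v * w\<close> to
  \<open>u\<close>. In the exponent the integrand then splits into \<open>1 - exp (- v * w)\<close>,
  which yields the normalizing constant, and \<open>(1 - exp (- u)) * exp (- v * w)\<close>, the
  Laplace exponent for the tilted intensity. At \<open>u = 0\<close> the same formula gives total
  mass 1.\<close>

lemma poisson_laplace_tilt:
  assumes v: "0 \<le> v"
  shows "poisson_laplace (tilt v) (density \<nu> (\<lambda>x. ennreal (exp (- v * w x))))"
proof -
  let ?e = "\<lambda>x. ennreal (exp (- v * w x))"
  have e: "?e x = nexp (ennreal (v * w x))" for x
    using v w_pos[of x] by (simp add: nexp_ennreal less_imp_le)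
  have lapl: "laplace_functional (tilt v) u = nexp (\<integral>\<^sup>+x. (1 - nexp (u x)) \<partial>density \<nu> ?e)"
    if [measurable]: "u \<in> borel_measurable \<nu>" for u
  proof -
    have "laplace_functional (tilt v) u =
        (\<integral>\<^sup>+N. nexp (\<integral>\<^sup>+x. ennreal (v * w x) + u x \<partial>N) / mass_laplace v \<partial>L)"
      unfolding laplace_functional_def tilt_def
      using v by (subst nn_integral_density)
        (auto intro!: nn_integral_cong simp: space_L nexp_mass nn_integral_add nexp_add ennreal_times_divide mult.commute cong: measurable_cong_sets)
    also have "\<dots> = laplace_functional L (\<lambda>x. ennreal (v * w x) + u x) / mass_laplace v"
      by (simp add: laplace_functional_def divide_ennreal_def nn_integral_multc)
    also have "laplace_functional L (\<lambda>x. ennreal (v * w x) + u x) =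
        nexp (\<integral>\<^sup>+x. (1 - nexp (ennreal (v * w x))) + (1 - nexp (u x)) * ?e x \<partial>\<nu>)"
      using diff_mult_distrib_ennreal_le_1(2)[OF nexp_le_1 nexp_le_1]
      unfolding e by (simp add: laplace nexp_add)
    also have "\<dots> = mass_laplace v * nexp (\<integral>\<^sup>+x. (1 - nexp (u x)) \<partial>density \<nu> ?e)"
      using v by (simp add: nn_integral_add nexp_add mass_laplace_eq nn_integral_density mult.commute)
    also have "\<dots> / mass_laplace v = nexp (\<integral>\<^sup>+x. (1 - nexp (u x)) \<partial>density \<nu> ?e)"
      using mass_laplace_pos[of v] mass_laplace_finite[of v]
      by (simp add: mult.commute[of "mass_laplace v"] mult_divide_eq_ennreal)
    finally show ?thesis .
  qed
  have "prob_space (tilt v)"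
    using lapl[of "\<lambda>_. 0"] by (intro prob_spaceI) (simp add: laplace_functional_def tilt_def)
  then interpret T: prob_space "tilt v" .
  show ?thesis
  proof
    show "sets (tilt v) = sets (measure_algebra (density \<nu> ?e))"
      by (simp add: tilt_def sets_L cong: measure_algebra_cong)
  qed (simp add: lapl)
qed

end

subsection \<open>Normalized measures and jump mixtures\<close>

lemma sets_weighted_measure [simp]: "sets (weighted_measure h N) = sets borel"
  by (simp add: weighted_measure_def)

context
  fixes h :: "'s::polish_space \<Rightarrow> real"
  assumes h [measurable]: "h \<in> borel_measurable borel"
begin

lemma emeasure_weighted_measure:
  fixes N :: "('s \<times> 'y::polish_space) measure"
  assumes [measurable_cong]: "sets N = sets (borel \<Otimes>\<^sub>M borel)" and [measurable]: "B \<in> sets borel"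
  shows "emeasure (weighted_measure h N) B = (\<integral>\<^sup>+z. ennreal (h (fst z)) * indicator B (snd z) \<partial>N)"
proof -
  have snd: "snd \<in> measurable N borel"
    unfolding measurable_cong_sets[OF assms(1) refl] by (rule measurable_snd)
  have h_fst: "(\<lambda>(s, y). ennreal (h s)) \<in> borel_measurable N"
    unfolding measurable_cong_sets[OF assms(1) refl] case_prod_unfold by measurable
  have "emeasure (weighted_measure h N) B = emeasure (density N (\<lambda>(s, y). ennreal (h s))) (snd -` B \<inter> space N)"
    unfolding weighted_measure_def using snd by (subst emeasure_distr) simp_all
  also have "\<dots> = (\<integral>\<^sup>+z. (case z of (s, y) \<Rightarrow> ennreal (h s)) * indicator (snd -` B \<inter> space N) z \<partial>N)"
    by (intro emeasure_density h_fst measurable_sets[OF snd]) simp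
  also have "\<dots> = (\<integral>\<^sup>+z. ennreal (h (fst z)) * indicator B (snd z) \<partial>N)"
    by (intro nn_integral_cong) (auto simp: indicator_def)
  finally show ?thesis .
qed

lemma total_mass_eq:
  fixes N :: "('s \<times> 'y::polish_space) measure"
  assumes "sets N = sets (borel \<Otimes>\<^sub>M borel)"
  shows "total_mass h N = (\<integral>\<^sup>+z. ennreal (h (fst z)) \<partial>N)"
  using emeasure_weighted_measure[OF assms, of UNIV] by (simp add: total_mass_def)

lemma measurable_weighted_measure [measurable]:
  "weighted_measure h \<in> measurable (measure_algebra (borel \<Otimes>\<^sub>M (borel :: 'y::polish_space measure))) (measure_algebra borel)"
proof (rule measurable_measure_algebra)
  fix B :: "'y set" assume [measurable]: "B \<in> sets borel"
  have "(\<lambda>N. \<integral>\<^sup>+z. ennreal (h (fst z)) * indicator B (snd z) \<partial>N)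
      \<in> borel_measurable (measure_algebra (borel \<Otimes>\<^sub>M borel))"
    by measurable
  then show "(\<lambda>N. emeasure (weighted_measure h N) B) \<in> borel_measurable (measure_algebra (borel \<Otimes>\<^sub>M borel))"
    by (rule measurable_cong[THEN iffD1, rotated])
      (simp add: emeasure_weighted_measure space_measure_algebra)
qed simp

end

lemma emeasure_normalized_measure:
  fixes \<mu> :: "'y::polish_space measure"
  assumes "sets \<mu> = sets borel" "A \<in> sets borel"
  shows "emeasure (normalized_measure \<mu>) A =
    (if 0 < emeasure \<mu> UNIV \<and> emeasure \<mu> UNIV < \<infinity> then emeasure \<mu> A / emeasure \<mu> UNIV
     else indicator A undefined)"
  using assms
  by (auto simp: normalized_measure_def ennreal_divide_times divide_ennreal_def mult.commute)

lemma sets_normalized_measure: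
  "sets \<mu> = sets borel \<Longrightarrow> sets (normalized_measure \<mu>) = sets borel"
  by (simp add: normalized_measure_def)

lemma prob_space_normalized_measure:
  fixes \<mu> :: "'y::polish_space measure"
  assumes "sets \<mu> = sets borel"
  shows "prob_space (normalized_measure \<mu>)"
proof (rule prob_spaceI)
  have "space (normalized_measure \<mu>) = UNIV"
    using sets_eq_imp_space_eq[OF sets_normalized_measure[OF assms]] by simp
  then show "emeasure (normalized_measure \<mu>) (space (normalized_measure \<mu>)) = 1"
    using assms by (auto simp: emeasure_normalized_measure ennreal_divide_self)
qed

lemma measurable_prob_algebra_emeasureI:
  assumes "\<And>\<omega>. \<omega> \<in> space M \<Longrightarrow> prob_space (f \<omega>)" "\<And>\<omega>. \<omega> \<in> space M \<Longrightarrow> sets (f \<omega>) = sets K"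
    and "\<And>A. A \<in> sets K \<Longrightarrow> (\<lambda>\<omega>. emeasure (f \<omega>) A) \<in> borel_measurable M"
  shows "f \<in> measurable M (prob_algebra K)"
  using assms by (intro measurable_prob_algebraI measurable_subprob_algebra) (auto intro: prob_space_imp_subprob_space)

lemma measurable_normalized_measure [measurable]:
  "normalized_measure \<in> measurable (measure_algebra (borel :: 'y::polish_space measure)) (prob_algebra borel)"
proof (rule measurable_prob_algebra_emeasureI)
  fix A :: "'y set" assume [measurable]: "A \<in> sets borel"
  have "(\<lambda>\<mu>. if 0 < emeasure \<mu> UNIV \<and> emeasure \<mu> UNIV < \<infinity> then emeasure \<mu> A / emeasure \<mu> UNIV
     else indicator A undefined) \<in> borel_measurable (measure_algebra borel)"
    by measurable
  then show "(\<lambda>\<mu>. emeasure (normalized_measure \<mu>) A) \<in> borel_measurable (measure_algebra borel)"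
    by (rule measurable_cong[THEN iffD1, rotated])
      (simp add: emeasure_normalized_measure space_measure_algebra)
qed (auto simp: space_measure_algebra sets_normalized_measure prob_space_normalized_measure)

text \<open>At infinite total mass the weight is 0, as division by \<infinity> gives 0. The bound
  makes \<open>1 - mixture_weight\<close> a true complement, so that \<open>jump_mixture\<close> is
  a probability measure for every Borel measure \<mu>.\<close>

lemma mixture_weight_le_1: "mixture_weight h p \<mu> x \<le> 1"
proof (cases "emeasure \<mu> UNIV = \<top>")
  case False
  have "a / (a + j) \<le> 1" if "a < \<top>" for a j :: ennreal
    using that by (cases "a + j = 0") (auto intro!: divide_le_posI_ennreal simp: zero_less_iff_neq_zero)
  with False show ?thesis by (simp add: mixture_weight_def less_top)
qed (simp add: mixture_weight_def)

context
  fixes h :: "'s::polish_space \<Rightarrow> real" and p :: "'c set"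
  assumes h [measurable]: "h \<in> borel_measurable borel" and h_pos: "\<And>s. 0 < h s"
    and p: "finite p" "p \<noteq> {}"
begin

lemma jump_mass_pos: "0 < jump_mass h p x"
proof -
  obtain C where "C \<in> p" using p by auto
  then have "ennreal (h (fst (x C))) \<le> jump_mass h p x"
    using p unfolding jump_mass_def by (intro member_le_sum) auto
  moreover have "0 < ennreal (h (fst (x C)))" using h_pos[of "fst (x C)"] by simp
  ultimately show ?thesis by (rule less_le_trans[rotated])
qed

lemma jump_mass_finite: "jump_mass h p x < \<top>"
  using h_pos by (simp add: jump_mass_def sum_ennreal less_imp_le)

lemma sets_jump_mixture [simp]: "sets (jump_mixture h p \<mu> x) = sets borel"
  unfolding jump_mixture_def using sets.sigma_sets_eq[of borel] by simp

lemma emeasure_jump_mixture: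
  fixes \<mu> :: "'y::polish_space measure"
  assumes \<mu>: "sets \<mu> = sets borel" and A: "A \<in> sets borel"
  shows "emeasure (jump_mixture h p \<mu> x) A =
    mixture_weight h p \<mu> x * emeasure (normalized_measure \<mu>) A +
    (1 - mixture_weight h p \<mu> x) *
      ((\<Sum>C\<in>p. ennreal (h (fst (x C))) * emeasure (return borel (snd (x C))) A) / jump_mass h p x)"
proof (rule emeasure_measure_of[OF jump_mixture_def])
  let ?f = "\<lambda>A. mixture_weight h p \<mu> x * emeasure (normalized_measure \<mu>) A +
    (1 - mixture_weight h p \<mu> x) *
      ((\<Sum>C\<in>p. ennreal (h (fst (x C))) * emeasure (return borel (snd (x C))) A) / jump_mass h p x)"
  show "positive (sets (jump_mixture h p \<mu> x)) ?f"
    by (simp add: positive_def)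
  show "countably_additive (sets (jump_mixture h p \<mu> x)) ?f"
  proof (rule countably_additiveI)
    fix A :: "nat \<Rightarrow> 'y set"
    assume "range A \<subseteq> sets (jump_mixture h p \<mu> x)" "disjoint_family A"
    then have A: "range A \<subseteq> sets (borel :: 'y measure)" "disjoint_family A" by simp_all
    have 1: "(\<Sum>k. emeasure (normalized_measure \<mu>) (A k)) = emeasure (normalized_measure \<mu>) (\<Union>k. A k)"
      using A \<mu> by (intro suminf_emeasure) (auto simp: sets_normalized_measure)
    have 2: "(\<Sum>k. emeasure (return borel y) (A k)) = emeasure (return borel y) (\<Union>k. A k)" for y
      using A by (intro suminf_emeasure) auto
    have "(\<Sum>k. ?f (A k)) = mixture_weight h p \<mu> x * (\<Sum>k. emeasure (normalized_measure \<mu>) (A k)) +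
      (1 - mixture_weight h p \<mu> x) *
        ((\<Sum>C\<in>p. ennreal (h (fst (x C))) * (\<Sum>k. emeasure (return borel (snd (x C))) (A k))) / jump_mass h p x)"
      by (simp add: suminf_add[symmetric] ennreal_suminf_cmult suminf_sum divide_ennreal_def ennreal_suminf_multc)
    then show "(\<Sum>k. ?f (A k)) = ?f (\<Union>k. A k)"
      unfolding 1 2 .
  qed
qed (use A in auto)

lemma prob_space_jump_mixture:
  fixes \<mu> :: "'y::polish_space measure"
  assumes \<mu>: "sets \<mu> = sets borel"
  shows "prob_space (jump_mixture h p \<mu> x)"
proof (rule prob_spaceI)
  have space: "space (jump_mixture h p \<mu> x) = UNIV"
    using sets_eq_imp_space_eq[OF sets_jump_mixture] by simp
  have "emeasure (normalized_measure \<mu>) UNIV = 1"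
    using prob_space.emeasure_space_1[OF prob_space_normalized_measure[OF \<mu>]]
      sets_eq_imp_space_eq[OF sets_normalized_measure[OF \<mu>]] by simp
  moreover have "(\<Sum>C\<in>p. ennreal (h (fst (x C))) * emeasure (return borel (snd (x C))) UNIV) / jump_mass h p x = 1"
    using jump_mass_pos[of x] jump_mass_finite[of x]
    by (simp add: jump_mass_def[symmetric] ennreal_divide_self)
  ultimately show "emeasure (jump_mixture h p \<mu> x) (space (jump_mixture h p \<mu> x)) = 1"
    using \<mu> mixture_weight_le_1[of h p \<mu> x]
    by (simp add: space emeasure_jump_mixture add_diff_inverse_ennreal)
qed

lemma measurable_jump_mixture:
  "(\<lambda>(\<mu>, x). jump_mixture h p \<mu> x) \<in>
    measurable (measure_algebra (borel :: 'y::polish_space measure) \<Otimes>\<^sub>M (\<Pi>\<^sub>M C\<in>p. borel \<Otimes>\<^sub>M borel)) (prob_algebra borel)"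
  (is "_ \<in> measurable ?M _")
proof (rule measurable_prob_algebra_emeasureI)
  have sets: "sets (fst \<omega>) = sets borel" if "\<omega> \<in> space ?M" for \<omega>
    using measurable_space[OF measurable_fst that] by (simp add: space_measure_algebra)
  then show "prob_space ((\<lambda>(\<mu>, x). jump_mixture h p \<mu> x) \<omega>)" if "\<omega> \<in> space ?M" for \<omega>
    using that by (simp add: case_prod_unfold prob_space_jump_mixture)
  fix A :: "'y set" assume A [measurable]: "A \<in> sets borel"
  have T [measurable]: "(\<lambda>\<omega>. emeasure (fst \<omega>) UNIV) \<in> borel_measurable ?M"
    by measurable
  have J [measurable]: "(\<lambda>\<omega>. jump_mass h p (snd \<omega>)) \<in> borel_measurable ?M"
    unfolding jump_mass_def by measurable
  have [measurable]: "(\<lambda>\<omega>. emeasure (normalized_measure (fst \<omega>)) A) \<in> borel_measurable ?M"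
    by (rule measurable_emeasure_kernel[OF measurable_prob_algebraD A]) measurable
  have [measurable]: "(\<lambda>\<omega>. \<Sum>C\<in>p. ennreal (h (fst (snd \<omega> C))) * emeasure (return borel (snd (snd \<omega> C))) A) \<in> borel_measurable ?M"
    by simp
  have "(\<lambda>\<omega>. emeasure (jump_mixture h p (fst \<omega>) (snd \<omega>)) A) \<in> borel_measurable ?M \<longleftrightarrow>
    (\<lambda>\<omega>. mixture_weight h p (fst \<omega>) (snd \<omega>) * emeasure (normalized_measure (fst \<omega>)) A +
      (1 - mixture_weight h p (fst \<omega>) (snd \<omega>)) *
      ((\<Sum>C\<in>p. ennreal (h (fst (snd \<omega> C))) * emeasure (return borel (snd (snd \<omega> C))) A) / jump_mass h p (snd \<omega>)))
      \<in> borel_measurable ?M"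
    by (intro measurable_cong emeasure_jump_mixture sets A)
  also have "\<dots>"
    unfolding mixture_weight_def by measurable
  finally show "(\<lambda>\<omega>. emeasure ((\<lambda>(\<mu>, x). jump_mixture h p \<mu> x) \<omega>) A) \<in> borel_measurable ?M"
    by (simp add: case_prod_unfold)
qed (simp add: case_prod_unfold)

text \<open>With mass \<open>t\<close> of \<mu> and mass \<open>j\<close> of the jumps, the weights
  \<open>t / (t + j)\<close> and \<open>j / (t + j)\<close> undo the separate normalizations and
  leave the common one: the value on \<open>A\<close> is \<open>(a + s) / (t + j)\<close>.\<close>

lemma jump_mixture_eq_normalized_measure:
  fixes N :: "('s \<times> 'y::polish_space) measure"
  assumes sets: "sets N = sets (borel \<Otimes>\<^sub>M borel)"
    and T: "0 < (\<integral>\<^sup>+z. ennreal (h (fst z)) \<partial>N)" "(\<integral>\<^sup>+z. ennreal (h (fst z)) \<partial>N) < \<infinity>"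
  shows "jump_mixture h p (weighted_measure h N) x = normalized_measure (weighted_measure h (add_atoms N p x))"
proof (rule measure_eqI)
  fix A :: "'y set" assume "A \<in> sets (jump_mixture h p (weighted_measure h N) x)"
  then have A [measurable]: "A \<in> sets borel" by simp
  let ?\<mu> = "weighted_measure h N" and ?\<mu>' = "weighted_measure h (add_atoms N p x)"
  let ?S = "\<lambda>B. \<Sum>C\<in>p. ennreal (h (fst (x C))) * indicator B (snd (x C))"
  have space: "space N = UNIV" using sets_eq_imp_space_eq[OF sets] by simp
  have add: "emeasure ?\<mu>' B = emeasure ?\<mu> B + ?S B" if [measurable]: "B \<in> sets borel" for B
    using sets by (simp add: emeasure_weighted_measure[OF h] nn_integral_add_atoms space cong: measurable_cong_sets)
  obtain t where t: "emeasure ?\<mu> UNIV = ennreal t" "0 < t"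
    using T by (cases "emeasure ?\<mu> UNIV") (auto simp: emeasure_weighted_measure[OF h sets])
  obtain j where j: "jump_mass h p x = ennreal j" "0 < j"
    using jump_mass_pos[of x] jump_mass_finite[of x] by (cases "jump_mass h p x") auto
  have "?S UNIV = jump_mass h p x" by (simp add: jump_mass_def)
  then have T': "emeasure ?\<mu>' UNIV = ennreal (t + j)"
    using t j by (simp add: add)
  have "emeasure ?\<mu> A \<le> emeasure ?\<mu> UNIV" by (intro emeasure_mono) (auto simp: sets_weighted_measure)
  then obtain a where a: "emeasure ?\<mu> A = ennreal a" "0 \<le> a"
    using t by (cases "emeasure ?\<mu> A") (auto simp: top_unique)
  have "?S A \<le> jump_mass h p x"
    unfolding jump_mass_def by (intro sum_mono) (auto simp: indicator_def)
  then obtain s where s: "?S A = ennreal s" "0 \<le> s"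
    using j by (cases "?S A") (auto simp: top_unique)
  have w: "mixture_weight h p ?\<mu> x = ennreal (t / (t + j))"
    using t j by (simp add: mixture_weight_def divide_ennreal flip: ennreal_plus)
  have w': "1 - mixture_weight h p ?\<mu> x = ennreal (j / (t + j))"
    using t j by (simp add: w ennreal_minus field_simps flip: ennreal_1)
  have "emeasure (jump_mixture h p ?\<mu> x) A = ennreal (t / (t + j)) * (ennreal a / ennreal t) + ennreal (j / (t + j)) * (ennreal s / ennreal j)"
    using t s by (subst emeasure_jump_mixture)
      (auto simp: sets_weighted_measure emeasure_normalized_measure w w'[unfolded w] a j)
  also have "\<dots> = ennreal ((a + s) / (t + j))"
  proof -
    have "t / (t + j) * (a / t) = a / (t + j)" "j / (t + j) * (s / j) = s / (t + j)"
      using t j by simp_all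
    moreover have "ennreal (t / (t + j)) * (ennreal a / ennreal t) = ennreal (t / (t + j) * (a / t))"
        "ennreal (j / (t + j)) * (ennreal s / ennreal j) = ennreal (j / (t + j) * (s / j))"
      using t j a s by (simp_all only: divide_ennreal) (rule ennreal_mult[symmetric]; simp)+
    ultimately show ?thesis
      using t j a s by (simp add: add_divide_distrib)
  qed
  also have "\<dots> = emeasure (normalized_measure ?\<mu>') A"
    using t j a s by (simp add: emeasure_normalized_measure sets_weighted_measure T' add divide_ennreal flip: ennreal_plus)
  finally show "emeasure (jump_mixture h p ?\<mu> x) A = emeasure (normalized_measure ?\<mu>') A" .
qed (simp add: sets_normalized_measure sets_weighted_measure)

end

subsection \<open>The mixing formulas\<close>

lemma ennreal_mult_divide_cancel:
  fixes a b :: ennreal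
  assumes "0 < a" "a \<noteq> \<top>"
  shows "a * (b / a) = b"
proof -
  have "a * (b / a) = b * a / a" by (simp add: ennreal_times_divide mult.commute)
  then show ?thesis using assms by (simp add: mult_divide_eq_ennreal)
qed

text \<open>The Gamma integral after substituting \<open>t * v\<close> for its variable.\<close>

lemma nn_integral_powr_exp:
  assumes "0 < a" "0 < t"
  shows "(\<integral>\<^sup>+v. ennreal (v powr (a - 1) / Gamma a) * ennreal (exp (- v * t)) \<partial>restrict_space lborel {0<..}) =
    ennreal (t powr (- a))"
proof -
  let ?I = "\<integral>\<^sup>+v. ennreal (v powr (a - 1) * exp (- v * t)) * indicator {0<..} v \<partial>lborel"
  have G: "0 < Gamma a" using assms by simp
  have cmult: "(\<integral>\<^sup>+v. c * (ennreal (v powr (a - 1) * exp (- v * t)) * indicator {0<..} v) \<partial>lborel) = c * ?I" for c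
    by (rule nn_integral_cmult) measurable
  have "ennreal (Gamma a) = ennreal t * (\<integral>\<^sup>+v. ennreal (indicator {0..} (t * v) * (t * v) powr (a - 1) / exp (t * v)) \<partial>lborel)"
    unfolding Gamma_conv_nn_integral_real[OF assms(1)]
    using assms(2) nn_integral_real_affine[of "\<lambda>v. ennreal (indicator {0..} v * v powr (a - 1) / exp v)" t 0]
    by simp
  also have "(\<integral>\<^sup>+v. ennreal (indicator {0..} (t * v) * (t * v) powr (a - 1) / exp (t * v)) \<partial>lborel) =
      (\<integral>\<^sup>+v. ennreal (t powr (a - 1)) * (ennreal (v powr (a - 1) * exp (- v * t)) * indicator {0<..} v) \<partial>lborel)"
  proof (intro nn_integral_cong)
    fix v :: real
    \<comment> \<open>The Gamma integral runs over \<open>{0..}\<close> and the claim over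
      \<open>{0<..}\<close>; at \<open>v = 0\<close> both integrands are 0, as
      \<open>0 powr (a - 1) = 0\<close>.\<close>
    consider "v < 0" | "v = 0" | "0 < v" by linarith
    then show "ennreal (indicator {0..} (t * v) * (t * v) powr (a - 1) / exp (t * v)) =
        ennreal (t powr (a - 1)) * (ennreal (v powr (a - 1) * exp (- v * t)) * indicator {0<..} v)"
    proof cases
      case 1
      then have "t * v < 0" using assms by (simp add: mult_pos_neg)
      with 1 show ?thesis by simp
    next
      case 3
      with assms show ?thesis
        by (simp add: powr_mult exp_minus divide_inverse mult.commute[of v] mult.assoc flip: ennreal_mult)
    qed simp
  qed
  also have "ennreal t * \<dots> = ennreal (t powr a) * ?I"
    unfolding cmult using assms by (simp add: powr_diff mult.assoc[symmetric] flip: ennreal_mult)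
  finally have I: "ennreal (Gamma a) = ennreal (t powr a) * ?I" .
  have "(\<integral>\<^sup>+v. ennreal (v powr (a - 1) / Gamma a) * ennreal (exp (- v * t)) \<partial>restrict_space lborel {0<..}) =
      (\<integral>\<^sup>+v. ennreal (1 / Gamma a) * (ennreal (v powr (a - 1) * exp (- v * t)) * indicator {0<..} v) \<partial>lborel)"
    using G by (subst nn_integral_restrict_space)
      (auto intro!: nn_integral_cong simp: indicator_def simp flip: ennreal_mult)
  also have "\<dots> = ennreal (1 / Gamma a) * ?I"
    by (rule cmult)
  also have "\<dots> = ennreal (1 / Gamma a) * (ennreal (t powr (- a)) * ennreal (t powr a)) * ?I"
    using assms by (simp add: powr_minus flip: ennreal_mult)
  also have "\<dots> = ennreal (t powr (- a)) * (ennreal (1 / Gamma a) * ennreal (Gamma a))"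
    by (subst I) (simp add: ac_simps)
  also have "\<dots> = ennreal (t powr (- a))"
    using G by (simp flip: ennreal_mult)
  finally show ?thesis .
qed

lemma PiM_density:
  assumes "sigma_finite_measure \<nu>" "finite I"
    and [measurable]: "\<And>i. i \<in> I \<Longrightarrow> f i \<in> borel_measurable \<nu>"
    and dens: "\<And>i. sigma_finite_measure (density \<nu> (f i))"
  shows "(\<Pi>\<^sub>M i\<in>I. density \<nu> (f i)) = density (\<Pi>\<^sub>M i\<in>I. \<nu>) (\<lambda>x. \<Prod>i\<in>I. f i (x i))"
proof -
  interpret P: product_sigma_finite "\<lambda>_. \<nu>" using assms(1) by (simp add: product_sigma_finite_def)
  interpret D: product_sigma_finite "\<lambda>i. density \<nu> (f i)" using dens by (simp add: product_sigma_finite_def)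
  show ?thesis
  proof (rule D.PiM_eqI[symmetric])
    show "sets (density (\<Pi>\<^sub>M i\<in>I. \<nu>) (\<lambda>x. \<Prod>i\<in>I. f i (x i))) = sets (\<Pi>\<^sub>M i\<in>I. density \<nu> (f i))"
      by (simp cong: sets_PiM_cong)
    fix A assume "\<And>i. i \<in> I \<Longrightarrow> A i \<in> sets (density \<nu> (f i))"
    then have A [measurable]: "A i \<in> sets \<nu>" if "i \<in> I" for i using that by simp
    have PA: "Pi\<^sub>E I A \<in> sets (\<Pi>\<^sub>M i\<in>I. \<nu>)" using assms(2) A by (intro sets_PiM_I_finite) auto
    have "emeasure (density (\<Pi>\<^sub>M i\<in>I. \<nu>) (\<lambda>x. \<Prod>i\<in>I. f i (x i))) (Pi\<^sub>E I A) =
        (\<integral>\<^sup>+x. (\<Prod>i\<in>I. f i (x i)) * indicator (Pi\<^sub>E I A) x \<partial>(\<Pi>\<^sub>M i\<in>I. \<nu>))"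
      by (rule emeasure_density[OF _ PA]) measurable
    also have "\<dots> = (\<integral>\<^sup>+x. (\<Prod>i\<in>I. f i (x i) * indicator (A i) (x i)) \<partial>(\<Pi>\<^sub>M i\<in>I. \<nu>))"
    proof (intro nn_integral_cong)
      fix x assume "x \<in> space (\<Pi>\<^sub>M i\<in>I. \<nu>)"
      then have "indicator (Pi\<^sub>E I A) x = (\<Prod>i\<in>I. indicator (A i) (x i) :: ennreal)"
        using assms(2) by (auto simp: prod_indicator_eq space_PiM PiE_def split: split_indicator)
      then show "(\<Prod>i\<in>I. f i (x i)) * indicator (Pi\<^sub>E I A) x = (\<Prod>i\<in>I. f i (x i) * indicator (A i) (x i))"
        by (simp add: prod.distrib)
    qed
    also have "\<dots> = (\<Prod>i\<in>I. \<integral>\<^sup>+x. f i x * indicator (A i) x \<partial>\<nu>)"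
      using assms(2) by (intro P.product_nn_integral_prod) measurable
    also have "\<dots> = (\<Prod>i\<in>I. emeasure (density \<nu> (f i)) (A i))"
      by (intro prod.cong refl) (simp add: emeasure_density)
    finally show "emeasure (density (\<Pi>\<^sub>M i\<in>I. \<nu>) (\<lambda>x. \<Prod>i\<in>I. f i (x i))) (Pi\<^sub>E I A) =
        (\<Prod>i\<in>I. emeasure (density \<nu> (f i)) (A i))" .
  qed fact
qed

locale poisson_kernel =
  fixes \<eta> :: "'y::polish_space measure" and \<rho> :: "'y \<Rightarrow> 's::polish_space measure"
    and h :: "'s \<Rightarrow> real" and L :: "('s \<times> 'y) measure measure"
  assumes sets_\<eta> [measurable_cong]: "sets \<eta> = sets borel" and kernel: "sigma_finite_kernel \<rho>"
    and h_measurable [measurable]: "h \<in> borel_measurable borel" and h_pos: "\<And>s. 0 < h s"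
    and poisson_mass: "poisson_mass L (intensity \<rho> \<eta>) (\<lambda>z. h (fst z))"
begin

abbreviation \<nu> :: "('s \<times> 'y) measure" where "\<nu> \<equiv> intensity \<rho> \<eta>"

sublocale poisson_mass L \<nu> "\<lambda>z. h (fst z)"
  by (rule poisson_mass)

lemma sets_\<nu> [measurable_cong]: "sets \<nu> = sets (borel \<Otimes>\<^sub>M borel)"
  by (rule sets_intensity)

lemma space_\<nu>: "space \<nu> = UNIV"
  using sets_eq_imp_space_eq[OF sets_\<nu>] by simp

lemma intensity_nonzero: "emeasure \<nu> UNIV \<noteq> 0"
  using emeasure_space_nonzero by (simp add: space_\<nu>)

lemma measure_algebra_\<nu>: "measure_algebra \<nu> = measure_algebra (borel \<Otimes>\<^sub>M borel)"
  by (rule measure_algebra_cong[OF sets_\<nu>])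

lemma intensity_exp_tilt_eq:
  "intensity (exp_tilt v h \<rho>) \<eta> = density \<nu> (\<lambda>z. ennreal (exp (- v * h (fst z))))"
proof -
  have g: "0 < 1 - nexp (ennreal (h s))" "1 - nexp (ennreal (h s)) < \<top>" for s
    using nexp_less_1[of "ennreal (h s)"] h_pos[of s] by (auto simp: less_top[symmetric])
  have "(\<integral>\<^sup>+z. (1 - nexp (ennreal (h (fst z)))) \<partial>\<nu>) < \<top>"
    using integral_one_minus_exp_finite[of 1] by simp
  from intensity_exp_tilt[OF sets_\<eta> kernel intensity_nonzero _ g this h_measurable, of v]
  show ?thesis by (simp add: case_prod_unfold)
qed

lemma poisson_law_exp_tilt:
  assumes "0 \<le> v"
  shows "poisson_law (intensity (exp_tilt v h \<rho>) \<eta>) = tilt v"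
  unfolding intensity_exp_tilt_eq by (rule poisson_laplace.poisson_law_eq[OF poisson_laplace_tilt[OF assms]])

lemma total_mass_eq_mass: "N \<in> space L \<Longrightarrow> total_mass h N = mass N"
  using total_mass_eq[OF h_measurable, of N] by (simp add: space_L sets_\<nu>)

lemma laplace_mass_eq:
  assumes "0 \<le> v"
  shows "laplace_mass h \<rho> \<eta> v = mass_laplace v"
  unfolding laplace_mass_def mass_laplace_def poisson_law_eq
proof (rule nn_integral_cong_AE, use AE_mass AE_space in eventually_elim)
  case (elim N)
  then obtain t where t: "mass N = ennreal t" "0 \<le> t" by (cases "mass N") auto
  then show ?case
    using assms elim by (simp add: total_mass_eq_mass nexp_ennreal flip: ennreal_mult)
qed

lemma kappa_eq: "kappa h \<rho> \<eta> m v = weight_moment m v"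
  unfolding kappa_def weight_moment_def
  by (rule nn_integral_intensity_fst[OF sets_\<eta> kernel intensity_nonzero, symmetric]) measurable

definition norm_measure :: "('s \<times> 'y) measure \<Rightarrow> 'y measure" where
  "norm_measure N = normalized_measure (weighted_measure h N)"

lemma measurable_norm_measure [measurable]: "norm_measure \<in> measurable (measure_algebra \<nu>) (prob_algebra borel)"
  unfolding norm_measure_def[abs_def] measure_algebra_\<nu>
  by (rule measurable_compose[OF measurable_weighted_measure[OF h_measurable] measurable_normalized_measure])

text \<open>\<open>T^-\<theta>\<close> is split as \<open>T^n * T^-(\<theta> + n)\<close>: the Gamma
  integral is then taken at the positive exponent \<open>\<theta> + n\<close>, even if
  \<open>\<theta> \<le> 0\<close>. Tonelli exchanges the integrals. \<open>G\<close> will be the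
  indicator of an event for the normalized measure.\<close>

lemma neg_power_mass_gamma:
  assumes "0 < \<theta> + real n" and [measurable]: "G \<in> borel_measurable (measure_algebra \<nu>)"
  shows "(\<integral>\<^sup>+N. neg_power_mass h \<theta> N * G N \<partial>L) =
    (\<integral>\<^sup>+v. ennreal (v powr (\<theta> + real n - 1) / Gamma (\<theta> + real n)) *
      (\<integral>\<^sup>+N. mass N ^ n * (nexp (ennreal v * mass N) * G N) \<partial>L) \<partial>restrict_space lborel {0<..})"
proof -
  let ?R = "restrict_space lborel {0<..} :: real measure"
  let ?g = "\<lambda>v. ennreal (v powr (\<theta> + real n - 1) / Gamma (\<theta> + real n))"
  interpret R: sigma_finite_measure ?R
    by (rule sigma_finite_measure_restrict_space) (auto intro: sigma_finite_lborel)
  interpret RL: pair_sigma_finite ?R L ..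
  have [measurable]: "?g \<in> borel_measurable ?R" by (intro measurable_restrict_space1) measurable
  have [measurable]: "(\<lambda>v. v) \<in> borel_measurable ?R" by (intro measurable_restrict_space1) measurable
  have "(\<integral>\<^sup>+N. neg_power_mass h \<theta> N * G N \<partial>L) =
      (\<integral>\<^sup>+N. (\<integral>\<^sup>+v. ?g v * (mass N ^ n * (nexp (ennreal v * mass N) * G N)) \<partial>?R) \<partial>L)"
  proof (rule nn_integral_cong_AE, use AE_mass AE_space in eventually_elim)
    case (elim N)
    then obtain t where t: "mass N = ennreal t" "0 < t" by (cases "mass N") auto
    have "(\<integral>\<^sup>+v. ?g v * (mass N ^ n * (nexp (ennreal v * mass N) * G N)) \<partial>?R) =
        (\<integral>\<^sup>+v. (mass N ^ n * G N) * (?g v * ennreal (exp (- v * t))) \<partial>?R)"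
      using t by (intro nn_integral_cong)
        (simp add: space_restrict_space nexp_ennreal ac_simps flip: ennreal_mult)
    also have "\<dots> = (mass N ^ n * G N) * ennreal (t powr - (\<theta> + real n))"
      using nn_integral_powr_exp[OF assms(1) t(2)] by (subst nn_integral_cmult) simp_all
    also have "\<dots> = neg_power_mass h \<theta> N * G N"
      using t elim
      by (simp add: neg_power_mass_def total_mass_eq_mass ennreal_power powr_diff powr_add powr_minus powr_realpow ac_simps flip: ennreal_mult)
    finally show ?case by simp
  qed
  also have "\<dots> = (\<integral>\<^sup>+v. (\<integral>\<^sup>+N. ?g v * (mass N ^ n * (nexp (ennreal v * mass N) * G N)) \<partial>L) \<partial>?R)"
    by (rule RL.Fubini') measurable
  also have "\<dots> = (\<integral>\<^sup>+v. ?g v * (\<integral>\<^sup>+N. mass N ^ n * (nexp (ennreal v * mass N) * G N) \<partial>L) \<partial>?R)"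
    by (intro nn_integral_cong nn_integral_cmult) measurable
  finally show ?thesis .
qed

text \<open>The constant \<open>neg_moment\<close> is kept as a divisor throughout; the mixing
  densities contain the same divisor.\<close>

lemma emeasure_normalized_law_tilted_law:
  assumes A [measurable]: "A \<in> sets (prob_algebra borel)"
  shows "emeasure (normalized_law h (tilted_law h \<rho> \<eta> \<theta>)) A =
    (\<integral>\<^sup>+N. neg_power_mass h \<theta> N * indicator A (norm_measure N) \<partial>L) / neg_moment h \<rho> \<eta> \<theta>"
proof -
  have "(\<lambda>N. ennreal (enn2real (mass N) powr (- \<theta>))) \<in> borel_measurable L"
    by measurable
  then have neg [measurable]: "neg_power_mass h \<theta> \<in> borel_measurable L"
    by (rule measurable_cong[THEN iffD1, rotated]) (simp add: neg_power_mass_def total_mass_eq_mass)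
  have "emeasure (normalized_law h (tilted_law h \<rho> \<eta> \<theta>)) A =
      (\<integral>\<^sup>+P. indicator A P \<partial>distr (density L (\<lambda>N. neg_power_mass h \<theta> N / neg_moment h \<rho> \<eta> \<theta>)) (prob_algebra borel) norm_measure)"
    by (simp add: normalized_law_def tilted_law_def poisson_law_eq norm_measure_def[abs_def])
  also have "\<dots> = (\<integral>\<^sup>+N. neg_power_mass h \<theta> N / neg_moment h \<rho> \<eta> \<theta> * indicator A (norm_measure N) \<partial>L)"
    by (subst nn_integral_distr, measurable, subst nn_integral_density) auto
  also have "\<dots> = (\<integral>\<^sup>+N. neg_power_mass h \<theta> N * indicator A (norm_measure N) \<partial>L) / neg_moment h \<rho> \<eta> \<theta>"
    by (simp add: divide_ennreal_def ac_simps flip: nn_integral_cmult)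
  finally show ?thesis .
qed

lemma emeasure_normalized_law_exp_tilt:
  assumes A [measurable]: "A \<in> sets (prob_algebra borel)" and "0 \<le> v"
  shows "emeasure (normalized_law h (poisson_law (intensity (exp_tilt v h \<rho>) \<eta>))) A =
    (\<integral>\<^sup>+N. nexp (ennreal v * mass N) * indicator A (norm_measure N) \<partial>L) / mass_laplace v"
proof -
  have "emeasure (normalized_law h (poisson_law (intensity (exp_tilt v h \<rho>) \<eta>))) A =
      (\<integral>\<^sup>+P. indicator A P \<partial>distr (tilt v) (prob_algebra borel) norm_measure)"
    using assms by (simp add: normalized_law_def poisson_law_exp_tilt norm_measure_def[abs_def])
  also have "\<dots> = (\<integral>\<^sup>+N. nexp (ennreal v * mass N) / mass_laplace v * indicator A (norm_measure N) \<partial>L)"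
    unfolding tilt_def by (subst nn_integral_distr, measurable, subst nn_integral_density) auto
  also have "\<dots> = (\<integral>\<^sup>+N. nexp (ennreal v * mass N) * indicator A (norm_measure N) \<partial>L) / mass_laplace v"
    by (simp add: divide_ennreal_def ac_simps flip: nn_integral_cmult)
  finally show ?thesis .
qed

lemma measurable_mass_laplace [measurable]: "mass_laplace \<in> borel_measurable borel"
  unfolding mass_laplace_def[abs_def] by measurable

lemma measurable_laplace_mass:
  "laplace_mass h \<rho> \<eta> \<in> borel_measurable (restrict_space lborel {0<..})"
  by (rule measurable_cong[THEN iffD2, of _ _ mass_laplace])
    (auto simp: laplace_mass_eq space_restrict_space intro!: measurable_restrict_space1)

lemma sets_normalized_law [simp]: "sets (normalized_law h K) = sets (prob_algebra borel)"
  by (simp add: normalized_law_def)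

text \<open>Given \<open>v\<close>, an event of P has probability
  \<open>E[exp (- v * T); P \<in> A] / E[exp (- v * T)]\<close>. The denominator cancels against the
  Laplace transform in the mixing density, and what remains is the Gamma formula with
  \<open>n = 0\<close>.\<close>

theorem normalized_law_tilted_law_eq_bind:
  assumes "0 < \<theta>"
  shows "normalized_law h (tilted_law h \<rho> \<eta> \<theta>) =
    bind (mixing_law h \<rho> \<eta> \<theta>) (\<lambda>v. normalized_law h (poisson_law (intensity (exp_tilt v h \<rho>) \<eta>)))"
    (is "?l = bind ?M ?K")
proof (rule measure_eqI)
  let ?R = "restrict_space lborel {0<..} :: real measure"
  have sets_M [measurable_cong]: "sets ?M = sets ?R" by (simp add: mixing_law_def)
  have space_M: "space ?M = {0<..}"
    using sets_eq_imp_space_eq[OF sets_M] by (simp add: space_restrict_space)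
  have K: "?K \<in> measurable ?M (subprob_algebra (prob_algebra borel))"
  proof (rule measurable_subprob_algebra)
    fix v assume "v \<in> space ?M"
    then have v: "0 \<le> v" by (simp add: space_M)
    interpret T: poisson_laplace "tilt v" "density \<nu> (\<lambda>x. ennreal (exp (- v * h (fst x))))"
      by (rule poisson_laplace_tilt[OF v])
    have "norm_measure \<in> measurable (tilt v) (prob_algebra borel)"
      by (simp add: tilt_def)
    then show "subprob_space (?K v)"
      unfolding poisson_law_exp_tilt[OF v] normalized_law_def norm_measure_def[abs_def, symmetric]
      by (intro prob_space_imp_subprob_space T.prob_space_distr)
  next
    fix A :: "'y measure set" assume A [measurable]: "A \<in> sets (prob_algebra borel)"
    have "(\<lambda>v. (\<integral>\<^sup>+N. nexp (ennreal v * mass N) * indicator A (norm_measure N) \<partial>L) / mass_laplace v) \<in> borel_measurable ?R"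
      by (intro measurable_restrict_space1) measurable
    then have "(\<lambda>v. (\<integral>\<^sup>+N. nexp (ennreal v * mass N) * indicator A (norm_measure N) \<partial>L) / mass_laplace v) \<in> borel_measurable ?M"
      by measurable
    then show "(\<lambda>v. emeasure (?K v) A) \<in> borel_measurable ?M"
      by (rule measurable_cong[THEN iffD1, rotated])
        (simp add: space_M emeasure_normalized_law_exp_tilt[OF A])
  qed simp
  have ne: "space ?M \<noteq> {}" by (simp add: space_M)
  show "sets ?l = sets (bind ?M ?K)"
    using ne by (subst sets_bind[where N="prob_algebra borel"]) auto
  fix A assume "A \<in> sets ?l"
  then have A [measurable]: "A \<in> sets (prob_algebra borel)" by simp
  let ?g = "\<lambda>v. ennreal (v powr (\<theta> - 1) / Gamma \<theta>)"
  let ?I = "\<lambda>v. \<integral>\<^sup>+N. nexp (ennreal v * mass N) * indicator A (norm_measure N) \<partial>L"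
  note lm = measurable_laplace_mass
  have g [measurable]: "?g \<in> borel_measurable ?R" by (intro measurable_restrict_space1) measurable
  have I [measurable]: "?I \<in> borel_measurable ?R" by (intro measurable_restrict_space1) measurable
  have "emeasure (bind ?M ?K) A = (\<integral>\<^sup>+v. emeasure (?K v) A \<partial>?M)"
    by (rule emeasure_bind[OF ne K A])
  also have "\<dots> = (\<integral>\<^sup>+v. ?I v / mass_laplace v \<partial>?M)"
    by (intro nn_integral_cong) (simp add: space_M emeasure_normalized_law_exp_tilt[OF A])
  also have "\<dots> = (\<integral>\<^sup>+v. ?g v * laplace_mass h \<rho> \<eta> v / neg_moment h \<rho> \<eta> \<theta> * (?I v / mass_laplace v) \<partial>?R)"
    unfolding mixing_law_def using lm g I measurable_restrict_space1[OF measurable_mass_laplace]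
    by (intro nn_integral_density borel_measurable_divide_ennreal borel_measurable_times_ennreal) auto
  also have "\<dots> = (\<integral>\<^sup>+v. ?g v * ?I v / neg_moment h \<rho> \<eta> \<theta> \<partial>?R)"
  proof (intro nn_integral_cong)
    fix v assume "v \<in> space ?R"
    then have v: "0 \<le> v" by (simp add: space_restrict_space)
    have "mass_laplace v * (i / mass_laplace v) = i" for i
      by (rule ennreal_mult_divide_cancel[OF mass_laplace_pos mass_laplace_finite])
    then show "?g v * laplace_mass h \<rho> \<eta> v / neg_moment h \<rho> \<eta> \<theta> * (?I v / mass_laplace v) = ?g v * ?I v / neg_moment h \<rho> \<eta> \<theta>"
      by (simp add: laplace_mass_eq[OF v] divide_ennreal_def[of _ "neg_moment h \<rho> \<eta> \<theta>"] ac_simps)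
         (simp add: mult.left_commute[of "mass_laplace v"])
  qed
  also have "\<dots> = (\<integral>\<^sup>+v. ?g v * ?I v \<partial>?R) / neg_moment h \<rho> \<eta> \<theta>"
    unfolding divide_ennreal_def by (rule nn_integral_multc) measurable
  also have "\<dots> = emeasure ?l A"
    using neg_power_mass_gamma[of \<theta> 0 "\<lambda>N. indicator A (norm_measure N)"] assms
    by (simp add: emeasure_normalized_law_tilted_law)
  finally show "emeasure ?l A = emeasure (bind ?M ?K) A" by simp
qed

end

section \<open>Mixtures over partitions with added jumps\<close>

context poisson_kernel
begin

lemma jump_law_eq:
  "jump_law h \<rho> \<eta> m v = density \<nu> (\<lambda>z. ennreal (h (fst z) ^ m * exp (- v * h (fst z))) / weight_moment m v)"
  by (simp add: jump_law_def kappa_eq case_prod_unfold)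

lemma prob_space_jump_law:
  assumes "1 \<le> m" "0 < v"
  shows "prob_space (jump_law h \<rho> \<eta> m v)"
proof (rule prob_spaceI)
  have "emeasure (jump_law h \<rho> \<eta> m v) (space (jump_law h \<rho> \<eta> m v)) =
      (\<integral>\<^sup>+z. ennreal (h (fst z) ^ m * exp (- v * h (fst z))) / weight_moment m v \<partial>\<nu>)"
    by (simp add: jump_law_eq emeasure_density cong: nn_integral_cong_simp)
  also have "\<dots> = weight_moment m v / weight_moment m v"
    unfolding divide_ennreal_def by (subst nn_integral_multc) (simp_all add: weight_moment_def)
  also have "\<dots> = 1"
    using weight_moment_pos[of m v] weight_moment_finite[OF assms] by (intro ennreal_divide_self) auto
  finally show "emeasure (jump_law h \<rho> \<eta> m v) (space (jump_law h \<rho> \<eta> m v)) = 1" .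
qed

lemma weighted_law_exp_tilt:
  assumes "0 \<le> v"
  shows "weighted_law h (exp_tilt v h \<rho>) \<eta> = distr (tilt v) (measure_algebra borel) (weighted_measure h)"
  by (simp add: weighted_law_def poisson_law_exp_tilt[OF assms])

lemma sets_tilt [measurable_cong]: "sets (tilt v) = sets (measure_algebra \<nu>)"
  by (simp add: tilt_def sets_L)

lemma measurable_weighted_measure_\<nu> [measurable]:
  "weighted_measure h \<in> measurable (measure_algebra \<nu>) (measure_algebra borel)"
  unfolding measure_algebra_\<nu> by (rule measurable_weighted_measure[OF h_measurable])

text \<open>For a partition \<open>p\<close> of \<open>{1..n}\<close>, its contribution to
  \<open>E[T^n exp (- v * T); P \<in> A]\<close>, not yet normalized.\<close>

definition palm_event :: "'y measure set \<Rightarrow> nat set set \<Rightarrow> real \<Rightarrow> ennreal" where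
  "palm_event A p v =
    palm_integral L \<nu> (\<lambda>z. ennreal (h (fst z))) card p (\<lambda>N. nexp (ennreal v * mass N) * indicator A (norm_measure N))"

context
  fixes p :: "nat set set" and v :: real
  assumes v: "0 < v" and p: "finite p" "p \<noteq> {}" "\<And>C. C \<in> p \<Longrightarrow> 1 \<le> card C"
begin

lemma jump_product:
  "(\<Pi>\<^sub>M C\<in>p. jump_law h \<rho> \<eta> (card C) v) =
    density (\<Pi>\<^sub>M C\<in>p. \<nu>)
      (\<lambda>x. \<Prod>C\<in>p. ennreal (h (fst (x C)) ^ card C * exp (- v * h (fst (x C)))) / weight_moment (card C) v)"
proof -
  let ?f = "\<lambda>C z. ennreal (h (fst z) ^ card C * exp (- v * h (fst z))) / weight_moment (card C) v"
  \<comment> \<open>The product lemma asks for \<sigma>-finite densities at every index, so outside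
    \<open>p\<close> the density is set to 1.\<close>
  let ?f' = "\<lambda>C. if C \<in> p then ?f C else (\<lambda>_. 1)"
  have "sigma_finite_measure (density \<nu> (?f' C))" for C
    using prob_space_jump_law[OF p(3) v, of C] sigma_finite_\<nu>
    by (auto simp: jump_law_eq density_1 intro: prob_space_imp_sigma_finite)
  from PiM_density[OF sigma_finite_\<nu> p(1) _ this]
  have "(\<Pi>\<^sub>M C\<in>p. density \<nu> (?f' C)) = density (\<Pi>\<^sub>M C\<in>p. \<nu>) (\<lambda>x. \<Prod>C\<in>p. ?f' C (x C))"
    by simp
  moreover have "(\<Pi>\<^sub>M C\<in>p. density \<nu> (?f' C)) = (\<Pi>\<^sub>M C\<in>p. jump_law h \<rho> \<eta> (card C) v)"
    by (intro PiM_cong refl) (simp add: jump_law_eq)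
  ultimately show ?thesis by (simp cong: prod.cong)
qed

lemma prob_space_jump_product: "prob_space (\<Pi>\<^sub>M C\<in>p. jump_law h \<rho> \<eta> (card C) v)"
  by (intro prob_space_PiM prob_space_jump_law v p)

lemma prob_space_weighted_law: "prob_space (weighted_law h (exp_tilt v h \<rho>) \<eta>)"
proof -
  have m: "weighted_measure h \<in> measurable (tilt v) (measure_algebra borel)"
    by measurable
  interpret T: poisson_laplace "tilt v" "density \<nu> (\<lambda>x. ennreal (exp (- v * h (fst x))))"
    using v by (intro poisson_laplace_tilt) simp
  show ?thesis
    using v unfolding weighted_law_exp_tilt[OF less_imp_le[OF v]] by (intro T.prob_space_distr m)
qed

lemma measurable_jump_mixture_law:
  "(\<lambda>(\<mu>, x). jump_mixture h p \<mu> x) \<in>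
    measurable (weighted_law h (exp_tilt v h \<rho>) \<eta> \<Otimes>\<^sub>M (\<Pi>\<^sub>M C\<in>p. jump_law h \<rho> \<eta> (card C) v)) (prob_algebra borel)"
proof -
  have "sets (weighted_law h (exp_tilt v h \<rho>) \<eta> \<Otimes>\<^sub>M (\<Pi>\<^sub>M C\<in>p. jump_law h \<rho> \<eta> (card C) v)) =
      sets (measure_algebra borel \<Otimes>\<^sub>M (\<Pi>\<^sub>M C\<in>p. borel \<Otimes>\<^sub>M borel))"
    by (intro sets_pair_measure_cong sets_PiM_cong refl) (simp_all add: weighted_law_def jump_law_def sets_\<nu>)
  then show ?thesis
    using measurable_jump_mixture[OF h_measurable h_pos p(1,2)] by (simp cong: measurable_cong_sets)
qed

lemma prob_space_jump_mixture_law: "prob_space (jump_mixture_law h \<rho> \<eta> v p)"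
proof -
  interpret W: prob_space "weighted_law h (exp_tilt v h \<rho>) \<eta>" by (rule prob_space_weighted_law)
  interpret J: prob_space "\<Pi>\<^sub>M C\<in>p. jump_law h \<rho> \<eta> (card C) v" by (rule prob_space_jump_product)
  interpret P: pair_prob_space "weighted_law h (exp_tilt v h \<rho>) \<eta>" "\<Pi>\<^sub>M C\<in>p. jump_law h \<rho> \<eta> (card C) v" ..
  show ?thesis
    unfolding jump_mixture_law_def by (intro P.prob_space_distr measurable_jump_mixture_law)
qed

text \<open>The weight moments and \<open>mass_laplace\<close> cancel the normalizations of the jump
  laws and of the tilted law. The factors \<open>exp (- v * h)\<close> left from the jumps combine
  with \<open>exp (- v * T)\<close> to the same exponential of the total mass after the atoms are
  added, and the mixture is the normalization of that enlarged measure; this is the integrand of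
  \<open>palm_event\<close>.\<close>

lemma emeasure_jump_mixture_law:
  assumes A [measurable]: "A \<in> sets (prob_algebra borel)"
  shows "(\<Prod>C\<in>p. weight_moment (card C) v) * mass_laplace v * emeasure (jump_mixture_law h \<rho> \<eta> v p) A = palm_event A p v"
proof -
  let ?W = "weighted_law h (exp_tilt v h \<rho>) \<eta>" and ?J = "\<Pi>\<^sub>M C\<in>p. jump_law h \<rho> \<eta> (card C) v"
  let ?f = "\<lambda>x. \<Prod>C\<in>p. ennreal (h (fst (x C)) ^ card C * exp (- v * h (fst (x C)))) / weight_moment (card C) v"
  let ?w = "\<lambda>x. \<Prod>C\<in>p. ennreal (h (fst (x C))) ^ card C"
  let ?I = "\<lambda>x. \<integral>\<^sup>+N. nexp (ennreal v * mass N) * indicator A (norm_measure (add_atoms N p x)) \<partial>L"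
  interpret W: prob_space ?W by (rule prob_space_weighted_law)
  interpret J: prob_space ?J by (rule prob_space_jump_product)
  interpret P: pair_sigma_finite ?W ?J ..
  note jm [measurable] = measurable_jump_mixture_law
  have I [measurable]: "?I \<in> borel_measurable (\<Pi>\<^sub>M C\<in>p. \<nu>)"
  proof -
    have "(\<lambda>z. norm_measure (add_atoms (snd z) p (fst z))) \<in> measurable ((\<Pi>\<^sub>M C\<in>p. \<nu>) \<Otimes>\<^sub>M L) (prob_algebra borel)"
      using measurable_compose[OF measurable_add_atoms_PiM measurable_norm_measure, of p] by (simp add: case_prod_unfold)
    then have "(\<lambda>z. nexp (ennreal v * mass (snd z)) * indicator A (norm_measure (add_atoms (snd z) p (fst z)))) \<in>
        borel_measurable ((\<Pi>\<^sub>M C\<in>p. \<nu>) \<Otimes>\<^sub>M L)"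
      by measurable
    from borel_measurable_nn_integral_fst[OF this] show ?thesis by simp
  qed
  have f [measurable]: "?f \<in> borel_measurable (\<Pi>\<^sub>M C\<in>p. \<nu>)" by measurable
  have ind: "(\<lambda>N. indicator A (norm_measure (add_atoms N p x)) :: ennreal) \<in> borel_measurable L"
    if "x \<in> space (\<Pi>\<^sub>M C\<in>p. \<nu>)" for x
    unfolding measurable_cong_sets[OF sets_L refl]
    by (rule measurable_add_atoms_fixed[OF _ that]) measurable
  have inner: "(\<integral>\<^sup>+\<mu>. indicator A (jump_mixture h p \<mu> x) \<partial>?W) = ?I x / mass_laplace v"
    if x: "x \<in> space (\<Pi>\<^sub>M C\<in>p. \<nu>)" for x
  proof -
    note [measurable] = ind[OF x]
    have [measurable]: "(\<lambda>\<mu>. jump_mixture h p \<mu> x) \<in> measurable (measure_algebra borel) (prob_algebra borel)"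
      using measurable_compose[OF measurable_Pair2' measurable_jump_mixture[OF h_measurable h_pos p(1,2)], of x]
      using x by (simp add: space_PiM space_\<nu>)
    have "(\<integral>\<^sup>+\<mu>. indicator A (jump_mixture h p \<mu> x) \<partial>?W) =
        (\<integral>\<^sup>+N. indicator A (jump_mixture h p (weighted_measure h N) x) \<partial>tilt v)"
      unfolding weighted_law_exp_tilt[OF less_imp_le[OF v]] by (rule nn_integral_distr) measurable
    also have "\<dots> = (\<integral>\<^sup>+N. nexp (ennreal v * mass N) / mass_laplace v * indicator A (jump_mixture h p (weighted_measure h N) x) \<partial>L)"
      unfolding tilt_def by (rule nn_integral_density) measurable
    \<comment> \<open>The mixture is identified with the normalized enlarged measure where 0 < T <
      \<infinity>, hence almost everywhere.\<close>
    also have "\<dots> = (\<integral>\<^sup>+N. (nexp (ennreal v * mass N) * indicator A (norm_measure (add_atoms N p x))) / mass_laplace v \<partial>L)"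
    proof (rule nn_integral_cong_AE, use AE_mass AE_space in eventually_elim)
      case (elim N)
      then have "jump_mixture h p (weighted_measure h N) x = norm_measure (add_atoms N p x)"
        unfolding norm_measure_def
        by (intro jump_mixture_eq_normalized_measure h_measurable h_pos p) (auto simp: space_L sets_\<nu>)
      then show ?case by (simp add: divide_ennreal_def ac_simps)
    qed
    also have "\<dots> = ?I x / mass_laplace v"
      unfolding divide_ennreal_def by (rule nn_integral_multc) measurable
    finally show ?thesis .
  qed
  have "emeasure (jump_mixture_law h \<rho> \<eta> v p) A = (\<integral>\<^sup>+P. indicator A P \<partial>jump_mixture_law h \<rho> \<eta> v p)"
    by (simp add: jump_mixture_law_def)
  also have "\<dots> = (\<integral>\<^sup>+z. indicator A (case z of (\<mu>, x) \<Rightarrow> jump_mixture h p \<mu> x) \<partial>(?W \<Otimes>\<^sub>M ?J))"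
    unfolding jump_mixture_law_def by (rule nn_integral_distr) measurable
  also have "\<dots> = (\<integral>\<^sup>+x. (\<integral>\<^sup>+\<mu>. indicator A (jump_mixture h p \<mu> x) \<partial>?W) \<partial>?J)"
    by (subst P.nn_integral_snd[symmetric]) (simp_all add: measurable_compose[OF jm])
  also have "\<dots> = (\<integral>\<^sup>+x. ?I x / mass_laplace v \<partial>?J)"
    by (intro nn_integral_cong inner) (simp add: space_PiM jump_law_eq)
  also have "\<dots> = (\<integral>\<^sup>+x. ?f x * (?I x / mass_laplace v) \<partial>(\<Pi>\<^sub>M C\<in>p. \<nu>))"
    unfolding jump_product by (rule nn_integral_density) measurable
  finally have em: "emeasure (jump_mixture_law h \<rho> \<eta> v p) A = (\<integral>\<^sup>+x. ?f x * (?I x / mass_laplace v) \<partial>(\<Pi>\<^sub>M C\<in>p. \<nu>))" .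
  have "(\<Prod>C\<in>p. weight_moment (card C) v) * mass_laplace v * emeasure (jump_mixture_law h \<rho> \<eta> v p) A =
      (\<integral>\<^sup>+x. (\<Prod>C\<in>p. weight_moment (card C) v) * mass_laplace v * (?f x * (?I x / mass_laplace v)) \<partial>(\<Pi>\<^sub>M C\<in>p. \<nu>))"
    unfolding em by (rule nn_integral_cmult[symmetric]) measurable
  also have "\<dots> = palm_event A p v"
    unfolding palm_event_def palm_integral_def
  proof (intro nn_integral_cong)
    fix x assume x: "x \<in> space (\<Pi>\<^sub>M C\<in>p. \<nu>)"
    note [measurable] = ind[OF x]
    have nexp_eq: "nexp (ennreal (v * h s)) = ennreal (exp (- v * h s))" for s
      using v h_pos[of s] by (simp add: nexp_ennreal)
    let ?e = "\<Prod>C\<in>p. nexp (ennreal (v * h (fst (x C))))"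
    have "(\<Prod>C\<in>p. weight_moment (card C) v) * ?f x = (\<Prod>C\<in>p. ennreal (h (fst (x C)) ^ card C * exp (- v * h (fst (x C)))))"
      unfolding prod.distrib[symmetric]
      using less_imp_neq[OF weight_moment_finite[OF p(3) v]]
      by (intro prod.cong refl ennreal_mult_divide_cancel weight_moment_pos) auto
    also have "\<dots> = ?w x * ?e"
      unfolding prod.distrib[symmetric]
      unfolding nexp_eq using h_pos by (intro prod.cong refl) (simp add: less_imp_le ennreal_mult ennreal_power)
    finally have *: "(\<Prod>C\<in>p. weight_moment (card C) v) * ?f x = ?w x * ?e" .
    have "(\<Prod>C\<in>p. weight_moment (card C) v) * mass_laplace v * (?f x * (?I x / mass_laplace v)) =
        ((\<Prod>C\<in>p. weight_moment (card C) v) * ?f x) * (mass_laplace v * (?I x / mass_laplace v))"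
      by (simp only: ac_simps)
    also have "\<dots> = ?w x * (?e * ?I x)"
      unfolding * ennreal_mult_divide_cancel[OF mass_laplace_pos mass_laplace_finite] by (simp only: ac_simps)
    also have "?e * ?I x = (\<integral>\<^sup>+N. ?e * (nexp (ennreal v * mass N) * indicator A (norm_measure (add_atoms N p x))) \<partial>L)"
      by (rule nn_integral_cmult[symmetric]) measurable
    also have "\<dots> = (\<integral>\<^sup>+N. nexp (ennreal v * mass (add_atoms N p x)) * indicator A (norm_measure (add_atoms N p x)) \<partial>L)"
    proof (intro nn_integral_cong)
      fix N assume "N \<in> space L"
      then have N: "sets N = sets \<nu>" by (simp add: space_L)
      have "mass (add_atoms N p x) = mass N + (\<Sum>C\<in>p. ennreal (h (fst (x C))))"
        using sets_eq_imp_space_eq[OF N]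
        by (intro nn_integral_add_atoms) (auto simp: space_\<nu> N cong: measurable_cong_sets)
      then have "nexp (ennreal v * mass (add_atoms N p x)) = nexp (ennreal v * mass N) * ?e"
        using v h_pos by (simp add: distrib_left nexp_add sum_distrib_left nexp_sum ennreal_mult less_imp_le del: sum_ennreal)
      then show "?e * (nexp (ennreal v * mass N) * indicator A (norm_measure (add_atoms N p x))) =
          nexp (ennreal v * mass (add_atoms N p x)) * indicator A (norm_measure (add_atoms N p x))"
        by (simp add: ac_simps)
    qed
    finally show "(\<Prod>C\<in>p. weight_moment (card C) v) * mass_laplace v * (?f x * (?I x / mass_laplace v)) =
      ?w x * (\<integral>\<^sup>+N. nexp (ennreal v * mass (add_atoms N p x)) * indicator A (norm_measure (add_atoms N p x)) \<partial>L)" .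
  qed
  finally show ?thesis .
qed

end

end

lemma measurable_pair_count_space_finite:
  assumes "finite A" and "\<And>a. a \<in> A \<Longrightarrow> (\<lambda>x. f (x, a)) \<in> measurable M K"
  shows "f \<in> measurable (M \<Otimes>\<^sub>M count_space A) K"
proof -
  have "(\<lambda>z. f (fst z, snd z)) \<in> measurable (M \<Otimes>\<^sub>M count_space A) K"
    by (rule measurable_compose_countable'[where I=A and f="\<lambda>a z. f (fst z, a)" and g=snd])
      (auto intro: countable_finite assms measurable_compose[OF measurable_fst assms(2)])
  then show ?thesis by simp
qed

context poisson_kernel
begin

lemma measurable_weight_moment [measurable]: "weight_moment m \<in> borel_measurable borel"
proof -
  interpret sigma_finite_measure \<nu> by (rule sigma_finite_\<nu>)
  show ?thesis unfolding weight_moment_def[abs_def] by measurable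
qed

lemma measurable_palm_event:
  assumes [measurable]: "A \<in> sets (prob_algebra borel)" and "finite p"
  shows "palm_event A p \<in> borel_measurable borel"
proof -
  interpret \<nu>: product_sigma_finite "\<lambda>_. \<nu>"
    using sigma_finite_\<nu> by (simp add: product_sigma_finite_def)
  interpret P: finite_product_sigma_finite "\<lambda>_. \<nu>" p
    by standard (rule assms)
  have P: "sigma_finite_measure (\<Pi>\<^sub>M C\<in>p. \<nu>)" by (rule P.sigma_finite_measure_axioms)
  let ?F = "\<lambda>v N. nexp (ennreal v * mass N) * indicator A (norm_measure N)"
  have "(\<lambda>(v, N). ?F v N) \<in> borel_measurable (borel \<Otimes>\<^sub>M measure_algebra \<nu>)"
    by measurable
  moreover have "(\<lambda>z. (fst (fst z), add_atoms (snd z) p (snd (fst z)))) \<in>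
      measurable ((borel \<Otimes>\<^sub>M (\<Pi>\<^sub>M C\<in>p. \<nu>)) \<Otimes>\<^sub>M L) (borel \<Otimes>\<^sub>M measure_algebra \<nu>)"
    by (intro measurable_Pair measurable_add_atoms) measurable
  ultimately have "(\<lambda>z. ?F (fst (fst z)) (add_atoms (snd z) p (snd (fst z)))) \<in> borel_measurable ((borel \<Otimes>\<^sub>M (\<Pi>\<^sub>M C\<in>p. \<nu>)) \<Otimes>\<^sub>M L)"
    using measurable_compose by fastforce
  from borel_measurable_nn_integral_fst[OF this]
  have [measurable]: "(\<lambda>z. \<integral>\<^sup>+N. ?F (fst z) (add_atoms N p (snd z)) \<partial>L) \<in> borel_measurable (borel \<Otimes>\<^sub>M (\<Pi>\<^sub>M C\<in>p. \<nu>))"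
    by simp
  have "(\<lambda>z. (\<Prod>C\<in>p. ennreal (h (fst (snd z C))) ^ card C) * (\<integral>\<^sup>+N. ?F (fst z) (add_atoms N p (snd z)) \<partial>L))
      \<in> borel_measurable (borel \<Otimes>\<^sub>M (\<Pi>\<^sub>M C\<in>p. \<nu>))"
    by measurable
  from sigma_finite_measure.borel_measurable_nn_integral_fst[OF P this]
  show ?thesis
    unfolding palm_event_def[abs_def] palm_integral_def by simp
qed

text \<open>For fixed \<open>v\<close> the mixing density cancels the normalization of the component
  laws, so each partition contributes its \<open>palm_event\<close>. By the expansion of the power
  of the mass these add up to \<open>E[T^n exp (- v * T); P \<in> A]\<close>, and the Gamma formula
  integrates out \<open>v\<close>.\<close>

theorem normalized_law_tilted_law_eq_bind_partition:
  assumes n: "1 \<le> n" and \<theta>: "0 < \<theta> + real n"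
  shows "normalized_law h (tilted_law h \<rho> \<eta> \<theta>) =
    bind (partition_mixing_law h \<rho> \<eta> n \<theta>) (\<lambda>(v, p). jump_mixture_law h \<rho> \<eta> v p)"
    (is "?l = bind ?M ?K")
proof (rule measure_eqI)
  let ?R = "restrict_space lborel {0<..} :: real measure"
  define P where "P = {p. partition_on {1..n} p}"
  have fin_P: "finite P" unfolding P_def by (rule finitely_many_partition_on) simp
  \<comment> \<open>As \<open>n \<ge> 1\<close>, every partition has a cell, so the sum of the jumps
    is positive; cells are nonempty, so their weight moments are finite.\<close>
  have p: "finite p" "p \<noteq> {}" "\<And>C. C \<in> p \<Longrightarrow> 1 \<le> card C" if "p \<in> P" for p
  proof -
    have part: "partition_on {1..n} p" using that by (simp only: P_def mem_Collect_eq)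
    show "finite p" using part by (rule finite_elements[rotated]) simp
    show "p \<noteq> {}" using part n by (auto simp: partition_on_def)
    fix C assume "C \<in> p"
    then have "C \<subseteq> {1..n}" "C \<noteq> {}" using part by (auto simp: partition_on_def)
    then have "finite C" "C \<noteq> {}" by (auto intro: finite_subset)
    then show "1 \<le> card C" by (simp add: Suc_leI card_gt_0_iff)
  qed
  have sets_M [measurable_cong]: "sets ?M = sets (?R \<Otimes>\<^sub>M count_space P)"
    by (simp only: partition_mixing_law_def sets_density P_def)
  have space_M: "space ?M = {0<..} \<times> P"
    using sets_eq_imp_space_eq[OF sets_M] by (simp add: space_restrict_space space_pair_measure)
  \<comment> \<open>A closed formula for the component probabilities. Their measurability in
    \<open>v\<close> is visible here, whereas \<open>jump_mixture_law\<close> depends on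
    \<open>v\<close> through the product measure itself.\<close>
  define E where "E A v q = palm_event A q v / ((\<Prod>C\<in>q. weight_moment (card C) v) * mass_laplace v)"
    for A v and q :: "nat set set"
  have norm: "0 < (\<Prod>C\<in>q. weight_moment (card C) v) * mass_laplace v"
      "(\<Prod>C\<in>q. weight_moment (card C) v) * mass_laplace v \<noteq> \<top>" if "0 < v" "q \<in> P" for v q
    using that p[OF that(2)] weight_moment_pos weight_moment_finite[OF _ that(1)] mass_laplace_pos[of v] mass_laplace_finite[of v]
    by (auto simp: zero_less_iff_neq_zero ennreal_mult_eq_top_iff ennreal_prod_eq_top less_imp_neq)
  have em: "emeasure (?K (v, q)) A = E A v q" if A: "A \<in> sets (prob_algebra borel)" and v: "0 < v" and q: "q \<in> P" for A v q
  proof -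
    let ?k = "(\<Prod>C\<in>q. weight_moment (card C) v) * mass_laplace v"
    have "E A v q = ?k * emeasure (jump_mixture_law h \<rho> \<eta> v q) A / ?k"
      unfolding E_def by (rule arg_cong[OF emeasure_jump_mixture_law[OF v p[OF q] A, symmetric]])
    also have "\<dots> = emeasure (jump_mixture_law h \<rho> \<eta> v q) A"
      unfolding ennreal_times_divide[symmetric] by (rule ennreal_mult_divide_cancel[OF norm[OF v q]])
    finally show ?thesis by simp
  qed
  have E_meas: "(\<lambda>v. E A v q) \<in> borel_measurable ?R" if A: "A \<in> sets (prob_algebra borel)" and q: "q \<in> P" for A q
  proof -
    have "(\<lambda>v. E A v q) \<in> borel_measurable borel"
      unfolding E_def
      by (intro borel_measurable_divide_ennreal borel_measurable_times_ennreal borel_measurable_prod_ennreal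
        measurable_palm_event[OF A p(1)[OF q]] measurable_weight_moment measurable_mass_laplace)
    then show ?thesis by (intro measurable_restrict_space1) (simp only: measurable_lborel2)
  qed
  have K: "?K \<in> measurable ?M (subprob_algebra (prob_algebra borel))"
    unfolding measurable_cong_sets[OF sets_M refl]
  proof (rule measurable_pair_count_space_finite[OF fin_P])
    fix q assume q: "q \<in> P"
    show "(\<lambda>v. ?K (v, q)) \<in> measurable ?R (subprob_algebra (prob_algebra borel))"
    proof (rule measurable_subprob_algebra)
      show "subprob_space (?K (v, q))" if "v \<in> space ?R" for v
        using prob_space_jump_mixture_law[OF _ p[OF q], of v] that
        by (simp add: space_restrict_space prob_space_imp_subprob_space)
      show "sets (?K (v, q)) = sets (prob_algebra borel)" for v
        by (simp add: jump_mixture_law_def)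
      show "(\<lambda>v. emeasure (?K (v, q)) A) \<in> borel_measurable ?R" if A: "A \<in> sets (prob_algebra borel)" for A
        using E_meas[OF A q]
        by (rule measurable_cong[THEN iffD1, rotated]) (simp add: em[OF A _ q, simplified] space_restrict_space)
    qed
  qed
  \<comment> \<open>The partition with a single cell shows that the mixing law lives on a nonempty
    space, as the rules for \<open>bind\<close> require.\<close>
  have "{{1..n}} \<in> P" using n by (auto simp: P_def partition_on_def)
  then have ne: "space ?M \<noteq> {}" by (auto simp: space_M intro: exI[of _ "1::real"])
  show "sets ?l = sets (bind ?M ?K)"
    using ne by (subst sets_bind[where N="prob_algebra borel"])
      (auto simp: space_M jump_mixture_law_def)
  fix A assume "A \<in> sets ?l"
  then have A [measurable]: "A \<in> sets (prob_algebra borel)" by simp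
  let ?g = "\<lambda>v. ennreal (v powr (\<theta> + real n - 1) / Gamma (\<theta> + real n))"
  let ?d = "\<lambda>(v, q). (\<Prod>C\<in>q. kappa h \<rho> \<eta> (card C) v) * ?g v * laplace_mass h \<rho> \<eta> v / neg_moment h \<rho> \<eta> \<theta>"
  let ?c = "neg_moment h \<rho> \<eta> \<theta>"
  note lm = measurable_laplace_mass
  have g: "?g \<in> borel_measurable ?R" by (intro measurable_restrict_space1) measurable
  have d: "?d \<in> borel_measurable (?R \<Otimes>\<^sub>M count_space P)"
  proof (rule measurable_pair_count_space_finite[OF fin_P])
    fix q assume "q \<in> P"
    have "(\<lambda>v. \<Prod>C\<in>q. kappa h \<rho> \<eta> (card C) v) \<in> borel_measurable ?R"
      unfolding kappa_eq by (intro measurable_restrict_space1) measurable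
    then show "(\<lambda>v. ?d (v, q)) \<in> borel_measurable ?R"
      using lm g by simp
  qed
  have E: "(\<lambda>(v, q). E A v q) \<in> borel_measurable (?R \<Otimes>\<^sub>M count_space P)"
    by (rule measurable_pair_count_space_finite[OF fin_P]) (simp add: E_meas[OF A])
  interpret C: sigma_finite_measure "count_space P"
    by (rule sigma_finite_measure_count_space_finite[OF fin_P])
  have "emeasure (bind ?M ?K) A = (\<integral>\<^sup>+z. emeasure (?K z) A \<partial>?M)"
    by (rule emeasure_bind[OF ne K A])
  also have "\<dots> = (\<integral>\<^sup>+z. (case z of (v, q) \<Rightarrow> E A v q) \<partial>?M)"
    by (intro nn_integral_cong) (auto simp: space_M em[OF A, simplified])
  also have "\<dots> = (\<integral>\<^sup>+z. ?d z * (case z of (v, q) \<Rightarrow> E A v q) \<partial>(?R \<Otimes>\<^sub>M count_space P))"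
    unfolding partition_mixing_law_def P_def[symmetric] by (rule nn_integral_density[OF d E])
  also have "\<dots> = (\<integral>\<^sup>+v. (\<integral>\<^sup>+q. ?d (v, q) * E A v q \<partial>count_space P) \<partial>?R)"
    using d E by (subst C.nn_integral_fst[symmetric]) (simp_all add: case_prod_unfold)
  also have "\<dots> = (\<integral>\<^sup>+v. ?g v * (\<integral>\<^sup>+N. mass N ^ n * (nexp (ennreal v * mass N) * indicator A (norm_measure N)) \<partial>L) / ?c \<partial>?R)"
  proof (intro nn_integral_cong)
    fix v assume "v \<in> space ?R"
    then have v: "0 < v" by (simp add: space_restrict_space)
    have "?d (v, q) * E A v q = palm_event A q v * (?g v / ?c)" if q: "q \<in> P" for q
    proof -
      let ?k = "(\<Prod>C\<in>q. weight_moment (card C) v) * mass_laplace v"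
      have "?d (v, q) * E A v q = (palm_event A q v / ?k * ?k) * (?g v / ?c)"
        using v by (simp add: E_def kappa_eq laplace_mass_eq divide_ennreal_def ac_simps)
      also have "palm_event A q v / ?k * ?k = palm_event A q v"
        using ennreal_mult_divide_cancel[OF norm[OF v q]] by (simp add: mult.commute)
      finally show ?thesis .
    qed
    then have "(\<integral>\<^sup>+q. ?d (v, q) * E A v q \<partial>count_space P) = (\<Sum>q\<in>P. palm_event A q v * (?g v / ?c))"
      using fin_P by (subst nn_integral_count_space_finite) simp_all
    also have "\<dots> = (\<Sum>q\<in>P. palm_event A q v) * (?g v / ?c)"
      by (simp add: sum_distrib_right)
    also have "(\<Sum>q\<in>P. palm_event A q v) =
        (\<integral>\<^sup>+N. mass N ^ n * (nexp (ennreal v * mass N) * indicator A (norm_measure N)) \<partial>L)"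
      using mass_power_eq_sum_palm_integral[OF sigma_finite_\<nu>, of "\<lambda>z. ennreal (h (fst z))" "{1..n}"
          "\<lambda>N. nexp (ennreal v * mass N) * indicator A (norm_measure N)"]
      by (simp add: palm_event_def P_def)
    finally show "(\<integral>\<^sup>+q. ?d (v, q) * E A v q \<partial>count_space P) =
        ?g v * (\<integral>\<^sup>+N. mass N ^ n * (nexp (ennreal v * mass N) * indicator A (norm_measure N)) \<partial>L) / ?c"
      by (simp add: divide_ennreal_def ac_simps)
  qed
  also have "\<dots> = (\<integral>\<^sup>+v. ?g v * (\<integral>\<^sup>+N. mass N ^ n * (nexp (ennreal v * mass N) * indicator A (norm_measure N)) \<partial>L) \<partial>?R) / ?c"
    unfolding divide_ennreal_def
    by (rule nn_integral_multc) (intro borel_measurable_times_ennreal g measurable_restrict_space1, measurable)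
  also have "\<dots> = emeasure ?l A"
    using neg_power_mass_gamma[OF \<theta>, of "\<lambda>N. indicator A (norm_measure N)"]
    by (simp add: emeasure_normalized_law_tilted_law)
  finally show "emeasure ?l A = emeasure (bind ?M ?K) A" by simp
qed

end

theorem proposition5p2:
  fixes \<eta> :: "'y::polish_space measure"
    and \<rho> :: "'y \<Rightarrow> 's::polish_space measure"
    and h :: "'s \<Rightarrow> real"
    and M :: "'w measure"
    and N :: "'w \<Rightarrow> ('s \<times> 'y) measure"
  assumes "sets \<eta> = sets borel" and "sigma_finite_measure \<eta>" and "non_atomic \<eta>"
    and "sigma_finite_kernel \<rho>"
    and "h \<in> borel_measurable borel" and "\<And>s. 0 < h s"
    and "poisson_random_measure M N (intensity \<rho> \<eta>)"
    and "AE \<omega> in M. 0 < total_mass h (N \<omega>) \<and> total_mass h (N \<omega>) < \<infinity>"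
  shows "(\<forall>\<theta>::real. 0 < \<theta> \<longrightarrow> neg_moment h \<rho> \<eta> \<theta> < \<infinity> \<longrightarrow>
           normalized_law h (tilted_law h \<rho> \<eta> \<theta>) =
           bind (mixing_law h \<rho> \<eta> \<theta>)
             (\<lambda>v. normalized_law h (poisson_law (intensity (exp_tilt v h \<rho>) \<eta>)))) \<and>
         (\<forall>(n::nat) \<theta>::real. 1 \<le> n \<longrightarrow> 0 < \<theta> + real n \<longrightarrow>
           (\<theta> \<noteq> 0 \<longrightarrow> neg_moment h \<rho> \<eta> \<theta> < \<infinity> \<and> neg_moment h \<rho> \<eta> (\<theta> + real n) < \<infinity>) \<longrightarrow>
           normalized_law h (tilted_law h \<rho> \<eta> \<theta>) =
           bind (partition_mixing_law h \<rho> \<eta> n \<theta>)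
             (\<lambda>(v, p). jump_mixture_law h \<rho> \<eta> v p))"
proof -
  let ?\<nu> = "intensity \<rho> \<eta>"
  \<comment> \<open>The law of the given \<open>N\<close> on the space of measures supplies the
    existence of \<open>poisson_law\<close> for the untilted intensity.\<close>
  define L where "L = distr M (measure_algebra ?\<nu>) N"
  have N: "N \<in> measurable M (measure_algebra ?\<nu>)"
    using assms(7) by (simp add: poisson_random_measure_def)
  interpret L: poisson_laplace L ?\<nu>
    unfolding L_def by (rule poisson_laplace_distr[OF assms(7)])
  have [measurable_cong]: "sets ?\<nu> = sets (borel \<Otimes>\<^sub>M borel)" by (rule sets_intensity)
  have h: "(\<lambda>z. h (fst z)) \<in> borel_measurable ?\<nu>"
    unfolding measurable_cong_sets[OF sets_intensity refl] by (rule measurable_compose[OF measurable_fst assms(5)])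
  have T: "(\<lambda>K. \<integral>\<^sup>+z. ennreal (h (fst z)) \<partial>K) \<in> borel_measurable (measure_algebra ?\<nu>)"
    using h by (intro nn_integral_measurable_measure_algebra) simp
  have "poisson_mass L ?\<nu> (\<lambda>z. h (fst z))"
  proof
    have "AE \<omega> in M. 0 < (\<integral>\<^sup>+z. ennreal (h (fst z)) \<partial>N \<omega>) \<and> (\<integral>\<^sup>+z. ennreal (h (fst z)) \<partial>N \<omega>) < \<infinity>"
      using assms(8) AE_space
    proof eventually_elim
      case (elim \<omega>)
      then have "sets (N \<omega>) = sets (borel \<Otimes>\<^sub>M borel)"
        using measurable_space[OF N] by (simp add: space_measure_algebra sets_intensity)
      with elim show ?case by (simp add: total_mass_eq[OF assms(5)])
    qed
    then show "AE K in L. 0 < (\<integral>\<^sup>+z. ennreal (h (fst z)) \<partial>K) \<and> (\<integral>\<^sup>+z. ennreal (h (fst z)) \<partial>K) < \<infinity>"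
      unfolding L_def using T by (subst AE_distr_iff[OF N]) simp_all
  qed (use h assms(6) in auto)
  then interpret poisson_kernel \<eta> \<rho> h L
    by (intro poisson_kernel.intro assms(1,4,5,6))
  show ?thesis
    by (intro conjI allI impI normalized_law_tilted_law_eq_bind normalized_law_tilted_law_eq_bind_partition)
qed

end
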